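(* Let $d\ge 1$ be an integer and $0<\alpha<2$. Assume: (a) $\varphi:\mathbb{R}\to[0,\infty)$ is a convex differentiable function with $\varphi(0)=0$ and $\varphi(x)>0$ if $x\neq 0$; (b) $h:[0,\infty)\to[0,\infty)$ is a continuous function with $h(x)>0$ if $x\neq 0$; (c) $k:[0,\infty)\to[0,\infty)$ is a continuous function; (d) $\sup_{t\in[0,T]}\int_0^t\left(\int_s^t k(r)\,dr\right)^{-1/\alpha}ds<\infty$ for every $T>0$; (e) $u_0\in C_b(\mathbb{R}^d)\cap L^1(\mathbb{R}^d)$. Suppose in addition $u_0\ge 0$ and $\|u_0\|_1>0$, and let $u$ be the solution in $C_b^{1,2}((0,\infty)\times\mathbb{R}^d)$ of $$\partial_t u(t,x)=k(t)\Delta_\alpha u(t,x)-h(t)\varphi(u(t,x)),\quad (t,x)\in(0,\infty)\times\mathbb{R}^d,\qquad u(0,x)=u_0(x),\quad x\in\mathbb{R}^d.$$ For $t\ge 0$ set $M(t)=\int_{\mathbb{R}^d}u(t,x)\,dx$. Then $$M(t)\ge \|u_0\|_1\exp\left\{-\frac{\varphi(\|u_0\|_u)}{\|u_0\|_u}\int_0^t h(s)\,ds\right\}\quad\text{for all }t\ge 0.$$ Moreover, the limit $M(\infty)=\lim_{t\to\infty}M(t)$ exists, and $M(\infty)>0$ if $\int_0^\infty h(s)\,ds<\infty$.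
   Context: $C_b(\mathbb{R}^d)$ is the space of bounded continuous real functions on $\mathbb{R}^d$; $C_b^2(\mathbb{R}^d)$ is the space of $C^2$ functions that are bounded together with their derivatives up to order two. $\|\cdot\|_1$ is the $L^1(\mathbb{R}^d)$ norm and $\|f\|_u=\sup_{x\in\mathbb{R}^d}|f(x)|$ is the uniform norm. $\Delta_\alpha=-(-\Delta)^{\alpha/2}$ is the fractional Laplacian (Fourier symbol $-\|\xi\|^\alpha$), defined on $C_b^2(\mathbb{R}^d)$ by $$\Delta_\alpha f(x)=c\left(\int_{\|z\|<r}\frac{f(x+z)-f(x)-\nabla f(x)\cdot z}{\|z\|^{d+\alpha}}dz+\int_{\|z\|\ge r}\frac{f(x+z)-f(x)}{\|z\|^{d+\alpha}}dz\right),$$ where $c=c(\alpha,d)>0$ is the normalizing constant giving the symbol $-\|\xi\|^\alpha$, and the value does not depend on $r>0$. In the equation $\Delta_\alpha$ acts in the $x$ variable. A solution $u\in C_b^{1,2}((0,\infty)\times\mathbb{R}^d)$ is a classical one: $u$ is bounded, continuous on $[0,\infty)\times\mathbb{R}^d$ with $u(0,\cdot)=u_0$, continuously differentiable in $t$ on $(0,\infty)\times\mathbb{R}^d$, $u(t,\cdot)\in C_b^2(\mathbb{R}^d)$ for each $t>0$, and the equation holds pointwise for $t>0$. Under the hypotheses, for $u_0\ge0$ such a solution exists, is unique and is non-negative. *)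

theory Defs
  imports "HOL-Analysis.Analysis"
begin

text \<open>
  The space \<open>\<real>\<^sup>d\<close> is an arbitrary type \<open>'a :: euclidean_space\<close>, with \<open>d = DIM('a)\<close>.
\<close>

text \<open>
  The singular integral in the fractional Laplacian, without the normalizing constant.
  On bounded \<open>C\<^sup>2\<close> functions its value does not depend on the radius at which the two
  integrals are separated; we use radius 1. The term \<open>frechet_derivative f (at x) z\<close> is
  the scalar product of the gradient of \<open>f\<close> at \<open>x\<close> with \<open>z\<close>. Complex values are needed
  only to apply the operator to \<open>x \<mapsto> exp (\<i> \<xi> \<bullet> x)\<close>.
\<close>

definition frac_singular_integral ::
  "real \<Rightarrow> ('a::euclidean_space \<Rightarrow> 'b::{banach, second_countable_topology}) \<Rightarrow> 'a \<Rightarrow> 'b" where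
  "frac_singular_integral \<alpha> f x =
     (LINT z:{z. norm z < 1}|lborel.
        (f (x + z) - f x - frechet_derivative f (at x) z) /\<^sub>R (norm z powr (real DIM('a) + \<alpha>)))
   + (LINT z:{z. norm z \<ge> 1}|lborel.
        (f (x + z) - f x) /\<^sub>R (norm z powr (real DIM('a) + \<alpha>)))"

text \<open>
  The constant \<open>c(\<alpha>, d)\<close> giving the operator the symbol \<open>\<xi> \<mapsto> - norm \<xi> powr \<alpha>\<close>, that is,
  making each character \<open>x \<mapsto> exp (\<i> \<xi> \<bullet> x)\<close> an eigenfunction with this eigenvalue.
  The first argument only carries the type \<open>'a\<close>, hence the dimension.
\<close>

definition frac_laplacian_const :: "'a::euclidean_space itself \<Rightarrow> real \<Rightarrow> real" where
  "frac_laplacian_const T \<alpha> =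
     (THE c. c > 0 \<and>
        (\<forall>(\<xi>::'a) x. c *\<^sub>R frac_singular_integral \<alpha> (\<lambda>y. cis (\<xi> \<bullet> y)) x
                    = (- (norm \<xi> powr \<alpha>)) *\<^sub>R cis (\<xi> \<bullet> x)))"

definition frac_laplacian :: "real \<Rightarrow> ('a::euclidean_space \<Rightarrow> real) \<Rightarrow> 'a \<Rightarrow> real" where
  "frac_laplacian \<alpha> f x =
     frac_laplacian_const TYPE('a) \<alpha> * frac_singular_integral \<alpha> f x"

definition Cb :: "('a::euclidean_space \<Rightarrow> real) set" where
  "Cb = {f. continuous_on UNIV f \<and> bounded (range f)}"

text \<open>In \<open>Cb2\<close>, \<open>g\<close> is the gradient of \<open>f\<close> and \<open>H\<close> its Hessian.\<close>

definition Cb2 :: "('a::euclidean_space \<Rightarrow> real) set" where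
  "Cb2 = {f. bounded (range f) \<and>
     (\<exists>(g :: 'a \<Rightarrow> 'a) (H :: 'a \<Rightarrow> 'a \<Rightarrow>\<^sub>L 'a).
        (\<forall>x. (f has_derivative (\<lambda>z. g x \<bullet> z)) (at x)) \<and>
        (\<forall>x. (g has_derivative blinfun_apply (H x)) (at x)) \<and>
        continuous_on UNIV H \<and> bounded (range g) \<and> bounded (range H))}"

definition L1_norm :: "('a::euclidean_space \<Rightarrow> real) \<Rightarrow> real" where
  "L1_norm f = (LINT x|lborel. \<bar>f x\<bar>)"

definition unif_norm :: "('a::euclidean_space \<Rightarrow> real) \<Rightarrow> real" where
  "unif_norm f = (SUP x. \<bar>f x\<bar>)"

text \<open>
  Classical solutions of \<open>\<partial>\<^sub>t u = k(t) \<Delta>\<^sub>\<alpha> u - h(t) \<phi>(u)\<close>, \<open>u(0, \<cdot>) = u\<^sub>0\<close>; only the values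
  \<open>u t x\<close> with \<open>t \<ge> 0\<close> matter, and \<open>ut\<close> is the time derivative.
\<close>

definition classical_solution ::
  "real \<Rightarrow> (real \<Rightarrow> real) \<Rightarrow> (real \<Rightarrow> real) \<Rightarrow> (real \<Rightarrow> real) \<Rightarrow> ('a::euclidean_space \<Rightarrow> real)
     \<Rightarrow> (real \<Rightarrow> 'a \<Rightarrow> real) \<Rightarrow> bool" where
  "classical_solution \<alpha> k h \<phi> u0 u \<longleftrightarrow>
     bounded ((\<lambda>(t, x). u t x) ` ({0..} \<times> UNIV)) \<and>
     continuous_on ({0..} \<times> UNIV) (\<lambda>(t, x). u t x) \<and>
     (\<forall>x. u 0 x = u0 x) \<and>
     (\<forall>t>0. u t \<in> Cb2) \<and>
     (\<exists>ut :: real \<Rightarrow> 'a \<Rightarrow> real.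
        continuous_on ({0<..} \<times> UNIV) (\<lambda>(t, x). ut t x) \<and>
        (\<forall>t>0. \<forall>x. ((\<lambda>s. u s x) has_real_derivative ut t x) (at t)) \<and>
        (\<forall>t>0. \<forall>x. ut t x = k t * frac_laplacian \<alpha> (u t) x - h t * \<phi> (u t x)))"

text \<open>
  The integral may be infinite, and so may the integrand: in \<^typ>\<open>ennreal\<close>, \<open>inverse 0 = \<infinity>\<close>,
  so \<open>inverse (ennreal (K powr (1 / \<alpha>)))\<close> is \<open>K\<close> to the power \<open>-1/\<alpha>\<close> with value \<open>\<infinity>\<close> at
  \<open>K = 0\<close>, whereas \<open>0 powr (-1/\<alpha>) = 0\<close> over the reals.
\<close>

definition neg_power_integral :: "real \<Rightarrow> (real \<Rightarrow> real) \<Rightarrow> real \<Rightarrow> ennreal" where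
  "neg_power_integral \<alpha> k t =
     (\<integral>\<^sup>+s\<in>{0..t}. inverse (ennreal ((LINT r:{s..t}|lborel. k r) powr (1 / \<alpha>))) \<partial>lborel)"

end

theory Submission
  imports Defs
begin

(* Let rho(x) = (1 + |x|^2)^(-(d + \<alpha>)/2). This weight is integrable, tends to 1 under the scaling
   rho_R(x) = rho(x / R), and |Delta_\<alpha> rho_R| is at most C R^(-\<alpha>) rho_R. A maximum principle gives
   0 <= u <= U for U = sup u0, hence phi(u) <= (phi(U) / U) u by convexity. Testing the equation with rho_R
   and moving Delta_\<alpha> to the weight, Gronwall's lemma shows that the integral of u(t) rho_R grows at
   most by exp(C R^(-\<alpha>) K(t)) and decays at most by this factor and exp(- (phi(U) / U) H(t)), where K
   and H are the primitives of k and h up to constants. Letting R tend to infinity, the mass is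
   nonincreasing and obeys the claimed lower bound. Nothing controls the C^2 norms of u(t) locally uniformly
   in t, so differentiation under the integral is done for truncations of rho with compact support, whose
   second differences obey the same bound uniformly. *)

section \<open>Affine substitutions and the jump kernel\<close>

text \<open>A compactly supported test function would not close the estimate: Delta_\<alpha> is
  nonlocal, so outside the support of such a bump it leaves a tail of order |x|^(-d-\<alpha>), which
  the bump cannot dominate. The exponent of rho matches this tail, so the diffusion error in the
  weighted mass is a multiple of the weighted mass itself. For the truncations the mismatch returns:
  their error is controlled only by the full weight. Hence Gronwall's argument is not applied to
  them; the differential inequality is integrated in time, the truncation level is sent to 0, and
  Gronwall is applied to the resulting integral inequality. The upper estimate gives more than
  monotonicity: integrability of u(t) for t > 0 is not part of being a classical solution and comes
  from this estimate by Fatou's lemma; without it the integral M(t) would be 0 by default. Writing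
  the operator with symmetric second differences avoids gradients of the weight and reduces its
  symmetry to translation invariance of Lebesgue measure.\<close>

lemma nn_integral_lborel_affine:
  fixes f :: "'a::euclidean_space \<Rightarrow> ennreal"
  assumes [measurable]: "f \<in> borel_measurable borel" and "c \<noteq> 0"
  shows "(\<integral>\<^sup>+x. f x \<partial>lborel) = ennreal (\<bar>c\<bar> ^ DIM('a)) * (\<integral>\<^sup>+x. f (t + c *\<^sub>R x) \<partial>lborel)"
  by (subst lborel_affine[OF \<open>c \<noteq> 0\<close>, of t])
     (simp add: nn_integral_density nn_integral_distr nn_integral_cmult)

lemma integrable_lborel_affine:
  fixes f :: "'a::euclidean_space \<Rightarrow> 'b::{banach, second_countable_topology}"
  assumes [measurable]: "f \<in> borel_measurable borel" and "c \<noteq> 0"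
  shows "integrable lborel (\<lambda>x. f (t + c *\<^sub>R x)) \<longleftrightarrow> integrable lborel f"
proof -
  have "(\<integral>\<^sup>+x. norm (f x) \<partial>lborel)
      = ennreal (\<bar>c\<bar> ^ DIM('a)) * (\<integral>\<^sup>+x. norm (f (t + c *\<^sub>R x)) \<partial>lborel)"
    using \<open>c \<noteq> 0\<close> by (intro nn_integral_lborel_affine) auto
  moreover have "ennreal (\<bar>c\<bar> ^ DIM('a)) \<noteq> 0"
    using \<open>c \<noteq> 0\<close> by simp
  ultimately show ?thesis
    unfolding integrable_iff_bounded by (auto simp: ennreal_mult_less_top)
qed

lemma integral_lborel_affine:
  fixes f :: "'a::euclidean_space \<Rightarrow> 'b::{banach, second_countable_topology}"
  assumes [measurable]: "f \<in> borel_measurable borel" and "c \<noteq> 0"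
  shows "(LINT x|lborel. f x) = \<bar>c\<bar> ^ DIM('a) *\<^sub>R (LINT x|lborel. f (t + c *\<^sub>R x))"
  by (subst lborel_affine[OF \<open>c \<noteq> 0\<close>, of t])
     (simp add: integral_density integral_distr)

lemmas integral_lborel_translate = integral_lborel_affine[where c=1, simplified]
lemmas integral_lborel_uminus = integral_lborel_affine[where c="-1" and t=0, simplified]
lemmas integrable_lborel_translate = integrable_lborel_affine[where c=1, simplified]
lemmas integrable_lborel_uminus = integrable_lborel_affine[where c="-1" and t=0, simplified]
lemmas nn_integral_lborel_translate = nn_integral_lborel_affine[where c=1, simplified]

text \<open>Up to a constant, the Levy density of the isotropic \<alpha>-stable process. At the
  origin it takes the value 0, since \<open>0 powr _ = 0\<close> and
  \<open>inverse 0 = 0\<close>.\<close>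

definition jump_kernel :: "real \<Rightarrow> 'a::euclidean_space \<Rightarrow> real" where
  "jump_kernel \<alpha> z = inverse (norm z powr (real DIM('a) + \<alpha>))"

lemma jump_kernel_nonneg [simp]: "jump_kernel \<alpha> z \<ge> 0"
  by (simp add: jump_kernel_def)

lemma jump_kernel_measurable [measurable]: "jump_kernel \<alpha> \<in> borel_measurable borel"
  unfolding jump_kernel_def[abs_def] by measurable

lemma jump_kernel_uminus [simp]: "jump_kernel \<alpha> (- z) = jump_kernel \<alpha> z"
  by (simp add: jump_kernel_def)

lemma jump_kernel_scaleR:
  fixes z :: "'a::euclidean_space"
  shows "c > 0 \<Longrightarrow> jump_kernel \<alpha> (c *\<^sub>R z) = c powr - (real DIM('a) + \<alpha>) * jump_kernel \<alpha> z"
  unfolding jump_kernel_def by (subst powr_minus) (simp add: powr_mult)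

text \<open>Near 0 the integrand is r powr (1 - \<alpha>), integrable because \<alpha> < 2; near
  infinity it is r powr (-1 - \<alpha>), integrable because \<alpha> > 0. This is the radial form of
  the Levy condition on the jump kernel.\<close>

lemma radial_weight_integral_finite:
  assumes "0 < \<alpha>" "\<alpha> < 2"
  shows "(\<integral>\<^sup>+r. ennreal (min 1 (r\<^sup>2) * r powr (- 1 - \<alpha>)) * indicator {0<..} r \<partial>lborel) < \<infinity>"
proof -
  have "((\<lambda>r. r powr (1 - \<alpha>)) has_integral (1 powr (1 - \<alpha> + 1) / (1 - \<alpha> + 1))) {0..1}"
    using assms by (intro has_integral_powr_from_0) auto
  from nn_integral_has_integral_lebesgue[OF _ this]
  have 1: "(\<integral>\<^sup>+r. ennreal (indicator {0..1} r * r powr (1 - \<alpha>)) \<partial>lborel) < \<infinity>" by simp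
  have "((\<lambda>r. r powr (-1 - \<alpha>)) has_integral (- (1 powr (-1 - \<alpha> + 1)) / (-1 - \<alpha> + 1))) {1..}"
    using assms by (intro has_integral_powr_to_inf) auto
  from nn_integral_has_integral_lebesgue[OF _ this]
  have 2: "(\<integral>\<^sup>+r. ennreal (indicator {1..} r * r powr (-1 - \<alpha>)) \<partial>lborel) < \<infinity>" by simp
  have "(\<integral>\<^sup>+r. ennreal (min 1 (r\<^sup>2) * r powr (- 1 - \<alpha>)) * indicator {0<..} r \<partial>lborel)
     \<le> (\<integral>\<^sup>+r. ennreal (indicator {0..1} r * r powr (1 - \<alpha>))
          + ennreal (indicator {1..} r * r powr (-1 - \<alpha>)) \<partial>lborel)"
  proof (rule nn_integral_mono)
    fix r :: real
    have "r\<^sup>2 * r powr (-1 - \<alpha>) = r powr (1 - \<alpha>)" if "r > 0"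
      using that by (simp flip: powr_numeral powr_add)
    moreover have "min 1 (r\<^sup>2) * r powr (-1 - \<alpha>) \<le> r\<^sup>2 * r powr (-1 - \<alpha>)"
      "min 1 (r\<^sup>2) * r powr (-1 - \<alpha>) \<le> 1 * r powr (-1 - \<alpha>)"
      by (intro mult_right_mono; simp)+
    ultimately show "ennreal (min 1 (r\<^sup>2) * r powr (- 1 - \<alpha>)) * indicator {0<..} r
      \<le> ennreal (indicator {0..1} r * r powr (1 - \<alpha>)) + ennreal (indicator {1..} r * r powr (-1 - \<alpha>))"
      by (auto simp: indicator_def ennreal_leI simp flip: ennreal_plus)
  qed
  also have "\<dots> < \<infinity>"
    using 1 2 by (subst nn_integral_add) auto
  finally show ?thesis .
qed

(* A point z is captured by all radii r between |z| and 2|z|; Fubini then reduces the integral to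
   the radial one without polar coordinates. *)
lemma nn_integral_jump_kernel_finite:
  assumes "0 < \<alpha>" "\<alpha> < 2"
  shows "(\<integral>\<^sup>+z. ennreal (min 1 ((norm z)\<^sup>2) * jump_kernel \<alpha> z) \<partial>(lborel::'a::euclidean_space measure)) < \<infinity>"
proof -
  let ?p = "real DIM('a) + \<alpha>"
  \<comment> \<open>The radii that capture z fill an interval of length \<open>norm z\<close>, so
    the radial weight carries one more negative power than the kernel. On this interval r is at most
    2 |z|, which costs the factor \<open>?C\<close>.\<close>
  let ?w = "\<lambda>r::real. min 1 (r\<^sup>2) * r powr (- ?p - 1)"
  let ?C = "2 powr (?p + 1)"
  let ?S = "{(z::'a, r). norm z \<le> r \<and> r \<le> 2 * norm z}"
  have "closed ?S"
    unfolding case_prod_beta by (intro closed_Collect_conj closed_Collect_le continuous_intros)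
  then have [measurable]: "?S \<in> sets (borel \<Otimes>\<^sub>M borel)"
    unfolding borel_prod by (rule borel_closed)
  define G where "G z r = ennreal ?C * (ennreal (?w r) * indicator ?S (z, r) * indicator {0<..} r)" for z r
  have meas: "(\<lambda>(z, r). G z r) \<in> borel_measurable (lborel \<Otimes>\<^sub>M lborel)"
  proof -
    have "(\<lambda>x. ennreal ?C * (ennreal (?w (snd x)) * indicator {0<..} (snd x)) * indicator ?S x)
        \<in> borel_measurable (borel \<Otimes>\<^sub>M borel)"
      using \<open>?S \<in> sets (borel \<Otimes>\<^sub>M borel)\<close>
      by (intro borel_measurable_times_ennreal borel_measurable_indicator measurable_compose[OF measurable_snd]) auto
    then show ?thesis
      by (simp add: G_def case_prod_beta mult_ac cong: measurable_cong_sets sets_pair_measure_cong)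
  qed
  have ptw: "ennreal (min 1 ((norm z)\<^sup>2) * jump_kernel \<alpha> z)
      \<le> (\<integral>\<^sup>+r. G z r \<partial>lborel)"
    for z :: 'a
  proof (cases "z = 0")
    case False
    then have z: "norm z > 0" by simp
    define m where "m = min 1 ((norm z)\<^sup>2) * (2 * norm z) powr (- ?p - 1)"
    have "ennreal (min 1 ((norm z)\<^sup>2) * jump_kernel \<alpha> z) = ennreal (?C * m) * ennreal (norm z)"
    proof -
      have "?C * (2 * norm z) powr (- ?p - 1) * norm z = jump_kernel \<alpha> z"
        using z assms by (simp add: powr_mult jump_kernel_def powr_diff powr_minus powr_add field_simps)
      then show ?thesis
        by (simp add: m_def ennreal_mult'[symmetric] mult_ac)
    qed
    also have "\<dots> = (\<integral>\<^sup>+r. ennreal (?C * m) * indicator {norm z..2 * norm z} r \<partial>lborel)"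
      by (subst nn_integral_cmult_indicator) auto
    also have "\<dots> \<le> (\<integral>\<^sup>+r. G z r \<partial>lborel)"
    proof (rule nn_integral_mono)
      fix r
      have "m \<le> ?w r" if "norm z \<le> r" "r \<le> 2 * norm z"
        unfolding m_def using that z assms less_le_trans[OF z that(1)]
        by (intro mult_mono powr_mono2' min.mono power_mono) auto
      then show "ennreal (?C * m) * indicator {norm z..2 * norm z} r \<le> G z r"
        using z less_le_trans[OF z, of r]
        by (auto simp: G_def indicator_def ennreal_mult'[symmetric] intro!: ennreal_leI)
    qed
    finally show ?thesis .
  qed (simp add: jump_kernel_def)
  have "(\<integral>\<^sup>+z. ennreal (min 1 ((norm z)\<^sup>2) * jump_kernel \<alpha> z) \<partial>(lborel::'a measure))
    \<le> (\<integral>\<^sup>+z. (\<integral>\<^sup>+r. G z r \<partial>lborel) \<partial>(lborel::'a measure))"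
    by (rule nn_integral_mono) (rule ptw)
  also have "\<dots> = (\<integral>\<^sup>+r. (\<integral>\<^sup>+z. G z r \<partial>lborel) \<partial>lborel)"
    by (rule lborel_pair.Fubini'[symmetric, OF meas])
  \<comment> \<open>For fixed r all admissible z lie in a ball of radius r; its volume, of order
    r^d, turns r powr (- ?p - 1) into r powr (-1 - \<alpha>).\<close>
  also have "\<dots> \<le> (\<integral>\<^sup>+r. ennreal (?C * unit_ball_vol (real DIM('a)))
      * (ennreal (min 1 (r\<^sup>2) * r powr (- 1 - \<alpha>)) * indicator {0<..} r) \<partial>lborel)"
  proof (rule nn_integral_mono)
    fix r :: real
    have "(\<integral>\<^sup>+z. G z r \<partial>lborel)
       \<le> (\<integral>\<^sup>+z. ennreal ?C * ennreal (?w r) * indicator {0<..} r * indicator (cball (0::'a) r) z \<partial>lborel)"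
      by (intro nn_integral_mono) (auto simp: G_def indicator_def)
    also have "\<dots> = ennreal ?C * ennreal (?w r) * indicator {0<..} r * emeasure lborel (cball (0::'a) r)"
      by (subst nn_integral_cmult_indicator) auto
    also have "\<dots> = ennreal (?C * unit_ball_vol (real DIM('a)))
      * (ennreal (min 1 (r\<^sup>2) * r powr (- 1 - \<alpha>)) * indicator {0<..} r)"
    proof (cases "r > 0")
      case True
      have "?w r * r ^ DIM('a) = min 1 (r\<^sup>2) * r powr (- 1 - \<alpha>)"
      proof -
        have "r powr (- ?p - 1) * r ^ DIM('a) = r powr (- 1 - \<alpha>)"
          using True by (simp add: minus_diff_commute flip: powr_realpow powr_add)
        then show ?thesis by (simp add: mult.assoc)
      qed
      then have "?C * unit_ball_vol (real DIM('a)) * (min 1 (r\<^sup>2) * r powr (- 1 - \<alpha>))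
        = ?C * unit_ball_vol (real DIM('a)) * (?w r * r ^ DIM('a))"
        by (simp only:)
      then show ?thesis
        using True
        by (simp only: emeasure_cball[OF less_imp_le[OF True]] ennreal_mult'[symmetric] mult.assoc[symmetric])
           (auto simp: ennreal_mult'[symmetric] mult_ac)
    qed simp
    finally show "(\<integral>\<^sup>+z. G z r \<partial>lborel) \<le> ennreal (?C * unit_ball_vol (real DIM('a)))
      * (ennreal (min 1 (r\<^sup>2) * r powr (- 1 - \<alpha>)) * indicator {0<..} r)" .
  qed
  also have "\<dots> < \<infinity>"
    using radial_weight_integral_finite[OF assms] by (subst nn_integral_cmult) (auto simp: ennreal_mult_less_top)
  finally show ?thesis .
qed

lemma integrable_jump_kernel:
  assumes "0 < \<alpha>" "\<alpha> < 2"
  shows "integrable lborel (\<lambda>z::'a::euclidean_space. min 1 ((norm z)\<^sup>2) * jump_kernel \<alpha> z)"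
  using nn_integral_jump_kernel_finite[OF assms, where 'a='a]
  by (auto simp: integrable_iff_bounded abs_mult)

section \<open>Symmetric second differences\<close>

definition diff2 :: "('a::real_vector \<Rightarrow> 'b::real_vector) \<Rightarrow> 'a \<Rightarrow> 'a \<Rightarrow> 'b" where
  "diff2 f x z = f (x + z) + f (x - z) - 2 *\<^sub>R f x"

text \<open>Twice the singular integral of the fractional Laplacian on smooth functions. The linear
  terms at z and -z cancel, so neither a gradient nor a cutoff radius appears, and the expression
  can be applied to the truncated weights directly.\<close>

definition diff2_integral ::
    "real \<Rightarrow> ('a::euclidean_space \<Rightarrow> 'b::{banach, second_countable_topology}) \<Rightarrow> 'a \<Rightarrow> 'b" where
  "diff2_integral \<alpha> f x = (LINT z|lborel. jump_kernel \<alpha> z *\<^sub>R diff2 f x z)"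

lemma integrable_jump_kernel_scaleR:
  fixes w :: "'a::euclidean_space \<Rightarrow> 'b::{banach, second_countable_topology}"
  assumes "0 < \<alpha>" "\<alpha> < 2" and [measurable]: "w \<in> borel_measurable borel"
    and w: "\<And>z. norm (w z) \<le> C * min 1 ((norm z)\<^sup>2)"
  shows "integrable lborel (\<lambda>z. jump_kernel \<alpha> z *\<^sub>R w z)"
proof (rule Bochner_Integration.integrable_bound)
  show "integrable lborel (\<lambda>z::'a. C * (min 1 ((norm z)\<^sup>2) * jump_kernel \<alpha> z))"
    by (intro integrable_mult_right integrable_jump_kernel assms)
  show "AE z in lborel. norm (jump_kernel \<alpha> z *\<^sub>R w z)
      \<le> norm (C * (min 1 ((norm z)\<^sup>2) * jump_kernel \<alpha> z))"
  proof (rule AE_I2)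
    fix z :: 'a
    have "norm (jump_kernel \<alpha> z *\<^sub>R w z) \<le> jump_kernel \<alpha> z * (C * min 1 ((norm z)\<^sup>2))"
      by (simp add: mult_left_mono w)
    also have "\<dots> = C * (min 1 ((norm z)\<^sup>2) * jump_kernel \<alpha> z)"
      by (simp only: mult_ac)
    also have "\<dots> \<le> norm (C * (min 1 ((norm z)\<^sup>2) * jump_kernel \<alpha> z))"
      unfolding real_norm_def by (rule abs_ge_self)
    finally show "norm (jump_kernel \<alpha> z *\<^sub>R w z) \<le> norm (C * (min 1 ((norm z)\<^sup>2) * jump_kernel \<alpha> z))" .
  qed
qed measurable

text \<open>For small z add the two first-order Taylor remainders, whose linear parts cancel; for
  large z use the uniform bound. The result is the profile min 1 |z|^2 against which the jump kernel
  is integrable.\<close>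

lemma norm_diff2_le:
  fixes f :: "'a::real_normed_vector \<Rightarrow> 'b::real_normed_vector"
  assumes "\<And>y. norm (f y) \<le> B" "linear f'"
    and "\<And>z. norm (f (x + z) - f x - f' z) \<le> C * (norm z)\<^sup>2"
  shows "norm (diff2 f x z) \<le> (4 * B + 2 * C) * min 1 ((norm z)\<^sup>2)"
proof -
  have B: "B \<ge> 0" using order_trans[OF norm_ge_zero assms(1)] .
  have C: "C * (norm z)\<^sup>2 \<ge> 0" using order_trans[OF norm_ge_zero assms(3)] .
  have eq: "diff2 f x z = (f (x + z) - f x - f' z) + (f (x + - z) - f x - f' (- z))"
    by (simp add: diff2_def linear_neg[OF assms(2)] scaleR_2)
  have n1: "norm (diff2 f x z) \<le> C * (norm z)\<^sup>2 + C * (norm z)\<^sup>2"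
    unfolding eq using assms(3)[of z] assms(3)[of "- z"] by (intro norm_triangle_le) auto
  have n2: "norm (diff2 f x z) \<le> B + B + 2 * B"
    unfolding diff2_def
    by (intro norm_triangle_le_diff add_mono norm_triangle_le assms(1)) (use assms(1) in auto)
  have n3: "C * (norm z)\<^sup>2 + C * (norm z)\<^sup>2 \<le> (4 * B + 2 * C) * (norm z)\<^sup>2"
    using B by (simp add: distrib_right)
  show ?thesis
  proof (cases "(norm z)\<^sup>2 \<le> 1")
    case True
    then show ?thesis using n1 n3 by (simp only: min_absorb2)
  next
    case False
    \<comment> \<open>The sign of C is not assumed; it follows from the remainder bound at any
      nonzero z.\<close>
    then have "C \<ge> 0" using C by (cases "z = 0") (auto simp: zero_le_mult_iff)
    with False show ?thesis using n2 by simp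
  qed
qed

lemma diff2_measurable [measurable]:
  fixes f :: "'a::euclidean_space \<Rightarrow> 'b::{banach, second_countable_topology}"
  assumes [measurable]: "f \<in> borel_measurable borel"
  shows "diff2 f x \<in> borel_measurable borel"
  unfolding diff2_def[abs_def] by measurable

lemma diff2_measurable2 [measurable]:
  fixes f :: "'a::euclidean_space \<Rightarrow> 'b::{banach, second_countable_topology}"
  assumes [measurable]: "f \<in> borel_measurable borel"
  shows "(\<lambda>(x, z). diff2 f x z) \<in> borel_measurable (borel \<Otimes>\<^sub>M borel)"
  unfolding diff2_def[abs_def] by measurable

text \<open>Both pieces of the singular integral converge absolutely, so they may be joined and
  averaged with their reflections under z -> -z. The cutoff ball is symmetric and the linear term
  odd, so only the second difference survives.\<close>

lemma frac_singular_integral_eq_diff2: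
  fixes f :: "'a::euclidean_space \<Rightarrow> 'b::{banach, second_countable_topology}"
  assumes \<alpha>: "0 < \<alpha>" "\<alpha> < 2" and f[measurable]: "f \<in> borel_measurable borel"
    and B: "\<And>y. norm (f y) \<le> B" and f': "bounded_linear f'"
    and C: "\<And>z. norm (f (x + z) - f x - f' z) \<le> C * (norm z)\<^sup>2"
    and frechet: "frechet_derivative f (at x) = f'"
  shows "frac_singular_integral \<alpha> f x = (1/2) *\<^sub>R diff2_integral \<alpha> f x"
proof -
  have [measurable]: "f' \<in> borel_measurable borel"
    using f' by (intro borel_measurable_continuous_onI linear_continuous_on)
  define w1 where "w1 z = indicator {z. norm z < 1} z *\<^sub>R (f (x + z) - f x - f' z)" for z
  define w2 where "w2 z = indicator {z. norm z \<ge> 1} z *\<^sub>R (f (x + z) - f x)" for z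
  have [measurable]: "w1 \<in> borel_measurable borel" "w2 \<in> borel_measurable borel"
    unfolding w1_def w2_def by measurable
  have C0: "C * (norm z)\<^sup>2 \<ge> 0" for z :: 'a using order_trans[OF norm_ge_zero C] .
  have w1: "integrable lborel (\<lambda>z. jump_kernel \<alpha> z *\<^sub>R w1 z)"
  proof (rule integrable_jump_kernel_scaleR[OF \<alpha>, where C=C])
    show "norm (w1 z) \<le> C * min 1 ((norm z)\<^sup>2)" for z
    proof (cases "norm z < 1")
      case True
      then have "(norm z)\<^sup>2 \<le> 1" by (simp add: power_le_one)
      then show ?thesis using C[of z] True by (simp add: w1_def)
    next
      case False
      then have "C \<ge> 0" using C0[of z] by (auto simp: zero_le_mult_iff)
      then show ?thesis using False by (simp add: w1_def)
    qed
  qed measurable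
  have w2: "integrable lborel (\<lambda>z. jump_kernel \<alpha> z *\<^sub>R w2 z)"
  proof (rule integrable_jump_kernel_scaleR[OF \<alpha>, where C="2 * B"])
    show "norm (w2 z) \<le> 2 * B * min 1 ((norm z)\<^sup>2)" for z
    proof (cases "norm z < 1")
      case False
      have "norm (f (x + z) - f x) \<le> B + B"
        by (intro norm_triangle_le_diff add_mono B)
      then show ?thesis using False by (auto simp: w2_def min_def one_le_power)
    qed (use order_trans[OF norm_ge_zero B] in \<open>auto simp: w2_def\<close>)
  qed measurable
  define w where "w z = w1 z + w2 z" for z
  have [measurable]: "w \<in> borel_measurable borel" unfolding w_def by measurable
  have w: "integrable lborel (\<lambda>z. jump_kernel \<alpha> z *\<^sub>R w z)"
    unfolding w_def scaleR_add_right by (intro Bochner_Integration.integrable_add w1 w2)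
  have "frac_singular_integral \<alpha> f x
      = (LINT z|lborel. jump_kernel \<alpha> z *\<^sub>R w1 z) + (LINT z|lborel. jump_kernel \<alpha> z *\<^sub>R w2 z)"
    unfolding frac_singular_integral_def frechet set_lebesgue_integral_def
    by (intro arg_cong2[where f="(+)"] Bochner_Integration.integral_cong)
       (simp_all add: w1_def w2_def jump_kernel_def)
  also have "\<dots> = (LINT z|lborel. jump_kernel \<alpha> z *\<^sub>R w z)"
    unfolding w_def scaleR_add_right using w1 w2 by simp
  finally have I: "frac_singular_integral \<alpha> f x = (LINT z|lborel. jump_kernel \<alpha> z *\<^sub>R w z)" .
  have w': "integrable lborel (\<lambda>z. jump_kernel \<alpha> z *\<^sub>R w (- z))"
    using integrable_lborel_uminus[of "\<lambda>z. jump_kernel \<alpha> z *\<^sub>R w z"] w by simp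
  have "(LINT z|lborel. jump_kernel \<alpha> z *\<^sub>R w z) = (LINT z|lborel. jump_kernel \<alpha> z *\<^sub>R w (- z))"
    using integral_lborel_uminus[of "\<lambda>z. jump_kernel \<alpha> z *\<^sub>R w z"] by simp
  then have "2 *\<^sub>R frac_singular_integral \<alpha> f x
      = (LINT z|lborel. jump_kernel \<alpha> z *\<^sub>R w z + jump_kernel \<alpha> z *\<^sub>R w (- z))"
    using w w' by (simp add: I scaleR_2)
  also have "(\<lambda>z. jump_kernel \<alpha> z *\<^sub>R w z + jump_kernel \<alpha> z *\<^sub>R w (- z))
      = (\<lambda>z. jump_kernel \<alpha> z *\<^sub>R diff2 f x z)"
    by (auto simp: fun_eq_iff w_def w1_def w2_def diff2_def bounded_linear.linear[OF f', THEN linear_neg]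
          scaleR_2 scaleR_add_right[symmetric] indicator_def)
  finally have "2 *\<^sub>R frac_singular_integral \<alpha> f x = diff2_integral \<alpha> f x"
    by (simp add: diff2_integral_def)
  then have "(1/2) *\<^sub>R (2 *\<^sub>R frac_singular_integral \<alpha> f x) = (1/2) *\<^sub>R diff2_integral \<alpha> f x"
    by (rule arg_cong)
  then show ?thesis by simp
qed

section \<open>Second-difference bounds for functions in \<open>Cb2\<close>\<close>

text \<open>Two uses of the mean value inequality: the bounded Hessian makes the gradient
  C-Lipschitz, and then f(x + y) - g x \<bullet> y has derivative of norm at most C |z| on the ball
  of radius |z|.\<close>

lemma Cb2_Taylor:
  fixes f :: "'a::euclidean_space \<Rightarrow> real"
  assumes "f \<in> Cb2"
  obtains g B C where "\<And>x. (f has_derivative (\<lambda>z. g x \<bullet> z)) (at x)"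
    "\<And>x. \<bar>f x\<bar> \<le> B" "\<And>x z. \<bar>f (x + z) - f x - g x \<bullet> z\<bar> \<le> C * (norm z)\<^sup>2"
proof -
  from assms obtain g :: "'a \<Rightarrow> 'a" and H where bf: "bounded (range f)"
    and g: "\<And>x. (f has_derivative (\<lambda>z. g x \<bullet> z)) (at x)"
    and H: "\<And>x. (g has_derivative blinfun_apply (H x)) (at x)" and bH: "bounded (range H)"
    unfolding Cb2_def by blast
  obtain B where B: "\<And>x. \<bar>f x\<bar> \<le> B" using bf by (auto simp: bounded_iff)
  obtain C where C: "\<And>x. norm (H x) \<le> C" using bH by (auto simp: bounded_iff)
  have lip: "norm (g y - g x) \<le> C * norm (y - x)" for x y
    by (rule differentiable_bound[where S=UNIV and f'="\<lambda>x. blinfun_apply (H x)"])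
       (auto simp: H C norm_blinfun.rep_eq[symmetric])
  have "\<bar>f (x + z) - f x - g x \<bullet> z\<bar> \<le> C * (norm z)\<^sup>2" for x z :: 'a
  proof -
    let ?F = "\<lambda>y::'a. f (x + y) - g x \<bullet> y"
    have "norm (?F z - ?F 0) \<le> (C * norm z) * norm (z - 0)"
    proof (rule differentiable_bound[where S="cball (0::'a) (norm z)" and f'="\<lambda>y h. (g (x + y) - g x) \<bullet> h"])
      fix y assume y: "y \<in> cball (0::'a) (norm z)"
      have "((\<lambda>y. f (x + y)) has_derivative (\<lambda>h. g (x + y) \<bullet> (0 + h))) (at y within cball (0::'a) (norm z))"
        by (rule has_derivative_compose[OF _ g]) (auto intro!: derivative_eq_intros)
      then show "(?F has_derivative (\<lambda>h. (g (x + y) - g x) \<bullet> h)) (at y within cball (0::'a) (norm z))"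
        by (auto intro!: derivative_eq_intros simp: inner_diff_left)
      have "C * norm y \<le> C * norm z"
        using y order_trans[OF norm_ge_zero C] by (intro mult_left_mono) auto
      then have *: "norm (g (x + y) - g x) \<le> C * norm z"
        using lip[of "x + y" x] by simp
      show "onorm (\<lambda>h. (g (x + y) - g x) \<bullet> h) \<le> C * norm z"
      proof (rule onorm_bound)
        show "0 \<le> C * norm z" using * order_trans[OF norm_ge_zero] by blast
        show "norm ((g (x + y) - g x) \<bullet> h) \<le> C * norm z * norm h" for h
          using order_trans[OF Cauchy_Schwarz_ineq2 mult_right_mono[OF *]] by simp
      qed
    qed auto
    then show ?thesis by (simp add: algebra_simps power2_eq_square)
  qed
  then show ?thesis by (rule that[OF g B])
qed

lemma Cb2_continuous:
  assumes "f \<in> Cb2"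
  shows "continuous_on UNIV f"
proof -
  obtain g B C where g: "\<And>x. (f has_derivative (\<lambda>z. g x \<bullet> z)) (at x)"
    and B: "\<And>x. \<bar>f x\<bar> \<le> B" and C: "\<And>x z. \<bar>f (x + z) - f x - g x \<bullet> z\<bar> \<le> C * (norm z)\<^sup>2"
    by (rule Cb2_Taylor[OF assms]) (rule that)
  show ?thesis
    by (rule has_derivative_continuous_on[where f'="\<lambda>x z. g x \<bullet> z"]) (use g in simp)
qed

lemma Cb2_measurable: "f \<in> Cb2 \<Longrightarrow> f \<in> borel_measurable borel"
  by (intro borel_measurable_continuous_onI Cb2_continuous)

lemma Cb2_diff2_bound:
  assumes "f \<in> Cb2"
  obtains C where "\<And>x z. \<bar>diff2 f x z\<bar> \<le> C * min 1 ((norm z)\<^sup>2)"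
proof -
  obtain g B C where g: "\<And>x. (f has_derivative (\<lambda>z. g x \<bullet> z)) (at x)"
    and B: "\<And>x. \<bar>f x\<bar> \<le> B" and C: "\<And>x z. \<bar>f (x + z) - f x - g x \<bullet> z\<bar> \<le> C * (norm z)\<^sup>2"
    by (rule Cb2_Taylor[OF assms]) (rule that)
  have "\<bar>diff2 f x z\<bar> \<le> (4 * B + 2 * C) * min 1 ((norm z)\<^sup>2)" for x z
    using norm_diff2_le[of f B "\<lambda>z. g x \<bullet> z" x C z] B C
      bounded_linear.linear[OF bounded_linear_inner_right[of "g x"]] by simp
  then show ?thesis by (rule that)
qed

lemma integrable_diff2_Cb2:
  assumes "0 < \<alpha>" "\<alpha> < 2" "f \<in> Cb2"
  shows "integrable lborel (\<lambda>z. jump_kernel \<alpha> z * diff2 f x z)"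
proof -
  obtain C where "\<And>x z. \<bar>diff2 f x z\<bar> \<le> C * min 1 ((norm z)\<^sup>2)"
    by (rule Cb2_diff2_bound[OF assms(3)]) (rule that)
  then show ?thesis
    using integrable_jump_kernel_scaleR[of \<alpha> "diff2 f x" C] assms Cb2_measurable[OF assms(3)] by auto
qed

lemma frac_singular_integral_Cb2:
  assumes "0 < \<alpha>" "\<alpha> < 2" "f \<in> Cb2"
  shows "frac_singular_integral \<alpha> f x = diff2_integral \<alpha> f x / 2"
proof -
  obtain g B C where g: "\<And>x. (f has_derivative (\<lambda>z. g x \<bullet> z)) (at x)"
    and B: "\<And>x. \<bar>f x\<bar> \<le> B" and C: "\<And>x z. \<bar>f (x + z) - f x - g x \<bullet> z\<bar> \<le> C * (norm z)\<^sup>2"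
    by (rule Cb2_Taylor[OF assms(3)]) (rule that)
  show ?thesis
    using frac_singular_integral_eq_diff2[of \<alpha> f B "\<lambda>z. g x \<bullet> z" x C] assms B C
      Cb2_measurable[OF assms(3)] frechet_derivative_at[OF g[of x], symmetric]
      bounded_linear_inner_right[of "g x"] by simp
qed

section \<open>The normalizing constant\<close>

(* Uniqueness of Haar measure in disguise: both sides equal the double integral of
   f (T x) * g (T x + y). Taking for g the indicator of a ball yields invariance under isometries. *)
lemma nn_integral_involution_exchange:
  fixes T :: "'a::euclidean_space \<Rightarrow> 'a" and f g :: "'a \<Rightarrow> ennreal"
  assumes T: "linear T" "\<And>x. T (T x) = x"
    and [measurable]: "f \<in> borel_measurable borel" "g \<in> borel_measurable borel"
  shows "(\<integral>\<^sup>+x. f (T x) \<partial>lborel) * (\<integral>\<^sup>+x. g x \<partial>lborel)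
       = (\<integral>\<^sup>+x. g (T x) \<partial>lborel) * (\<integral>\<^sup>+x. f x \<partial>lborel)"
proof -
  have [measurable]: "T \<in> borel_measurable borel"
    by (intro borel_measurable_continuous_onI linear_continuous_on linear_conv_bounded_linear[THEN iffD1] T)
  have "(\<integral>\<^sup>+x. f (T x) \<partial>lborel) * (\<integral>\<^sup>+x. g x \<partial>lborel)
      = (\<integral>\<^sup>+x. f (T x) * (\<integral>\<^sup>+y. g y \<partial>lborel) \<partial>lborel)"
    by (simp add: nn_integral_multc)
  also have "\<dots> = (\<integral>\<^sup>+x. (\<integral>\<^sup>+y. f (T x) * g (T x + y) \<partial>lborel) \<partial>lborel)"
  proof (rule nn_integral_cong)
    fix x
    have "(\<integral>\<^sup>+y. g y \<partial>lborel) = (\<integral>\<^sup>+y. g (T x + y) \<partial>lborel)"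
      by (rule nn_integral_lborel_translate) measurable
    then show "f (T x) * (\<integral>\<^sup>+y. g y \<partial>lborel) = (\<integral>\<^sup>+y. f (T x) * g (T x + y) \<partial>lborel)"
      by (simp add: nn_integral_cmult)
  qed
  also have "\<dots> = (\<integral>\<^sup>+y. (\<integral>\<^sup>+x. f (T x) * g (T x + y) \<partial>lborel) \<partial>lborel)"
    by (rule lborel_pair.Fubini'[symmetric]) measurable
  \<comment> \<open>Translate x by - T y. Since T is a linear involution, T (x - T y) = T x - y, so
    y moves from the argument of g to that of f.\<close>
  also have "\<dots> = (\<integral>\<^sup>+y. (\<integral>\<^sup>+x. f (T x - y) * g (T x) \<partial>lborel) \<partial>lborel)"
  proof (rule nn_integral_cong)
    fix y
    have "T (x - T y) = T x - y" for x
      using T by (simp add: linear_diff)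
    then show "(\<integral>\<^sup>+x. f (T x) * g (T x + y) \<partial>lborel) = (\<integral>\<^sup>+x. f (T x - y) * g (T x) \<partial>lborel)"
      using nn_integral_lborel_translate[of "\<lambda>x. f (T x) * g (T x + y)" "- T y"] by simp
  qed
  also have "\<dots> = (\<integral>\<^sup>+x. (\<integral>\<^sup>+y. f (T x - y) * g (T x) \<partial>lborel) \<partial>lborel)"
    by (rule lborel_pair.Fubini') measurable
  also have "\<dots> = (\<integral>\<^sup>+x. g (T x) * (\<integral>\<^sup>+y. f y \<partial>lborel) \<partial>lborel)"
  proof (rule nn_integral_cong)
    fix x
    have "(\<integral>\<^sup>+y. f y \<partial>lborel) = (\<integral>\<^sup>+y. f (T x - y) \<partial>lborel)"
      using nn_integral_lborel_affine[of f "-1" "T x"] by simp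
    then show "(\<integral>\<^sup>+y. f (T x - y) * g (T x) \<partial>lborel) = g (T x) * (\<integral>\<^sup>+y. f y \<partial>lborel)"
      by (simp add: nn_integral_cmult mult.commute[of _ "g (T x)"])
  qed
  finally show ?thesis by (simp add: nn_integral_multc)
qed

lemma emeasure_lborel_ball_pos:
  assumes "r > 0"
  shows "emeasure lborel (ball (c::'a::euclidean_space) r) \<noteq> 0"
  using assms less_imp_neq[OF unit_ball_vol_pos[of "real DIM('a)"]] by (simp add: emeasure_ball)

lemma nn_integral_isometric_involution:
  fixes T :: "'a::euclidean_space \<Rightarrow> 'a" and f :: "'a \<Rightarrow> ennreal"
  assumes T: "linear T" "\<And>x. T (T x) = x" "\<And>x. norm (T x) = norm x"
    and f: "f \<in> borel_measurable borel"
  shows "(\<integral>\<^sup>+x. f (T x) \<partial>lborel) = (\<integral>\<^sup>+x. f x \<partial>lborel)"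
proof -
  let ?B = "ball (0::'a) 1"
  have [measurable]: "(indicator ?B :: 'a \<Rightarrow> ennreal) \<in> borel_measurable borel"
    by (intro borel_measurable_indicator borel_open open_ball)
  have "indicator ?B (T x) = (indicator ?B x :: ennreal)" for x
    using T(3) by (simp add: indicator_def)
  then have "(\<integral>\<^sup>+x. f (T x) \<partial>lborel) * emeasure lborel ?B = (\<integral>\<^sup>+x. f x \<partial>lborel) * emeasure lborel ?B"
    using nn_integral_involution_exchange[OF T(1,2) f, of "indicator ?B"] by (simp add: mult.commute)
  moreover have "emeasure lborel ?B \<noteq> 0" "emeasure lborel ?B < top"
    using emeasure_lborel_ball_pos[of 1 "0::'a"] by (simp_all add: emeasure_ball)
  ultimately show ?thesis
    by (auto simp: mult.commute[of _ "emeasure lborel ?B"] ennreal_mult_cancel_left)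
qed

section \<open>The symbol of the unnormalized operator\<close>

text \<open>The Levy-Khintchine exponent of the jump kernel; the sine part is absent because the
  kernel is even.\<close>

definition symbol_integral :: "real \<Rightarrow> 'a::euclidean_space \<Rightarrow> real" where
  "symbol_integral \<alpha> \<xi> = (LINT z|lborel. jump_kernel \<alpha> z * (1 - cos (\<xi> \<bullet> z)))"

lemma norm_cis_Taylor: "norm (cis t - 1 - t *\<^sub>R \<i>) \<le> t\<^sup>2"
  using Taylor_exp[of "\<i> * complex_of_real t" 1]
  by (simp add: cis_conv_exp norm_mult power2_eq_square scaleR_conv_of_real algebra_simps)

lemma one_minus_cos_le: "\<bar>1 - cos t\<bar> \<le> 2 * min 1 (t\<^sup>2)" for t :: real
proof -
  have "\<bar>1 - cos t\<bar> \<le> t\<^sup>2"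
    using order_trans[OF abs_Re_le_cmod norm_cis_Taylor, of t] by (simp add: abs_minus_commute)
  moreover have "\<bar>1 - cos t\<bar> \<le> 2"
    using cos_ge_minus_one[of t] cos_le_one[of t] by linarith
  moreover have "t\<^sup>2 \<le> 2 * t\<^sup>2" by simp
  ultimately have "\<bar>1 - cos t\<bar> \<le> 2" "\<bar>1 - cos t\<bar> \<le> 2 * t\<^sup>2"
    by linarith+
  then show ?thesis by (auto simp: min_def)
qed

lemma integrable_symbol:
  assumes "0 < \<alpha>" "\<alpha> < 2"
  shows "integrable lborel (\<lambda>z::'a::euclidean_space. jump_kernel \<alpha> z * (1 - cos (\<xi> \<bullet> z)))"
proof -
  have "\<bar>1 - cos (\<xi> \<bullet> z)\<bar> \<le> (2 * max 1 ((norm \<xi>)\<^sup>2)) * min 1 ((norm z)\<^sup>2)" for z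
  proof -
    have "(\<xi> \<bullet> z)\<^sup>2 \<le> (norm \<xi>)\<^sup>2 * (norm z)\<^sup>2"
      using Cauchy_Schwarz_ineq[of \<xi> z] by (simp add: power2_norm_eq_inner)
    also have "\<dots> \<le> max 1 ((norm \<xi>)\<^sup>2) * (norm z)\<^sup>2"
      by (intro mult_right_mono) auto
    finally have "min 1 ((\<xi> \<bullet> z)\<^sup>2) \<le> max 1 ((norm \<xi>)\<^sup>2) * min 1 ((norm z)\<^sup>2)"
      by (auto simp: min_def)
    then show ?thesis using one_minus_cos_le[of "\<xi> \<bullet> z"] by linarith
  qed
  then show ?thesis
    by (intro integrable_jump_kernel_scaleR[OF assms, of "\<lambda>z. 1 - cos (\<xi> \<bullet> z)", simplified]) auto
qed

text \<open>Substituting c z produces the Jacobian c^d against the kernel's homogeneity of degree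
  -(d + \<alpha>).\<close>

lemma symbol_integral_scaleR:
  fixes \<xi> :: "'a::euclidean_space"
  assumes "c > 0"
  shows "symbol_integral \<alpha> (c *\<^sub>R \<xi>) = c powr \<alpha> * symbol_integral \<alpha> \<xi>"
proof -
  have "symbol_integral \<alpha> \<xi>
      = c ^ DIM('a) * (LINT z|lborel. jump_kernel \<alpha> (c *\<^sub>R z) * (1 - cos (\<xi> \<bullet> c *\<^sub>R z)))"
    unfolding symbol_integral_def
    using assms by (subst integral_lborel_affine[where c=c and t=0]) auto
  also have "\<dots> = (c ^ DIM('a) * c powr - (real DIM('a) + \<alpha>)) * symbol_integral \<alpha> (c *\<^sub>R \<xi>)"
    using assms by (simp add: jump_kernel_scaleR symbol_integral_def mult.assoc)
  also have "c ^ DIM('a) * c powr - (real DIM('a) + \<alpha>) = c powr - \<alpha>"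
    using assms by (simp flip: powr_realpow powr_add)
  finally show ?thesis
    using assms by (simp add: powr_minus field_simps)
qed

lemma symbol_integral_nonneg: "symbol_integral \<alpha> \<xi> \<ge> 0"
  unfolding symbol_integral_def by (intro Bochner_Integration.integral_nonneg) simp

lemma symbol_integral_eq_nn_integral:
  "symbol_integral \<alpha> \<xi> = enn2real (\<integral>\<^sup>+z. ennreal (jump_kernel \<alpha> z * (1 - cos (\<xi> \<bullet> z))) \<partial>lborel)"
  unfolding symbol_integral_def by (rule integral_eq_nn_integral) auto

text \<open>The reflection in the hyperplane orthogonal to \<xi> - \<eta> maps \<xi> to \<eta> when
  both have the same length. It is a linear isometric involution, so the invariance proved above
  applies without treating general rotations.\<close>

lemma symbol_integral_norm_cong:
  fixes \<xi> \<eta> :: "'a::euclidean_space"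
  assumes "norm \<xi> = norm \<eta>"
  shows "symbol_integral \<alpha> \<xi> = symbol_integral \<alpha> \<eta>"
proof (cases "\<xi> = \<eta>")
  case False
  define v where "v = \<xi> - \<eta>"
  have v: "v \<bullet> v \<noteq> 0" using False by (simp add: v_def)
  define T where "T z = z - (2 * (v \<bullet> z) / (v \<bullet> v)) *\<^sub>R v" for z
  have T: "linear T"
    unfolding T_def by (intro linearI) (simp_all add: algebra_simps add_divide_distrib inner_add_right)
  have TT: "T (T z) = z" for z
    using v by (simp add: T_def inner_diff_right algebra_simps)
  have Tin: "T x \<bullet> T y = x \<bullet> y" for x y
    using v by (simp add: T_def inner_diff_right inner_diff_left inner_commute field_simps)
  have Tn: "norm (T z) = norm z" for z
    by (simp add: norm_eq_sqrt_inner Tin)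
  have "\<xi> \<bullet> \<xi> = \<eta> \<bullet> \<eta>" using assms by (simp add: norm_eq)
  then have "2 * (v \<bullet> \<xi>) = v \<bullet> v"
    by (simp add: v_def inner_diff_left inner_diff_right inner_commute)
  then have T\<xi>: "T \<xi> = \<eta>" using v by (simp add: T_def v_def)
  have "jump_kernel \<alpha> (T z) * (1 - cos (\<xi> \<bullet> T z)) = jump_kernel \<alpha> z * (1 - cos (\<eta> \<bullet> z))" for z
    using Tin[of \<xi> "T z"] by (simp add: TT T\<xi> Tn jump_kernel_def)
  then show ?thesis
    unfolding symbol_integral_eq_nn_integral
    using nn_integral_isometric_involution[OF T TT Tn,
        of "\<lambda>z. ennreal (jump_kernel \<alpha> z * (1 - cos (\<xi> \<bullet> z)))"] by simp
qed simp

text \<open>On the ball of radius 1/2 around b the scalar product with b lies strictly between 1/2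
  and 3/2, hence in (0, pi), where the cosine is less than 1. A vanishing integral would force this
  ball to be a null set.\<close>

lemma symbol_integral_pos:
  assumes "0 < \<alpha>" "\<alpha> < 2" "b \<in> Basis"
  shows "symbol_integral \<alpha> (b::'a::euclidean_space) > 0"
proof (rule ccontr)
  assume "\<not> symbol_integral \<alpha> b > 0"
  then have "(LINT z|lborel. jump_kernel \<alpha> z * (1 - cos (b \<bullet> z))) = 0"
    using symbol_integral_nonneg[of \<alpha> b] unfolding symbol_integral_def by linarith
  then have "AE z in lborel. jump_kernel \<alpha> z * (1 - cos (b \<bullet> z)) = 0"
    using integral_nonneg_eq_0_iff_AE[OF integrable_symbol[OF assms(1,2)], of b] by simp
  then have "AE z in lborel. z \<notin> ball b (1/2)"
  proof eventually_elim
    case (elim z)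
    show ?case
    proof
      assume z: "z \<in> ball b (1/2)"
      have "\<bar>b \<bullet> (z - b)\<bar> \<le> norm b * norm (z - b)" by (rule Cauchy_Schwarz_ineq2)
      also have "\<dots> < 1/2" using z assms by (simp add: dist_norm norm_minus_commute)
      finally have bz: "\<bar>b \<bullet> z - 1\<bar> < 1/2" using assms by (simp add: inner_diff_right)
      then have "0 < b \<bullet> z" "b \<bullet> z \<le> pi" using pi_gt3 by linarith+
      then have "cos (b \<bullet> z) < cos 0"
        by (intro cos_monotone_0_pi) auto
      moreover have "z \<noteq> 0" using bz by auto
      ultimately show False using elim by (simp add: jump_kernel_def)
    qed
  qed
  then have "emeasure lborel (ball b (1/2)) = 0"
    by (subst (asm) AE_iff_null) (auto simp: null_sets_def ball_def)
  then show False using emeasure_lborel_ball_pos[of "1/2" b] by simp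
qed

lemma symbol_integral_eq:
  fixes \<xi> b :: "'a::euclidean_space"
  assumes "b \<in> Basis" "0 < \<alpha>"
  shows "symbol_integral \<alpha> \<xi> = norm \<xi> powr \<alpha> * symbol_integral \<alpha> b"
proof (cases "\<xi> = 0")
  case False
  then have "symbol_integral \<alpha> \<xi> = symbol_integral \<alpha> (norm \<xi> *\<^sub>R b)"
    using assms by (intro symbol_integral_norm_cong) simp
  then show ?thesis using False by (simp add: symbol_integral_scaleR)
qed (simp add: symbol_integral_def)

text \<open>The second difference of a character is 2 (cos (\<xi> \<bullet> z) - 1) times the
  character itself, so the x-dependence factors out of the integral.\<close>

lemma frac_singular_integral_cis:
  fixes \<xi> x :: "'a::euclidean_space"
  assumes "0 < \<alpha>" "\<alpha> < 2"
  shows "frac_singular_integral \<alpha> (\<lambda>y. cis (\<xi> \<bullet> y)) x = (- symbol_integral \<alpha> \<xi>) *\<^sub>R cis (\<xi> \<bullet> x)"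
proof -
  let ?f = "\<lambda>y. cis (\<xi> \<bullet> y)" and ?f' = "\<lambda>z. (\<xi> \<bullet> z) *\<^sub>R (\<i> * cis (\<xi> \<bullet> x))"
  have deriv: "(?f has_derivative ?f') (at x)"
    by (auto intro!: derivative_eq_intros)
  have Taylor: "norm (?f (x + z) - ?f x - ?f' z) \<le> (norm \<xi>)\<^sup>2 * (norm z)\<^sup>2" for z
  proof -
    have "?f (x + z) - ?f x - ?f' z = cis (\<xi> \<bullet> x) * (cis (\<xi> \<bullet> z) - 1 - (\<xi> \<bullet> z) *\<^sub>R \<i>)"
      by (simp add: inner_add_right cis_mult[symmetric] algebra_simps)
    then have "norm (?f (x + z) - ?f x - ?f' z) \<le> (\<xi> \<bullet> z)\<^sup>2"
      using norm_cis_Taylor[of "\<xi> \<bullet> z"] by (simp add: norm_mult)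
    also have "\<dots> \<le> (norm \<xi>)\<^sup>2 * (norm z)\<^sup>2"
      using Cauchy_Schwarz_ineq[of \<xi> z] by (simp add: power2_norm_eq_inner)
    finally show ?thesis .
  qed
  have meas: "?f \<in> borel_measurable borel"
    by (intro borel_measurable_continuous_onI continuous_intros)
  have "frac_singular_integral \<alpha> ?f x = (1/2) *\<^sub>R diff2_integral \<alpha> ?f x"
    by (rule frac_singular_integral_eq_diff2[OF assms meas _ has_derivative_bounded_linear[OF deriv] Taylor
          frechet_derivative_at[OF deriv, symmetric], of 1]) simp
  also have "diff2_integral \<alpha> ?f x
      = (LINT z|lborel. (jump_kernel \<alpha> z * (1 - cos (\<xi> \<bullet> z))) *\<^sub>R (- 2 *\<^sub>R cis (\<xi> \<bullet> x)))"
    unfolding diff2_integral_def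
  proof (intro Bochner_Integration.integral_cong refl)
    fix z
    have "diff2 ?f x z = (1 - cos (\<xi> \<bullet> z)) *\<^sub>R (- 2 *\<^sub>R cis (\<xi> \<bullet> x))"
      by (simp add: diff2_def inner_add_right inner_diff_right complex_eq_iff cos_add cos_diff sin_add sin_diff
            algebra_simps)
    then show "jump_kernel \<alpha> z *\<^sub>R diff2 ?f x z
        = (jump_kernel \<alpha> z * (1 - cos (\<xi> \<bullet> z))) *\<^sub>R (- 2 *\<^sub>R cis (\<xi> \<bullet> x))" by simp
  qed
  also have "\<dots> = symbol_integral \<alpha> \<xi> *\<^sub>R (- 2 *\<^sub>R cis (\<xi> \<bullet> x))"
    unfolding symbol_integral_def by (rule integral_scaleR_left) (use integrable_symbol[OF assms] in simp)
  finally show ?thesis by simp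
qed

text \<open>The definite description denotes something only once existence and uniqueness are
  proved. Homogeneity and rotation invariance give the symbol s |\<xi>|^\<alpha> with s > 0, so 1 /
  s qualifies; testing \<xi> = b at x = 0 excludes every other value. What the later estimates take
  from the constant is its sign.\<close>

lemma frac_laplacian_const_pos:
  assumes "0 < \<alpha>" "\<alpha> < 2"
  shows "frac_laplacian_const TYPE('a::euclidean_space) \<alpha> > 0"
proof -
  obtain b :: 'a where b: "b \<in> Basis" using nonempty_Basis by blast
  define s where "s = symbol_integral \<alpha> b"
  have s: "s > 0" using symbol_integral_pos[OF assms b] by (simp add: s_def)
  let ?P = "\<lambda>c. c > 0 \<and> (\<forall>(\<xi>::'a) x. c *\<^sub>R frac_singular_integral \<alpha> (\<lambda>y. cis (\<xi> \<bullet> y)) x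
                    = (- (norm \<xi> powr \<alpha>)) *\<^sub>R cis (\<xi> \<bullet> x))"
  have I: "frac_singular_integral \<alpha> (\<lambda>y. cis (\<xi> \<bullet> y)) x = (- (norm \<xi> powr \<alpha> * s)) *\<^sub>R cis (\<xi> \<bullet> x)"
    for \<xi> x :: 'a
    using symbol_integral_eq[OF b assms(1), of \<xi>] by (simp add: frac_singular_integral_cis[OF assms] s_def)
  have "(THE c. ?P c) = 1 / s"
  proof (rule the_equality)
    show "?P (1 / s)" using s by (simp add: I)
  next
    fix c assume "?P c"
    then have "c *\<^sub>R frac_singular_integral \<alpha> (\<lambda>y. cis (b \<bullet> y)) 0 = (- (norm b powr \<alpha>)) *\<^sub>R cis (b \<bullet> 0)"
      by blast
    then have "c * s = 1" using b by (simp add: I complex_eq_iff)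
    then show "c = 1 / s" using s by (simp add: field_simps)
  qed
  then show ?thesis using s by (simp add: frac_laplacian_const_def)
qed

lemma frac_laplacian_Cb2:
  fixes f :: "'a::euclidean_space \<Rightarrow> real"
  assumes "0 < \<alpha>" "\<alpha> < 2" "f \<in> Cb2"
  shows "frac_laplacian \<alpha> f x = frac_laplacian_const TYPE('a) \<alpha> / 2 * diff2_integral \<alpha> f x"
  using frac_singular_integral_Cb2[OF assms] by (simp add: frac_laplacian_def)

section \<open>Truncated weights\<close>

text \<open>The even function s -> G s + G (- s) has derivative G' s - G' (- s), which is at most 2
  K on [0, 1] by the mean value inequality for G'; a second application, now to the even function,
  finishes.\<close>

lemma second_difference_bound:
  fixes G G' G'' :: "real \<Rightarrow> real"
  assumes G: "\<And>s. \<bar>s\<bar> \<le> 1 \<Longrightarrow> (G has_real_derivative G' s) (at s)"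
    and G': "\<And>s. \<bar>s\<bar> \<le> 1 \<Longrightarrow> (G' has_real_derivative G'' s) (at s)"
    and K: "\<And>s. \<bar>s\<bar> \<le> 1 \<Longrightarrow> \<bar>G'' s\<bar> \<le> K"
  shows "\<bar>G 1 + G (- 1) - 2 * G 0\<bar> \<le> 2 * K"
proof -
  have K0: "K \<ge> 0" using order_trans[OF abs_ge_zero K[of 0]] by simp
  have G'_diff: "\<bar>G' s - G' (- s)\<bar> \<le> 2 * K" if "0 \<le> s" "s \<le> 1" for s
  proof -
    have "norm (G' s - G' (- s)) \<le> K * norm (s - - s)"
      by (rule field_differentiable_bound[where S="{-1..1}" and f'=G''])
         (use that K in \<open>auto intro!: has_field_derivative_at_within G'\<close>)
    also have "\<dots> \<le> K * 2" using that K0 by (intro mult_left_mono) auto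
    finally show ?thesis by (simp add: mult.commute)
  qed
  have "norm ((G 1 + G (- 1)) - (G 0 + G (- 0))) \<le> (2 * K) * norm (1 - 0 :: real)"
  proof (rule field_differentiable_bound[where S="{0..1}" and f'="\<lambda>s. G' s - G' (- s)"])
    fix s :: real assume s: "s \<in> {0..1}"
    have "((\<lambda>s. G (- s)) has_real_derivative (G' (- s) * - 1)) (at s)"
      by (rule DERIV_chain2[OF G]) (use s in \<open>auto intro!: derivative_eq_intros\<close>)
    then have "((\<lambda>s. G s + G (- s)) has_real_derivative (G' s - G' (- s))) (at s)"
      using DERIV_add[OF G[of s], of "\<lambda>s. G (- s)" "- G' (- s)"] s by simp
    then show "((\<lambda>s. G s + G (- s)) has_real_derivative (G' s - G' (- s))) (at s within {0..1})"
      by (rule has_field_derivative_at_within)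
    show "norm (G' s - G' (- s)) \<le> 2 * K" using G'_diff s by simp
  qed auto
  then show ?thesis by simp
qed

definition tail_weight :: "real \<Rightarrow> 'a::euclidean_space \<Rightarrow> real" where
  "tail_weight \<alpha> x = (1 + (norm x)\<^sup>2) powr (- (real DIM('a) + \<alpha>) / 2)"

(* The third power of the positive part is C^2, and its second derivatives are bounded by the weight
   itself, uniformly in the truncation level \<epsilon>. *)
definition truncated_weight :: "real \<Rightarrow> real \<Rightarrow> 'a::euclidean_space \<Rightarrow> real" where
  "truncated_weight \<alpha> \<epsilon> x = (max 0 ((1 + (norm x)\<^sup>2) powr (- (real DIM('a) + \<alpha>) / 6) - \<epsilon>)) ^ 3"

text \<open>Only the kink at 0 needs care: the difference quotient there is at most |h|^n, which
  tends to 0 because n is positive.\<close>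

lemma has_real_derivative_max_power:
  assumes "n \<ge> 1"
  shows "((\<lambda>y. (max 0 y) ^ Suc n) has_real_derivative (real (Suc n) * (max 0 y) ^ n)) (at (y::real))"
proof -
  consider "y > 0" | "y < 0" | "y = 0" by linarith
  then show ?thesis
  proof cases
    case 1
    have "((\<lambda>y. y ^ Suc n) has_real_derivative (real (Suc n) * y ^ n)) (at y)"
      by (rule DERIV_pow[THEN DERIV_cong]) simp
    then have "((\<lambda>y. (max 0 y) ^ Suc n) has_real_derivative (real (Suc n) * y ^ n)) (at y)"
      by (rule has_field_derivative_transform_within_open[of _ _ _ "{0<..}"]) (use 1 in auto)
    then show ?thesis using 1 by simp
  next
    case 2
    have "((\<lambda>y. (max 0 y) ^ Suc n) has_real_derivative 0) (at y)"
      by (rule has_field_derivative_transform_within_open[where f="\<lambda>_. 0" and S="{..<0}"])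
         (use 2 in auto)
    then show ?thesis using 2 assms by (simp add: power_0_left)
  next
    case 3
    have "((\<lambda>h. (max 0 (0 + h)) ^ Suc n / h) \<longlongrightarrow> 0) (at (0::real))"
    proof (rule Lim_null_comparison)
      show "\<forall>\<^sub>F h in at (0::real). norm ((max 0 (0 + h)) ^ Suc n / h) \<le> \<bar>h\<bar> ^ n"
        by (intro always_eventually allI) (auto simp: max_def power_abs[symmetric] abs_mult)
      have "((\<lambda>h::real. \<bar>h\<bar> ^ n) \<longlongrightarrow> \<bar>0\<bar> ^ n) (at 0)" by (intro tendsto_intros)
      moreover have "\<bar>0::real\<bar> ^ n = 0" using assms by (simp add: power_0_left)
      ultimately show "((\<lambda>h::real. \<bar>h\<bar> ^ n) \<longlongrightarrow> 0) (at 0)" by (simp only:)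
    qed
    then show ?thesis using assms 3 by (simp add: DERIV_def power_0_left)
  qed
qed

lemma one_plus_norm_square_pos [simp]: "1 + (norm x)\<^sup>2 > 0"
  by (simp add: add_pos_nonneg)

lemma one_plus_norm_square_neq_0 [simp]: "1 + (norm x)\<^sup>2 \<noteq> 0"
  using one_plus_norm_square_pos[of x] by linarith

lemma tail_weight_pos [simp]: "tail_weight \<alpha> x > 0"
  by (simp add: tail_weight_def)

lemma tail_weight_nonneg [simp]: "tail_weight \<alpha> x \<ge> 0"
  by (simp add: tail_weight_def)

lemma tail_weight_le_1:
  fixes x :: "'a::euclidean_space"
  assumes "\<alpha> > 0"
  shows "tail_weight \<alpha> x \<le> 1"
proof -
  have "tail_weight \<alpha> x \<le> 1 powr (- (real DIM('a) + \<alpha>) / 2)"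
    unfolding tail_weight_def using assms by (intro powr_mono2') auto
  then show ?thesis by simp
qed

lemma truncated_weight_nonneg [simp]: "truncated_weight \<alpha> \<epsilon> x \<ge> 0"
  by (simp add: truncated_weight_def)

lemma truncated_weight_0:
  fixes x :: "'a::euclidean_space"
  shows "truncated_weight \<alpha> 0 x = tail_weight \<alpha> x"
proof -
  let ?p = "real DIM('a) + \<alpha>" and ?q = "1 + (norm x)\<^sup>2"
  have "(?q powr (- ?p / 6)) ^ 3 = ?q powr (3 * (- ?p / 6))"
    by (simp add: powr_power)
  also have "3 * (- ?p / 6) = - ?p / 2" by simp
  finally show ?thesis by (simp add: truncated_weight_def tail_weight_def)
qed

lemma truncated_weight_antimono:
  "\<epsilon> \<le> \<delta> \<Longrightarrow> truncated_weight \<alpha> \<delta> x \<le> truncated_weight \<alpha> \<epsilon> x"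
  unfolding truncated_weight_def by (intro power_mono) auto

lemma truncated_weight_le: "\<epsilon> \<ge> 0 \<Longrightarrow> truncated_weight \<alpha> \<epsilon> x \<le> tail_weight \<alpha> x"
  using truncated_weight_antimono[of 0 \<epsilon> \<alpha> x] by (simp add: truncated_weight_0)

lemma continuous_on_weight [continuous_intros]:
  fixes f :: "'b::topological_space \<Rightarrow> 'a::euclidean_space"
  assumes "continuous_on S f"
  shows "continuous_on S (\<lambda>x. truncated_weight \<alpha> \<epsilon> (f x))" "continuous_on S (\<lambda>x. tail_weight \<alpha> (f x))"
  unfolding truncated_weight_def tail_weight_def
  by (intro continuous_intros assms; simp add: add_nonneg_eq_0_iff)+

lemma weight_measurable [measurable]:
  "truncated_weight \<alpha> \<epsilon> \<in> borel_measurable borel" "tail_weight \<alpha> \<in> borel_measurable borel"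
  by (intro borel_measurable_continuous_onI continuous_intros)+

lemma tail_weight_comparable:
  fixes x y :: "'a::euclidean_space"
  assumes "\<alpha> > 0" "C > 0" "1 + (norm x)\<^sup>2 \<le> C * (1 + (norm y)\<^sup>2)"
  shows "tail_weight \<alpha> y \<le> C powr ((real DIM('a) + \<alpha>) / 2) * tail_weight \<alpha> x"
proof -
  let ?b = "(real DIM('a) + \<alpha>) / 2"
  have "(1 + (norm x)\<^sup>2) powr ?b \<le> (C * (1 + (norm y)\<^sup>2)) powr ?b"
    using assms by (intro powr_mono2) (auto intro: add_nonneg_nonneg)
  also have "\<dots> = C powr ?b * (1 + (norm y)\<^sup>2) powr ?b"
    using assms by (simp add: powr_mult add_nonneg_nonneg)
  finally show ?thesis
    unfolding tail_weight_def minus_divide_left[symmetric] powr_minus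
    by (simp add: field_simps add_pos_nonneg less_imp_neq[symmetric])
qed

lemma norm_add_square_le: "(norm (x + y :: 'a::real_normed_vector))\<^sup>2 \<le> 2 * (norm x)\<^sup>2 + 2 * (norm y)\<^sup>2"
proof -
  have "(norm (x + y))\<^sup>2 \<le> (norm x + norm y)\<^sup>2"
    by (intro power_mono norm_triangle_ineq) simp
  also have "\<dots> \<le> 2 * (norm x)\<^sup>2 + 2 * (norm y)\<^sup>2"
    using zero_le_power2[of "norm x - norm y"] by (simp add: power2_eq_square algebra_simps)
  finally show ?thesis .
qed

text \<open>A Harnack-type comparison: within unit distance the weight changes by a bounded factor.
  It lets second derivatives along a short segment be estimated by the weight at its
  midpoint.\<close>

lemma tail_weight_shift_le:
  fixes x y :: "'a::euclidean_space"
  assumes "\<alpha> > 0" "norm y \<le> 1"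
  shows "tail_weight \<alpha> (x + y) \<le> 3 powr ((real DIM('a) + \<alpha>) / 2) * tail_weight \<alpha> x"
proof (rule tail_weight_comparable)
  have "(norm ((x + y) + - y))\<^sup>2 \<le> 2 * (norm (x + y))\<^sup>2 + 2 * (norm (- y))\<^sup>2"
    by (rule norm_add_square_le)
  moreover have "(norm y)\<^sup>2 \<le> 1" using assms by (simp add: power_le_one)
  ultimately show "1 + (norm x)\<^sup>2 \<le> 3 * (1 + (norm (x + y))\<^sup>2)"
    using zero_le_power2[of "norm (x + y)"] unfolding distrib_left by (simp, linarith)
qed (use assms in auto)

text \<open>The longer of x and y has length at least |x + y| / 2, so its weight is at most a
  constant times the weight of x + y. This is the inequality behind the fact that convolving the
  weight with itself gives at most a multiple of the weight.\<close>

lemma tail_weight_product_le: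
  fixes x y :: "'a::euclidean_space"
  assumes "\<alpha> > 0"
  shows "tail_weight \<alpha> x * tail_weight \<alpha> y
    \<le> 4 powr ((real DIM('a) + \<alpha>) / 2) * tail_weight \<alpha> (x + y) * (tail_weight \<alpha> x + tail_weight \<alpha> y)"
proof -
  let ?A = "4 powr ((real DIM('a) + \<alpha>) / 2) * tail_weight \<alpha> (x + y)"
  have *: "(norm (x + y))\<^sup>2 \<le> 2 * (norm x)\<^sup>2 + 2 * (norm y)\<^sup>2" by (rule norm_add_square_le)
  have "tail_weight \<alpha> y \<le> ?A" if "norm x \<le> norm y"
  proof -
    have "(norm x)\<^sup>2 \<le> (norm y)\<^sup>2" using that by (intro power_mono) auto
    then have "1 + (norm (x + y))\<^sup>2 \<le> 4 * (1 + (norm y)\<^sup>2)"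
      using * unfolding distrib_left by linarith
    then show ?thesis using assms by (intro tail_weight_comparable) auto
  qed
  moreover have "tail_weight \<alpha> x \<le> ?A" if "norm y \<le> norm x"
  proof -
    have "(norm y)\<^sup>2 \<le> (norm x)\<^sup>2" using that by (intro power_mono) auto
    then have "1 + (norm (x + y))\<^sup>2 \<le> 4 * (1 + (norm x)\<^sup>2)"
      using * unfolding distrib_left by linarith
    then show ?thesis using assms by (intro tail_weight_comparable) auto
  qed
  ultimately have "tail_weight \<alpha> x \<le> ?A \<or> tail_weight \<alpha> y \<le> ?A" by linarith
  moreover have "?A \<ge> 0" by simp
  ultimately show ?thesis
    by (auto simp: distrib_left intro: order_trans[OF mult_right_mono] order_trans[OF mult_left_mono])
qed

lemma jump_kernel_le_tail_weight:
  fixes z :: "'a::euclidean_space"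
  assumes "\<alpha> > 0" "norm z \<ge> 1"
  shows "jump_kernel \<alpha> z \<le> 2 powr ((real DIM('a) + \<alpha>) / 2) * tail_weight \<alpha> z"
proof -
  let ?b = "(real DIM('a) + \<alpha>) / 2"
  have z: "norm z > 0" "(norm z)\<^sup>2 \<ge> 1" using assms by (auto simp: one_le_power less_le_trans[OF zero_less_one])
  have "(1 + (norm z)\<^sup>2) powr ?b \<le> (2 * (norm z)\<^sup>2) powr ?b"
    using assms z by (intro powr_mono2) (auto intro: add_nonneg_nonneg)
  also have "\<dots> = 2 powr ?b * (norm z powr (2 * ?b))"
    using z by (simp add: powr_mult powr_powr flip: powr_numeral)
  also have "2 * ?b = real DIM('a) + \<alpha>" by simp
  finally have "(1 + (norm z)\<^sup>2) powr ?b \<le> 2 powr ?b * norm z powr (real DIM('a) + \<alpha>)" .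
  then show ?thesis
    unfolding tail_weight_def minus_divide_left[symmetric] powr_minus jump_kernel_def
    using z by (simp add: field_simps add_pos_nonneg less_imp_neq[symmetric])
qed

text \<open>Inside the unit ball the weight is at most 1; outside it lies below the jump kernel,
  whose integral there is already known to be finite.\<close>

lemma integrable_tail_weight:
  assumes "0 < \<alpha>" "\<alpha> < 2"
  shows "integrable lborel (tail_weight \<alpha> :: 'a::euclidean_space \<Rightarrow> real)"
proof (rule Bochner_Integration.integrable_bound)
  show "integrable lborel (\<lambda>x::'a. indicator (cball 0 1) x + min 1 ((norm x)\<^sup>2) * jump_kernel \<alpha> x)"
    by (intro Bochner_Integration.integrable_add integrable_jump_kernel assms integrable_real_indicator)
       (auto simp: emeasure_cball)
  show "AE x in lborel. norm (tail_weight \<alpha> (x::'a))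
    \<le> norm (indicator (cball 0 1) x + min 1 ((norm x)\<^sup>2) * jump_kernel \<alpha> x)"
  proof (rule AE_I2)
    fix x :: 'a
    show "norm (tail_weight \<alpha> (x::'a))
      \<le> norm (indicator (cball 0 1) x + min 1 ((norm x)\<^sup>2) * jump_kernel \<alpha> x)"
    proof (cases "norm x \<le> 1")
      case True
      then show ?thesis using tail_weight_le_1[of \<alpha> x] assms
        by (simp add: add_increasing2)
    next
      case False
      have "tail_weight \<alpha> x \<le> (norm x powr 2) powr (- (real DIM('a) + \<alpha>) / 2)"
        unfolding tail_weight_def using False assms by (intro powr_mono2') auto
      also have "\<dots> = jump_kernel \<alpha> x"
        by (simp only: powr_powr nonzero_mult_div_cancel_left times_divide_eq_right powr_minus jump_kernel_def
              zero_neq_numeral not_False_eq_True)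
      finally show ?thesis using False by (simp add: min_def one_le_power)
    qed
  qed
qed measurable

text \<open>Restricted to the line s -> x + s z, the weight is the cube of m = max 0 (b -
  \<epsilon>) with b = q powr - \<gamma>. Both b' and b'' are at most multiples of b, and m \<le> b,
  so the second derivative of m^3 is at most a multiple of b^3, the full weight, for every
  \<epsilon>. The two summands of D come from 6 m (b')^2 and 3 m^2 b''.\<close>

lemma truncated_weight_line_bound:
  fixes x z :: "'a::euclidean_space"
  assumes "\<alpha> > 0" "\<epsilon> \<ge> 0" "norm z \<le> 1"
  defines "\<gamma> \<equiv> (real DIM('a) + \<alpha>) / 6"
  defines "D \<equiv> 6 * \<gamma>\<^sup>2 + 3 * \<gamma> * (\<gamma> + 3)"
  shows "\<bar>diff2 (truncated_weight \<alpha> \<epsilon>) x z\<bar>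
    \<le> 2 * D * 3 powr ((real DIM('a) + \<alpha>) / 2) * tail_weight \<alpha> x * (norm z)\<^sup>2"
proof -
  define q where "q s = 1 + (norm (x + s *\<^sub>R z))\<^sup>2" for s
  define q' where "q' s = 2 * ((x + s *\<^sub>R z) \<bullet> z)" for s
  define b where "b s = q s powr - \<gamma>" for s
  define b' where "b' s = - \<gamma> * q s powr (- \<gamma> - 1) * q' s" for s
  define b'' where "b'' s = - \<gamma> * (- \<gamma> - 1) * q s powr (- \<gamma> - 2) * (q' s)\<^sup>2
      - \<gamma> * q s powr (- \<gamma> - 1) * (2 * (norm z)\<^sup>2)" for s
  define m where "m s = max 0 (b s - \<epsilon>)" for s
  define G where "G s = m s ^ 3" for s
  define G' where "G' s = 3 * (m s)\<^sup>2 * b' s" for s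
  define G'' where "G'' s = 6 * m s * (b' s)\<^sup>2 + 3 * (m s)\<^sup>2 * b'' s" for s
  have \<gamma>: "\<gamma> > 0" using assms by (simp add: \<gamma>_def add_nonneg_pos)
  have exponent: "- (real DIM('a) + \<alpha>) / 6 = - \<gamma>" unfolding \<gamma>_def by (rule minus_divide_left[symmetric])
  have q_pos: "q s > 0" for s by (simp add: q_def)
  have q_deriv: "(q has_real_derivative q' s) (at s)" for s
    unfolding q_def[abs_def] q'_def power2_norm_eq_inner
    by (auto intro!: derivative_eq_intros simp: has_real_derivative_iff_has_vector_derivative inner_commute algebra_simps
        has_vector_derivative_def[symmetric])
  have q'_deriv: "(q' has_real_derivative 2 * (norm z)\<^sup>2) (at s)" for s
    unfolding q'_def[abs_def] power2_norm_eq_inner inner_add_left inner_scaleR_left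
    by (auto intro!: derivative_eq_intros)
  have q_powr_deriv: "((\<lambda>s. q s powr c) has_real_derivative c * q s powr (c - 1) * q' s) (at s)" for c s
    by (rule DERIV_chain2[where f="\<lambda>y. y powr c" and g=q, OF has_real_derivative_powr[OF q_pos] q_deriv])
  have b_deriv: "(b has_real_derivative b' s) (at s)" for s
    unfolding b_def[abs_def] b'_def by (rule q_powr_deriv)
  have b'_deriv: "(b' has_real_derivative b'' s) (at s)" for s
  proof -
    have "(b' has_real_derivative - \<gamma> * ((- \<gamma> - 1) * q s powr (- \<gamma> - 1 - 1) * q' s) * q' s
        + (2 * (norm z)\<^sup>2) * (- \<gamma> * q s powr (- \<gamma> - 1))) (at s)"
      unfolding b'_def[abs_def] by (intro DERIV_mult DERIV_cmult q_powr_deriv q'_deriv)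
    also have "- \<gamma> - 1 - 1 = - \<gamma> - 2" by simp
    finally show ?thesis
      by (rule DERIV_cong) (simp add: b''_def power2_eq_square)
  qed
  have m_deriv: "((\<lambda>s. m s ^ Suc n) has_real_derivative real (Suc n) * m s ^ n * b' s) (at s)"
    if "n \<ge> 1" for n s
    unfolding m_def using has_real_derivative_max_power[OF that]
    by (rule DERIV_chain2) (auto intro!: derivative_eq_intros b_deriv)
  have G_deriv: "(G has_real_derivative G' s) (at s)" for s
    using m_deriv[of 2 s] by (simp add: G_def[abs_def] G'_def eval_nat_numeral)
  have G'_deriv: "(G' has_real_derivative G'' s) (at s)" for s
  proof -
    have "((\<lambda>s. (m s)\<^sup>2) has_real_derivative 2 * m s * b' s) (at s)"
      using m_deriv[of 1 s] by (simp add: eval_nat_numeral)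
    then have "(G' has_real_derivative 3 * (2 * m s * b' s) * b' s + b'' s * (3 * (m s)\<^sup>2)) (at s)"
      unfolding G'_def[abs_def] by (intro DERIV_mult DERIV_cmult b'_deriv)
    then show ?thesis
      by (rule DERIV_cong) (simp add: G''_def power2_eq_square)
  qed
  \<comment> \<open>Since 2 |y| \<le> 1 + |y|^2, differentiating q costs a factor
    \<open>norm z\<close> and no additional power of q.\<close>
  have q'_le: "\<bar>q' s\<bar> \<le> q s * norm z" for s
  proof -
    have "\<bar>q' s\<bar> \<le> 2 * (norm (x + s *\<^sub>R z) * norm z)"
      unfolding q'_def using Cauchy_Schwarz_ineq2[of "x + s *\<^sub>R z" z] by simp
    moreover have "2 * norm (x + s *\<^sub>R z) \<le> q s"
      using zero_le_power2[of "norm (x + s *\<^sub>R z) - 1"] by (simp add: q_def power2_eq_square algebra_simps)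
    then have "2 * norm (x + s *\<^sub>R z) * norm z \<le> q s * norm z" by (rule mult_right_mono) simp
    ultimately show ?thesis by simp
  qed
  have q_ge_1: "q s \<ge> 1" for s by (simp add: q_def)
  have qb1: "q s powr (- \<gamma> - 1) * q s = b s" for s
    using q_pos[of s] by (simp add: b_def powr_diff)
  have qb2: "q s powr (- \<gamma> - 2) * (q s)\<^sup>2 = b s" for s
    using q_pos[of s] by (simp add: b_def powr_diff)
  have b_nonneg: "b s \<ge> 0" for s by (simp add: b_def)
  have b'_le: "\<bar>b' s\<bar> \<le> \<gamma> * b s * norm z" for s
  proof -
    have "\<bar>b' s\<bar> = \<gamma> * q s powr (- \<gamma> - 1) * \<bar>q' s\<bar>" using \<gamma> by (simp add: b'_def abs_mult)
    also have "\<dots> \<le> \<gamma> * q s powr (- \<gamma> - 1) * (q s * norm z)"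
      using \<gamma> by (intro mult_left_mono q'_le) simp
    also have "\<dots> = \<gamma> * (q s powr (- \<gamma> - 1) * q s) * norm z" by (simp only: mult_ac)
    finally show ?thesis by (simp only: qb1)
  qed
  have b''_le: "\<bar>b'' s\<bar> \<le> \<gamma> * (\<gamma> + 3) * b s * (norm z)\<^sup>2" for s
  proof -
    have "(q' s)\<^sup>2 \<le> (q s * norm z)\<^sup>2"
      using q'_le[of s] power_mono[OF q'_le[of s], of 2] by simp
    then have "\<gamma> * (\<gamma> + 1) * q s powr (- \<gamma> - 2) * (q' s)\<^sup>2
        \<le> \<gamma> * (\<gamma> + 1) * q s powr (- \<gamma> - 2) * (q s * norm z)\<^sup>2"
      using \<gamma> by (intro mult_left_mono) auto
    also have "\<dots> = \<gamma> * (\<gamma> + 1) * (q s powr (- \<gamma> - 2) * (q s)\<^sup>2) * (norm z)\<^sup>2"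
      by (simp only: power_mult_distrib mult_ac)
    also have "\<dots> = \<gamma> * (\<gamma> + 1) * b s * (norm z)\<^sup>2" by (simp only: qb2)
    finally have 1: "\<gamma> * (\<gamma> + 1) * q s powr (- \<gamma> - 2) * (q' s)\<^sup>2 \<le> \<gamma> * (\<gamma> + 1) * b s * (norm z)\<^sup>2" .
    have "q s powr (- \<gamma> - 1) * 1 \<le> q s powr (- \<gamma> - 1) * q s"
      using q_ge_1 by (intro mult_left_mono) auto
    then have "\<gamma> * 2 * (norm z)\<^sup>2 * q s powr (- \<gamma> - 1) \<le> \<gamma> * 2 * (norm z)\<^sup>2 * b s"
      unfolding qb1 using \<gamma> by (intro mult_left_mono) auto
    then have 2: "\<gamma> * q s powr (- \<gamma> - 1) * (2 * (norm z)\<^sup>2) \<le> 2 * \<gamma> * b s * (norm z)\<^sup>2"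
      by (simp add: mult_ac)
    have "b'' s = \<gamma> * (\<gamma> + 1) * q s powr (- \<gamma> - 2) * (q' s)\<^sup>2 - \<gamma> * q s powr (- \<gamma> - 1) * (2 * (norm z)\<^sup>2)"
      by (simp add: b''_def algebra_simps)
    moreover have "0 \<le> \<gamma> * (\<gamma> + 1) * q s powr (- \<gamma> - 2) * (q' s)\<^sup>2"
      "0 \<le> \<gamma> * q s powr (- \<gamma> - 1) * (2 * (norm z)\<^sup>2)" using \<gamma> by simp_all
    ultimately have "\<bar>b'' s\<bar> \<le> \<gamma> * (\<gamma> + 1) * b s * (norm z)\<^sup>2 + 2 * \<gamma> * b s * (norm z)\<^sup>2"
      using 1 2 by linarith
    then show ?thesis by (simp add: algebra_simps)
  qed
  have m_le: "0 \<le> m s" "m s \<le> b s" for s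
    using assms(2) b_nonneg[of s] by (auto simp: m_def)
  have b_cube: "b s ^ 3 = tail_weight \<alpha> (x + s *\<^sub>R z)" for s
    using truncated_weight_0[of \<alpha> "x + s *\<^sub>R z"]
    unfolding truncated_weight_def exponent b_def q_def by simp
  define K where "K = D * 3 powr ((real DIM('a) + \<alpha>) / 2) * tail_weight \<alpha> x * (norm z)\<^sup>2"
  have D0: "D \<ge> 0" using \<gamma> by (simp add: D_def)
  have "\<bar>G'' s\<bar> \<le> K" if "\<bar>s\<bar> \<le> 1" for s
  proof -
    have "(b' s)\<^sup>2 \<le> (\<gamma> * b s * norm z)\<^sup>2"
      using power_mono[OF b'_le[of s], of 2] by simp
    then have 1: "6 * m s * (b' s)\<^sup>2 \<le> 6 * b s * (\<gamma> * b s * norm z)\<^sup>2"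
      using m_le[of s] by (intro mult_mono) auto
    have 2: "3 * (m s)\<^sup>2 * \<bar>b'' s\<bar> \<le> 3 * (b s)\<^sup>2 * (\<gamma> * (\<gamma> + 3) * b s * (norm z)\<^sup>2)"
      using m_le[of s] b''_le[of s] by (intro mult_mono power_mono) auto
    have "\<bar>G'' s\<bar> \<le> \<bar>6 * m s * (b' s)\<^sup>2\<bar> + \<bar>3 * (m s)\<^sup>2 * b'' s\<bar>"
      unfolding G''_def by (rule abs_triangle_ineq)
    also have "\<dots> \<le> 6 * b s * (\<gamma> * b s * norm z)\<^sup>2 + 3 * (b s)\<^sup>2 * (\<gamma> * (\<gamma> + 3) * b s * (norm z)\<^sup>2)"
      using 1 2 m_le[of s] by (intro add_mono) (simp_all add: abs_mult)
    also have "\<dots> = D * (norm z)\<^sup>2 * tail_weight \<alpha> (x + s *\<^sub>R z)"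
      unfolding b_cube[symmetric] D_def by (simp add: power2_eq_square power3_eq_cube algebra_simps)
    also have "\<dots> \<le> D * (norm z)\<^sup>2 * (3 powr ((real DIM('a) + \<alpha>) / 2) * tail_weight \<alpha> x)"
      using D0 that assms by (intro mult_left_mono tail_weight_shift_le) (auto intro: mult_le_one)
    finally show ?thesis by (simp add: K_def mult_ac)
  qed
  then have "\<bar>G 1 + G (- 1) - 2 * G 0\<bar> \<le> 2 * K"
    by (intro second_difference_bound[OF G_deriv G'_deriv])
  moreover have "G s = truncated_weight \<alpha> \<epsilon> (x + s *\<^sub>R z)" for s
    unfolding G_def m_def b_def q_def truncated_weight_def exponent ..
  ultimately show ?thesis by (simp add: diff2_def K_def mult.assoc)
qed

text \<open>Small jumps are handled by the bound along lines. For large jumps the kernel is itself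
  at most a multiple of the weight, and the product inequality extracts the factor rho(x). What
  remains has an integral in z that does not depend on x.\<close>

lemma integral_diff2_truncated_weight:
  assumes "0 < \<alpha>" "\<alpha> < 2"
  obtains C where "C \<ge> 0"
    "\<And>\<epsilon> x. \<epsilon> \<ge> 0 \<Longrightarrow> integrable lborel (\<lambda>z. jump_kernel \<alpha> z * diff2 (truncated_weight \<alpha> \<epsilon>) (x::'a::euclidean_space) z)"
    "\<And>\<epsilon> x. \<epsilon> \<ge> 0 \<Longrightarrow> (LINT z|lborel. \<bar>jump_kernel \<alpha> z * diff2 (truncated_weight \<alpha> \<epsilon>) (x::'a) z\<bar>)
        \<le> C * tail_weight \<alpha> x"
proof -
  let ?\<rho> = "tail_weight \<alpha> :: 'a \<Rightarrow> real" and ?\<beta> = "(real DIM('a) + \<alpha>) / 2" and ?\<gamma> = "(real DIM('a) + \<alpha>) / 6"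
  define E where "E = 2 * (6 * ?\<gamma>\<^sup>2 + 3 * ?\<gamma> * (?\<gamma> + 3)) * 3 powr ?\<beta>"
  define A where "A = 2 powr ?\<beta> * 4 powr ?\<beta>"
  \<comment> \<open>A pays for the products rho(x + z) rho(z) and rho(x - z) rho(z), the 2 for the
    central value in the second difference, and E for the jumps of length at most 1.\<close>
  define C1 where "C1 = A + 2 + E"
  \<comment> \<open>Every summand is integrable in z, and by translation and reflection its integral
    is independent of x.\<close>
  define W where "W x z = ?\<rho> (x + z) + ?\<rho> (x - z) + 2 * ?\<rho> z + min 1 ((norm z)\<^sup>2) * jump_kernel \<alpha> z" for x z
  have E: "E \<ge> 0" using assms by (simp add: E_def)
  have A: "A \<ge> 0" by (simp add: A_def)
  have C1: "C1 \<ge> 0" using A E by (simp add: C1_def)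
  define I where "I = (LINT z|lborel. min 1 ((norm z)\<^sup>2) * jump_kernel \<alpha> (z::'a))"
  have int_plus: "integrable lborel (\<lambda>z. ?\<rho> (x + z))" "(LINT z|lborel. ?\<rho> (x + z)) = (LINT z|lborel. ?\<rho> z)" for x
    using integrable_lborel_translate[of ?\<rho> x] integral_lborel_translate[of ?\<rho> x] integrable_tail_weight[OF assms]
    by simp_all
  have int_minus: "integrable lborel (\<lambda>z. ?\<rho> (x - z))" "(LINT z|lborel. ?\<rho> (x - z)) = (LINT z|lborel. ?\<rho> z)" for x
    using integrable_lborel_affine[of ?\<rho> "-1" x] integral_lborel_affine[of ?\<rho> "-1" x] integrable_tail_weight[OF assms]
    by simp_all
  have W_int: "integrable lborel (W x)" for x
    unfolding W_def
    by (intro Bochner_Integration.integrable_add int_plus int_minus integrable_mult_right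
        integrable_tail_weight integrable_jump_kernel assms)
  have W_integral: "(LINT z|lborel. W x z) = 4 * (LINT z|lborel. ?\<rho> z) + I" for x
    unfolding W_def I_def
    by (simp add: int_plus int_minus integrable_tail_weight integrable_jump_kernel assms)
  have W_nonneg: "W x z \<ge> 0" for x z by (simp add: W_def)
  have bound: "\<bar>jump_kernel \<alpha> z * diff2 (truncated_weight \<alpha> \<epsilon>) x z\<bar> \<le> C1 * ?\<rho> x * W x z"
    if "\<epsilon> \<ge> 0" for \<epsilon> x z
  proof (cases "norm z \<le> 1")
    case True
    then have "(norm z)\<^sup>2 \<le> 1" by (simp add: power_le_one)
    then have m: "min 1 ((norm z)\<^sup>2) = (norm z)\<^sup>2" by simp
    have "\<bar>jump_kernel \<alpha> z * diff2 (truncated_weight \<alpha> \<epsilon>) x z\<bar> \<le> jump_kernel \<alpha> z * (E * ?\<rho> x * (norm z)\<^sup>2)"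
      unfolding abs_mult abs_of_nonneg[OF jump_kernel_nonneg] E_def
      by (intro mult_left_mono truncated_weight_line_bound assms that True) simp
    also have "\<dots> = E * ?\<rho> x * (min 1 ((norm z)\<^sup>2) * jump_kernel \<alpha> z)" by (simp only: m mult_ac)
    also have "\<dots> \<le> C1 * ?\<rho> x * W x z"
      using A E C1 by (intro mult_mono) (auto simp: C1_def W_def)
    finally show ?thesis .
  next
    case False
    then have z: "norm z \<ge> 1" by simp
    have tw: "0 \<le> truncated_weight \<alpha> \<epsilon> y" "truncated_weight \<alpha> \<epsilon> y \<le> ?\<rho> y" for y :: 'a
      using truncated_weight_le[OF that] by auto
    have m: "min 1 ((norm z)\<^sup>2) = 1" using z by (simp add: one_le_power)
    have J: "jump_kernel \<alpha> z \<le> 2 powr ?\<beta> * ?\<rho> z" using assms z by (intro jump_kernel_le_tail_weight)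
    have P: "jump_kernel \<alpha> z * ?\<rho> y \<le> A * ?\<rho> x * (?\<rho> y + ?\<rho> z)"
      if "y = x + z \<or> y = x - z" for y
    proof -
      \<comment> \<open>The vector from y to x is z or -z, and the weight is even; this puts both
        cases into the form y + z' = x required by the product inequality.\<close>
      have "\<exists>z'. ?\<rho> z' = ?\<rho> z \<and> y + z' = x"
        using that by (intro exI[of _ "x - y"]) (auto simp: tail_weight_def)
      then obtain z' where z': "?\<rho> z' = ?\<rho> z" "y + z' = x" by blast
      have "jump_kernel \<alpha> z * ?\<rho> y \<le> 2 powr ?\<beta> * ?\<rho> z * ?\<rho> y"
        by (intro mult_right_mono J) simp
      also have "\<dots> = 2 powr ?\<beta> * (?\<rho> y * ?\<rho> z')" using z' by simp
      also have "\<dots> \<le> 2 powr ?\<beta> * (4 powr ?\<beta> * ?\<rho> (y + z') * (?\<rho> y + ?\<rho> z'))"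
        using assms by (intro mult_left_mono tail_weight_product_le) auto
      finally show ?thesis by (simp add: z' A_def mult.assoc)
    qed
    have "\<bar>diff2 (truncated_weight \<alpha> \<epsilon>) x z\<bar> \<le> ?\<rho> (x + z) + ?\<rho> (x - z) + 2 * ?\<rho> x"
      unfolding diff2_def real_scaleR_def using tw[of "x + z"] tw[of "x - z"] tw[of x] by linarith
    then have "\<bar>jump_kernel \<alpha> z * diff2 (truncated_weight \<alpha> \<epsilon>) x z\<bar>
        \<le> jump_kernel \<alpha> z * (?\<rho> (x + z) + ?\<rho> (x - z) + 2 * ?\<rho> x)"
      unfolding abs_mult abs_of_nonneg[OF jump_kernel_nonneg] by (intro mult_left_mono) auto
    also have "\<dots> = jump_kernel \<alpha> z * ?\<rho> (x + z) + jump_kernel \<alpha> z * ?\<rho> (x - z) + 2 * ?\<rho> x * jump_kernel \<alpha> z"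
      by (simp add: algebra_simps)
    also have "\<dots> \<le> A * ?\<rho> x * (?\<rho> (x + z) + ?\<rho> z) + A * ?\<rho> x * (?\<rho> (x - z) + ?\<rho> z) + 2 * ?\<rho> x * jump_kernel \<alpha> z"
      by (intro add_mono P) auto
    also have "\<dots> = (A * ?\<rho> x) * (?\<rho> (x + z) + ?\<rho> (x - z) + 2 * ?\<rho> z) + 2 * ?\<rho> x * jump_kernel \<alpha> z"
      by (simp add: algebra_simps)
    also have "\<dots> \<le> (C1 * ?\<rho> x) * (?\<rho> (x + z) + ?\<rho> (x - z) + 2 * ?\<rho> z) + C1 * ?\<rho> x * jump_kernel \<alpha> z"
      using A E by (intro add_mono mult_right_mono) (auto simp: C1_def)
    also have "\<dots> = C1 * ?\<rho> x * W x z" unfolding W_def m by (simp only: distrib_left mult_1)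
    finally show ?thesis .
  qed
  have C0: "C1 * (4 * (LINT z|lborel. ?\<rho> z) + I) \<ge> 0"
    using C1 unfolding I_def
    by (intro mult_nonneg_nonneg add_nonneg_nonneg Bochner_Integration.integral_nonneg) auto
  have meas: "(\<lambda>z. jump_kernel \<alpha> z * diff2 (truncated_weight \<alpha> \<epsilon>) (x::'a) z) \<in> borel_measurable lborel" for \<epsilon> x
    by measurable
  have int: "integrable lborel (\<lambda>z. jump_kernel \<alpha> z * diff2 (truncated_weight \<alpha> \<epsilon>) (x::'a) z)" if "\<epsilon> \<ge> 0" for \<epsilon> x
  proof (rule Bochner_Integration.integrable_bound[OF _ meas])
    show "integrable lborel (\<lambda>z. C1 * ?\<rho> x * W x z)" by (intro integrable_mult_right W_int)
    show "AE z in lborel. norm (jump_kernel \<alpha> z * diff2 (truncated_weight \<alpha> \<epsilon>) x z) \<le> norm (C1 * ?\<rho> x * W x z)"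
      using order_trans[OF bound[OF that] abs_ge_self] by (auto simp del: abs_mult)
  qed
  have "(LINT z|lborel. \<bar>jump_kernel \<alpha> z * diff2 (truncated_weight \<alpha> \<epsilon>) (x::'a) z\<bar>)
      \<le> C1 * (4 * (LINT z|lborel. ?\<rho> z) + I) * ?\<rho> x" if "\<epsilon> \<ge> 0" for \<epsilon> x
  proof -
    have "(LINT z|lborel. \<bar>jump_kernel \<alpha> z * diff2 (truncated_weight \<alpha> \<epsilon>) (x::'a) z\<bar>)
        \<le> (LINT z|lborel. C1 * ?\<rho> x * W x z)"
      by (intro integral_mono integrable_abs int that bound integrable_mult_right W_int)
    then show ?thesis by (simp add: W_integral mult_ac)
  qed
  then show ?thesis using that[OF C0 int] by blast
qed

section \<open>Scaling and symmetry\<close>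

lemma one_plus_norm_square_powr_ge_imp_bounded:
  assumes "c > 0" "\<epsilon> > 0" "\<epsilon> \<le> (1 + (norm x)\<^sup>2) powr - c"
  shows "norm x \<le> sqrt (\<epsilon> powr (- 1 / c))"
proof -
  have "((1 + (norm x)\<^sup>2) powr - c) powr (- 1 / c) \<le> \<epsilon> powr (- 1 / c)"
    using assms by (intro powr_mono2') auto
  then have "1 + (norm x)\<^sup>2 \<le> \<epsilon> powr (- 1 / c)"
    using assms less_imp_le[OF one_plus_norm_square_pos[of x]] by (simp add: powr_powr)
  then show ?thesis
    by (intro real_le_rsqrt) linarith
qed

lemma truncated_weight_compact_support:
  assumes "\<alpha> > 0" "\<epsilon> > 0"
  obtains r where "\<And>x::'a::euclidean_space. norm x > r \<Longrightarrow> truncated_weight \<alpha> \<epsilon> x = 0"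
proof
  let ?c = "(real DIM('a) + \<alpha>) / 6"
  fix x :: 'a assume x: "norm x > sqrt (\<epsilon> powr (- 1 / ?c))"
  have "(1 + (norm x)\<^sup>2) powr - ?c < \<epsilon>"
    using one_plus_norm_square_powr_ge_imp_bounded[of ?c \<epsilon> x] x assms
    by (force simp: add_nonneg_pos not_le[symmetric])
  then show "truncated_weight \<alpha> \<epsilon> x = 0"
    unfolding truncated_weight_def minus_divide_left[symmetric] by simp
qed

lemma compact_tail_weight_ge:
  assumes "\<alpha> > 0" "\<epsilon> > 0" "R > 0"
  shows "compact {x::'a::euclidean_space. tail_weight \<alpha> (x /\<^sub>R R) \<ge> \<epsilon>}"
proof -
  let ?c = "(real DIM('a) + \<alpha>) / 2"
  have "norm x \<le> R * sqrt (\<epsilon> powr (- 1 / ?c))" if "tail_weight \<alpha> (x /\<^sub>R R) \<ge> \<epsilon>" for x :: 'a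
  proof -
    have "\<epsilon> \<le> (1 + (norm (x /\<^sub>R R))\<^sup>2) powr - ?c"
      using that unfolding tail_weight_def minus_divide_left[symmetric] .
    then have "norm (x /\<^sub>R R) \<le> sqrt (\<epsilon> powr (- 1 / ?c))"
      using assms by (intro one_plus_norm_square_powr_ge_imp_bounded) (auto simp: add_nonneg_pos)
    then show ?thesis using assms by (simp add: field_simps)
  qed
  then have "bounded {x::'a. tail_weight \<alpha> (x /\<^sub>R R) \<ge> \<epsilon>}"
    unfolding bounded_iff by blast
  moreover have "closed {x::'a. tail_weight \<alpha> (x /\<^sub>R R) \<ge> \<epsilon>}"
    by (intro closed_Collect_le continuous_intros)
  ultimately show ?thesis by (simp add: compact_eq_bounded_closed)
qed

lemma tail_weight_tendsto_1:
  assumes "filterlim R at_top F"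
  shows "((\<lambda>n. tail_weight \<alpha> ((x::'a::euclidean_space) /\<^sub>R R n)) \<longlongrightarrow> 1) F"
proof -
  have "((\<lambda>n. inverse (R n)) \<longlongrightarrow> 0) F"
    using tendsto_inverse_0_at_top[OF assms] .
  then have "((\<lambda>n. x /\<^sub>R R n) \<longlongrightarrow> 0 *\<^sub>R x) F"
    by (intro tendsto_intros)
  moreover have "isCont (tail_weight \<alpha> :: 'a \<Rightarrow> real) 0"
    using continuous_on_weight(2)[of UNIV "\<lambda>x::'a. x" \<alpha>] by (simp add: continuous_on_eq_continuous_at)
  ultimately have "((\<lambda>n. tail_weight \<alpha> (x /\<^sub>R R n)) \<longlongrightarrow> tail_weight \<alpha> (0::'a)) F"
    using isCont_tendsto_compose by fastforce
  then show ?thesis by (simp add: tail_weight_def)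
qed

definition scaled_weight :: "real \<Rightarrow> real \<Rightarrow> real \<Rightarrow> 'a::euclidean_space \<Rightarrow> real" where
  "scaled_weight \<alpha> \<epsilon> R x = truncated_weight \<alpha> \<epsilon> (x /\<^sub>R R)"

lemma scaled_weight_0: "scaled_weight \<alpha> 0 R x = tail_weight \<alpha> (x /\<^sub>R R)"
  by (simp add: scaled_weight_def truncated_weight_0)

lemma scaled_weight_nonneg [simp]: "scaled_weight \<alpha> \<epsilon> R x \<ge> 0"
  by (simp add: scaled_weight_def)

lemma scaled_weight_le: "\<epsilon> \<ge> 0 \<Longrightarrow> scaled_weight \<alpha> \<epsilon> R x \<le> tail_weight \<alpha> (x /\<^sub>R R)"
  by (simp add: scaled_weight_def truncated_weight_le)

lemma continuous_on_scaled_weight [continuous_intros]: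
  fixes f :: "'b::topological_space \<Rightarrow> 'a::euclidean_space"
  shows "continuous_on S f \<Longrightarrow> continuous_on S (\<lambda>x. scaled_weight \<alpha> \<epsilon> R (f x))"
  unfolding scaled_weight_def by (intro continuous_intros)

lemma scaled_weight_measurable [measurable]: "scaled_weight \<alpha> \<epsilon> R \<in> borel_measurable borel"
  by (intro borel_measurable_continuous_onI continuous_intros)

lemma integrable_tail_weight_scaled:
  assumes "0 < \<alpha>" "\<alpha> < 2" "R > 0"
  shows "integrable lborel (\<lambda>x::'a::euclidean_space. tail_weight \<alpha> (x /\<^sub>R R))"
  using integrable_lborel_affine[of "tail_weight \<alpha> :: 'a \<Rightarrow> real" "inverse R" 0] integrable_tail_weight[of \<alpha>] assms
  by simp

lemma integrable_scaled_weight: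
  assumes "0 < \<alpha>" "\<alpha> < 2" "R > 0" "\<epsilon> \<ge> 0"
  shows "integrable lborel (scaled_weight \<alpha> \<epsilon> R :: 'a::euclidean_space \<Rightarrow> real)"
proof (rule Bochner_Integration.integrable_bound)
  show "integrable lborel (\<lambda>x::'a. tail_weight \<alpha> (x /\<^sub>R R))"
    by (intro integrable_tail_weight_scaled assms)
  show "AE x in lborel. norm (scaled_weight \<alpha> \<epsilon> R (x::'a)) \<le> norm (tail_weight \<alpha> (x /\<^sub>R R))"
    using scaled_weight_le[OF assms(4)] by auto
qed measurable

text \<open>Rescaling z by R gives R^d from the volume and R powr - (d + \<alpha>) from the kernel.
  The resulting R powr - \<alpha> makes the diffusion error vanish for wide weights.\<close>

lemma integral_diff2_scaled_weight:
  assumes "0 < \<alpha>" "\<alpha> < 2"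
  obtains C where "C \<ge> 0"
    "\<And>\<epsilon> R x. \<epsilon> \<ge> 0 \<Longrightarrow> R > 0 \<Longrightarrow>
      integrable lborel (\<lambda>z. jump_kernel \<alpha> z * diff2 (scaled_weight \<alpha> \<epsilon> R) (x::'a::euclidean_space) z)"
    "\<And>\<epsilon> R x. \<epsilon> \<ge> 0 \<Longrightarrow> R > 0 \<Longrightarrow>
      (LINT z|lborel. \<bar>jump_kernel \<alpha> z * diff2 (scaled_weight \<alpha> \<epsilon> R) (x::'a) z\<bar>)
        \<le> C * R powr - \<alpha> * tail_weight \<alpha> (x /\<^sub>R R)"
proof -
  obtain C where C: "C \<ge> 0"
    and int: "\<And>\<epsilon> x. \<epsilon> \<ge> 0 \<Longrightarrow> integrable lborel (\<lambda>z. jump_kernel \<alpha> z * diff2 (truncated_weight \<alpha> \<epsilon>) (x::'a) z)"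
    and bound: "\<And>\<epsilon> x. \<epsilon> \<ge> 0 \<Longrightarrow> (LINT z|lborel. \<bar>jump_kernel \<alpha> z * diff2 (truncated_weight \<alpha> \<epsilon>) (x::'a) z\<bar>)
        \<le> C * tail_weight \<alpha> x"
    by (rule integral_diff2_truncated_weight[OF assms, where 'a='a]) (rule that)
  show ?thesis
  proof (rule that[OF C])
    fix \<epsilon> R :: real and x :: 'a assume \<epsilon>: "\<epsilon> \<ge> 0" and R: "R > 0"
    let ?f = "\<lambda>z. jump_kernel \<alpha> z * diff2 (truncated_weight \<alpha> \<epsilon>) (x /\<^sub>R R) z"
    have [measurable]: "?f \<in> borel_measurable borel" by measurable
    have eq: "jump_kernel \<alpha> z * diff2 (scaled_weight \<alpha> \<epsilon> R) x z
        = R powr - (real DIM('a) + \<alpha>) * ?f (0 + inverse R *\<^sub>R z)" for z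
    proof -
      have "jump_kernel \<alpha> z = R powr - (real DIM('a) + \<alpha>) * jump_kernel \<alpha> (inverse R *\<^sub>R z)"
        using jump_kernel_scaleR[OF R, of \<alpha> "inverse R *\<^sub>R z"] R by simp
      moreover have "diff2 (scaled_weight \<alpha> \<epsilon> R) x z = diff2 (truncated_weight \<alpha> \<epsilon>) (x /\<^sub>R R) (inverse R *\<^sub>R z)"
        by (simp add: diff2_def scaled_weight_def scaleR_add_right scaleR_diff_right)
      ultimately show ?thesis by simp
    qed
    have "integrable lborel (\<lambda>z. ?f (0 + inverse R *\<^sub>R z))"
      using R by (subst integrable_lborel_affine) (auto intro: int[OF \<epsilon>])
    then show "integrable lborel (\<lambda>z. jump_kernel \<alpha> z * diff2 (scaled_weight \<alpha> \<epsilon> R) x z)"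
      unfolding eq by (rule integrable_mult_right)
    have "(LINT z|lborel. \<bar>?f z\<bar>) = inverse R ^ DIM('a) * (LINT z|lborel. \<bar>?f (0 + inverse R *\<^sub>R z)\<bar>)"
      using R by (subst integral_lborel_affine[of _ "inverse R" 0]) auto
    then have "(LINT z|lborel. \<bar>?f (0 + inverse R *\<^sub>R z)\<bar>) = R ^ DIM('a) * (LINT z|lborel. \<bar>?f z\<bar>)"
      using R by (simp add: field_simps)
    then have "(LINT z|lborel. \<bar>jump_kernel \<alpha> z * diff2 (scaled_weight \<alpha> \<epsilon> R) x z\<bar>)
        = (R powr - (real DIM('a) + \<alpha>) * R ^ DIM('a)) * (LINT z|lborel. \<bar>?f z\<bar>)"
      unfolding eq by (subst abs_mult) (simp add: mult.assoc)
    also have "R powr - (real DIM('a) + \<alpha>) * R ^ DIM('a) = R powr - \<alpha>"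
      using R by (simp flip: powr_realpow powr_add)
    also have "R powr - \<alpha> * (LINT z|lborel. \<bar>?f z\<bar>) \<le> R powr - \<alpha> * (C * tail_weight \<alpha> (x /\<^sub>R R))"
      by (intro mult_left_mono bound \<epsilon>) simp
    finally show "(LINT z|lborel. \<bar>jump_kernel \<alpha> z * diff2 (scaled_weight \<alpha> \<epsilon> R) x z\<bar>)
        \<le> C * R powr - \<alpha> * tail_weight \<alpha> (x /\<^sub>R R)"
      by (simp add: mult_ac)
  qed
qed

lemma integrable_lborel_pairI:
  fixes f :: "'a::euclidean_space \<times> 'b::euclidean_space \<Rightarrow> real"
  assumes f[measurable]: "f \<in> borel_measurable (lborel \<Otimes>\<^sub>M lborel)"
    and int: "\<And>x. integrable lborel (\<lambda>z. f (x, z))"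
    and le: "\<And>x. (LINT z|lborel. \<bar>f (x, z)\<bar>) \<le> G x" and G: "integrable lborel G"
  shows "integrable (lborel \<Otimes>\<^sub>M lborel) f"
proof (rule lborel_pair.Fubini_integrable[OF f])
  show "integrable lborel (\<lambda>x. LINT z|lborel. norm (f (x, z)))"
  proof (rule Bochner_Integration.integrable_bound[OF G])
    show "AE x in lborel. norm (LINT z|lborel. norm (f (x, z))) \<le> norm (G x)"
      using order_trans[OF le abs_ge_self] by (auto intro!: AE_I2)
  qed measurable
  show "AE x in lborel. integrable lborel (\<lambda>z. f (x, z))"
    using int by simp
qed

text \<open>For fixed z, integration in x lets the shifts be moved from u to g by translation
  invariance. The rest is Fubini, needed once on each side with different dominations: on the left
  the second differences of u are small and g is integrable, on the right u is bounded and G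
  controls the second differences of g.\<close>

lemma diff2_integral_symmetric:
  fixes u g G :: "'a::euclidean_space \<Rightarrow> real"
  assumes \<alpha>: "0 < \<alpha>" "\<alpha> < 2"
    and u[measurable]: "u \<in> borel_measurable borel" and B: "\<And>x. \<bar>u x\<bar> \<le> B"
    and C: "\<And>x z. \<bar>diff2 u x z\<bar> \<le> C * min 1 ((norm z)\<^sup>2)"
    and g[measurable]: "g \<in> borel_measurable borel" and g_int: "integrable lborel g"
    and g_diff2: "\<And>x. integrable lborel (\<lambda>z. jump_kernel \<alpha> z * diff2 g x z)"
      "\<And>x. (LINT z|lborel. \<bar>jump_kernel \<alpha> z * diff2 g x z\<bar>) \<le> G x"
    and G: "integrable lborel G"
  shows "(LINT x|lborel. diff2_integral \<alpha> u x * g x) = (LINT x|lborel. u x * diff2_integral \<alpha> g x)"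
proof -
  define F where "F x z = jump_kernel \<alpha> z * diff2 u x z * g x" for x z
  define H where "H x z = u x * (jump_kernel \<alpha> z * diff2 g x z)" for x z
  define I where "I = (LINT z|lborel. min 1 ((norm z)\<^sup>2) * jump_kernel \<alpha> (z::'a))"
  have u_diff2: "integrable lborel (\<lambda>z. jump_kernel \<alpha> z * diff2 u x z)" for x
    using integrable_jump_kernel_scaleR[OF \<alpha>, of "diff2 u x" C] C by simp
  have meas: "(\<lambda>(x, z). F x z) \<in> borel_measurable (lborel \<Otimes>\<^sub>M lborel)"
    "(\<lambda>(x, z). H x z) \<in> borel_measurable (lborel \<Otimes>\<^sub>M lborel)"
    unfolding F_def H_def by measurable
  have F: "integrable (lborel \<Otimes>\<^sub>M lborel) (\<lambda>(x, z). F x z)"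
  proof (rule integrable_lborel_pairI[OF meas(1)])
    fix x
    show "integrable lborel (\<lambda>z. case (x, z) of (x, z) \<Rightarrow> F x z)"
      unfolding F_def prod.case by (intro integrable_mult_left u_diff2)
    have "(LINT z|lborel. \<bar>jump_kernel \<alpha> z * diff2 u x z\<bar>)
        \<le> (LINT z|lborel. C * (min 1 ((norm z)\<^sup>2) * jump_kernel \<alpha> (z::'a)))"
    proof (intro integral_mono integrable_abs u_diff2 integrable_mult_right integrable_jump_kernel \<alpha>)
      fix z
      show "\<bar>jump_kernel \<alpha> z * diff2 u x z\<bar> \<le> C * (min 1 ((norm z)\<^sup>2) * jump_kernel \<alpha> z)"
        using mult_left_mono[OF C jump_kernel_nonneg, of \<alpha> z x z] by (simp add: abs_mult mult_ac)
    qed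
    then have "(LINT z|lborel. \<bar>jump_kernel \<alpha> z * diff2 u x z\<bar>) * \<bar>g x\<bar> \<le> C * I * \<bar>g x\<bar>"
      by (intro mult_right_mono) (simp_all add: I_def)
    then show "(LINT z|lborel. \<bar>case (x, z) of (x, z) \<Rightarrow> F x z\<bar>) \<le> C * I * \<bar>g x\<bar>"
      by (simp add: F_def abs_mult)
  qed (intro integrable_mult_right integrable_abs g_int)
  have H: "integrable (lborel \<Otimes>\<^sub>M lborel) (\<lambda>(x, z). H x z)"
  proof (rule integrable_lborel_pairI[OF meas(2)])
    fix x
    show "integrable lborel (\<lambda>z. case (x, z) of (x, z) \<Rightarrow> H x z)"
      unfolding H_def prod.case by (intro integrable_mult_right g_diff2)
    have "\<bar>u x\<bar> * (LINT z|lborel. \<bar>jump_kernel \<alpha> z * diff2 g x z\<bar>) \<le> B * G x"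
      using g_diff2(2)[of x] B[of x]
      by (intro mult_mono order_trans[OF abs_ge_zero B] Bochner_Integration.integral_nonneg) auto
    then show "(LINT z|lborel. \<bar>case (x, z) of (x, z) \<Rightarrow> H x z\<bar>) \<le> B * G x"
      by (simp add: H_def abs_mult)
  qed (intro integrable_mult_right G)
  have bounded_mult: "integrable lborel (\<lambda>x. u (x + a) * g (x + b))" for a b
  proof (rule Bochner_Integration.integrable_bound)
    show "integrable lborel (\<lambda>x. B * g (x + b))"
      using g_int integrable_lborel_translate[OF g, of b] by (simp add: add.commute)
    show "AE x in lborel. norm (u (x + a) * g (x + b)) \<le> norm (B * g (x + b))"
      using order_trans[OF B abs_ge_self] by (auto simp: abs_mult intro!: AE_I2 mult_right_mono)
  qed measurable
  have shift: "(LINT x|lborel. u (x + a) * g x) = (LINT x|lborel. u x * g (x - a))" for a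
    using integral_lborel_translate[of "\<lambda>x. u x * g (x - a)" a] by (simp add: add.commute)
  have swap: "(LINT x|lborel. F x z) = (LINT x|lborel. H x z)" for z
  proof -
    have i: "integrable lborel (\<lambda>x. u (x + z) * g x)" "integrable lborel (\<lambda>x. u (x - z) * g x)"
      "integrable lborel (\<lambda>x. u x * g x)" "integrable lborel (\<lambda>x. u x * g (x + z))"
      "integrable lborel (\<lambda>x. u x * g (x - z))"
      using bounded_mult[of z 0] bounded_mult[of "- z" 0] bounded_mult[of 0 0]
        bounded_mult[of 0 z] bounded_mult[of 0 "- z"] by simp_all
    have "(LINT x|lborel. diff2 u x z * g x)
        = (LINT x|lborel. u (x + z) * g x + u (x - z) * g x - 2 * (u x * g x))"
      by (simp add: diff2_def algebra_simps)
    also have "\<dots> = (LINT x|lborel. u (x + z) * g x) + (LINT x|lborel. u (x - z) * g x)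
        - 2 * (LINT x|lborel. u x * g x)"
      using i by simp
    also have "\<dots> = (LINT x|lborel. u x * g (x - z)) + (LINT x|lborel. u x * g (x + z))
        - 2 * (LINT x|lborel. u x * g x)"
      using shift[of z] shift[of "- z"] by simp
    also have "\<dots> = (LINT x|lborel. u x * g (x - z) + u x * g (x + z) - 2 * (u x * g x))"
      using i by simp
    also have "\<dots> = (LINT x|lborel. u x * diff2 g x z)"
      by (simp add: diff2_def algebra_simps)
    finally have "jump_kernel \<alpha> z * (LINT x|lborel. diff2 u x z * g x)
        = jump_kernel \<alpha> z * (LINT x|lborel. u x * diff2 g x z)" by simp
    then show ?thesis by (simp add: F_def H_def mult_ac flip: integral_mult_right_zero)
  qed
  have "(LINT x|lborel. diff2_integral \<alpha> u x * g x) = (LINT x|lborel. LINT z|lborel. F x z)"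
    by (simp add: diff2_integral_def F_def)
  also have "\<dots> = (LINT z|lborel. LINT x|lborel. F x z)"
    by (rule lborel_pair.Fubini_integral[symmetric, OF F])
  also have "\<dots> = (LINT z|lborel. LINT x|lborel. H x z)" by (simp add: swap)
  also have "\<dots> = (LINT x|lborel. LINT z|lborel. H x z)"
    by (rule lborel_pair.Fubini_integral[OF H])
  also have "\<dots> = (LINT x|lborel. u x * diff2_integral \<alpha> g x)"
    by (simp add: diff2_integral_def H_def)
  finally show ?thesis .
qed

section \<open>Maximum principle\<close>

(* Penalizing with N (1 - rho(x/R)) forces the maximum to be attained; there the diffusion term is at most
   that of the penalization, which is O(R^-\<alpha>). *)
lemma nonlocal_maximum_principle:
  fixes w wt :: "real \<Rightarrow> 'a::euclidean_space \<Rightarrow> real" and \<kappa> :: "real \<Rightarrow> real"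
  assumes \<alpha>: "0 < \<alpha>" "\<alpha> < 2"
    and cont: "continuous_on ({0..T} \<times> UNIV) (\<lambda>(t, x). w t x)"
    and K: "\<And>t x. t \<in> {0..T} \<Longrightarrow> \<bar>w t x\<bar> \<le> K"
    and Cb2: "\<And>t. t \<in> {0<..T} \<Longrightarrow> w t \<in> Cb2"
    and deriv: "\<And>t x. t \<in> {0<..T} \<Longrightarrow> ((\<lambda>s. w s x) has_real_derivative wt t x) (at t)"
    and wt: "\<And>t x. t \<in> {0<..T} \<Longrightarrow> w t x > m \<Longrightarrow> wt t x \<le> \<kappa> t * diff2_integral \<alpha> (w t) x"
    and \<kappa>: "\<And>t. t \<in> {0<..T} \<Longrightarrow> 0 \<le> \<kappa> t" "\<And>t. t \<in> {0<..T} \<Longrightarrow> \<kappa> t \<le> \<kappa>max"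
    and init: "\<And>x. w 0 x \<le> m" and t0: "t0 \<in> {0..T}"
  shows "w t0 x0 \<le> m"
proof (rule ccontr)
  assume "\<not> w t0 x0 \<le> m"
  define \<eta> where "\<eta> = w t0 x0 - m"
  have \<eta>: "\<eta> > 0" using \<open>\<not> w t0 x0 \<le> m\<close> by (simp add: \<eta>_def)
  have T: "T \<ge> 0" "0 \<in> {0..T}" using t0 by auto
  have K0: "K \<ge> 0" using order_trans[OF abs_ge_zero K[OF T(2)]] .
  \<comment> \<open>Where rho \<le> 1/2 the penalty is at least N / 2 = K + |m| + 1, which exceeds w
    - m; hence v is negative outside a compact set.\<close>
  define N where "N = 2 * (K + \<bar>m\<bar> + 1)"
  have N: "N > 0" using K0 by (simp add: N_def)
  \<comment> \<open>The tilt in time makes the inequality at the maximum strict, while consuming at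
    most a quarter of the excess \<eta> over [0, T].\<close>
  define \<delta> where "\<delta> = \<eta> / (4 * (T + 1))"
  have \<delta>: "\<delta> > 0" "\<delta> * T \<le> \<eta> / 4" using \<eta> T by (auto simp: \<delta>_def field_simps)
  obtain C where C: "C \<ge> 0"
    and int: "\<And>\<epsilon> R x. \<epsilon> \<ge> 0 \<Longrightarrow> R > 0 \<Longrightarrow>
      integrable lborel (\<lambda>z. jump_kernel \<alpha> z * diff2 (scaled_weight \<alpha> \<epsilon> R) (x::'a) z)"
    and bound: "\<And>\<epsilon> R x. \<epsilon> \<ge> 0 \<Longrightarrow> R > 0 \<Longrightarrow>
      (LINT z|lborel. \<bar>jump_kernel \<alpha> z * diff2 (scaled_weight \<alpha> \<epsilon> R) (x::'a) z\<bar>)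
        \<le> C * R powr - \<alpha> * tail_weight \<alpha> (x /\<^sub>R R)"
    by (rule integral_diff2_scaled_weight[OF \<alpha>, where 'a='a]) (rule that)
  have "((\<lambda>R. N * (1 - tail_weight \<alpha> (x0 /\<^sub>R R))) \<longlongrightarrow> N * (1 - 1)) at_top"
    by (intro tendsto_intros tail_weight_tendsto_1 filterlim_ident)
  then have ev1: "eventually (\<lambda>R. N * (1 - tail_weight \<alpha> (x0 /\<^sub>R R)) < \<eta> / 4) at_top"
    using \<eta> by (auto dest!: order_tendstoD(2)[where a="\<eta> / 4"])
  have "((\<lambda>R. R powr - \<alpha>) \<longlongrightarrow> 0) at_top"
    using \<alpha> by (intro tendsto_neg_powr filterlim_ident) auto
  then have "((\<lambda>R. \<kappa>max * (N * (C * R powr - \<alpha>))) \<longlongrightarrow> \<kappa>max * (N * (C * 0))) at_top"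
    by (intro tendsto_intros)
  then have ev2: "eventually (\<lambda>R. \<kappa>max * (N * (C * R powr - \<alpha>)) < \<delta>) at_top"
    using \<delta> by (auto dest!: order_tendstoD(2)[where a=\<delta>])
  \<comment> \<open>The second condition keeps v positive at (t0, x0), since penalty and tilt
    together stay below \<eta> / 2; the third makes the diffusion of the penalty smaller than the
    tilt.\<close>
  obtain R where R: "R > 0" "N * (1 - tail_weight \<alpha> (x0 /\<^sub>R R)) < \<eta> / 4" "\<kappa>max * (N * (C * R powr - \<alpha>)) < \<delta>"
    using eventually_happens'[OF trivial_limit_at_top_linorder
        eventually_conj[OF eventually_gt_at_top[of 0] eventually_conj[OF ev1 ev2]]] by blast
  let ?\<rho> = "scaled_weight \<alpha> 0 R"
  define v where "v t x = w t x - m - N * (1 - ?\<rho> x) - \<delta> * t" for t x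
  define B where "B = {x::'a. tail_weight \<alpha> (x /\<^sub>R R) \<ge> 1 / 2}"
  have B: "compact B" unfolding B_def using \<alpha> R by (intro compact_tail_weight_ge) auto
  have outside: "v t x < 0" if "t \<in> {0..T}" "x \<notin> B" for t x
  proof -
    have "N * (1 - ?\<rho> x) \<ge> N * (1 / 2)"
      using that N by (intro mult_left_mono) (auto simp: B_def scaled_weight_0)
    moreover have "\<delta> * t \<ge> 0" using \<delta> that by simp
    ultimately show ?thesis using K[OF that(1), of x] by (simp add: v_def N_def)
  qed
  have v0: "v t0 x0 > 0"
  proof -
    have "\<delta> * t0 \<le> \<delta> * T" using t0 \<delta> by (intro mult_left_mono) auto
    then show ?thesis
      unfolding v_def scaled_weight_0 using R(2) \<delta>(2) \<eta> \<eta>_def by linarith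
  qed
  have "x0 \<in> B" using outside[OF t0, of x0] v0 by force
  have "continuous_on ({0..T} \<times> B) (\<lambda>(t, x). w t x)"
    by (rule continuous_on_subset[OF cont]) auto
  then have "continuous_on ({0..T} \<times> B) (\<lambda>(t, x). v t x)"
    unfolding v_def case_prod_beta by (intro continuous_intros)
  then have "\<exists>p\<in>{0..T} \<times> B. \<forall>p'\<in>{0..T} \<times> B. (\<lambda>(t, x). v t x) p' \<le> (\<lambda>(t, x). v t x) p"
    using t0 \<open>x0 \<in> B\<close> by (intro continuous_attains_sup compact_Times B) auto
  then obtain t1 x1 where t1: "t1 \<in> {0..T}" and x1: "x1 \<in> B"
    and max_B: "\<And>t x. t \<in> {0..T} \<Longrightarrow> x \<in> B \<Longrightarrow> v t x \<le> v t1 x1"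
    by auto
  have v1: "v t1 x1 > 0" using max_B[OF t0 \<open>x0 \<in> B\<close>] v0 by simp
  have max: "v t x \<le> v t1 x1" if "t \<in> {0..T}" for t x
    using max_B[OF that] outside[OF that] v1 by (cases "x \<in> B") force+
  have \<rho>_le: "N * (1 - ?\<rho> x1) \<ge> 0"
    using N \<alpha> tail_weight_le_1[of \<alpha> "x1 /\<^sub>R R"] by (simp add: scaled_weight_0)
  have "\<delta> * t1 \<ge> 0" using \<delta> t1 by simp
  then have w1: "w t1 x1 > m" using v1 \<rho>_le by (simp add: v_def)
  then have "t1 \<noteq> 0" using init[of x1] by auto
  then have t1': "t1 \<in> {0<..T}" using t1 by auto
  \<comment> \<open>The maximum may sit at the final time T, so only comparison with earlier times
    is available; it yields an inequality rather than a vanishing derivative.\<close>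
  have "wt t1 x1 - \<delta> \<ge> 0"
  proof (rule ccontr)
    assume neg: "\<not> wt t1 x1 - \<delta> \<ge> 0"
    have "((\<lambda>s. v s x1) has_real_derivative (wt t1 x1 - \<delta>)) (at t1)"
      unfolding v_def by (auto intro!: derivative_eq_intros deriv[OF t1'])
    then obtain d where d: "d > 0" "\<And>h. h > 0 \<Longrightarrow> h < d \<Longrightarrow> v t1 x1 < v (t1 - h) x1"
      using DERIV_neg_dec_left[of "\<lambda>s. v s x1" "wt t1 x1 - \<delta>" t1] neg by auto
    define h where "h = min (d / 2) t1"
    have "h > 0" "h < d" "t1 - h \<in> {0..T}" using d t1' by (auto simp: h_def)
    then show False using d(2)[of h] max[of "t1 - h" x1] by force
  qed
  then have "\<delta> \<le> \<kappa> t1 * diff2_integral \<alpha> (w t1) x1"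
    using wt[OF t1' w1] by linarith
  also have "\<dots> \<le> \<kappa> t1 * (N * (C * R powr - \<alpha>))"
  proof (rule mult_left_mono[OF _ \<kappa>(1)[OF t1']])
    have "diff2_integral \<alpha> (w t1) x1 \<le> (LINT z|lborel. N * \<bar>jump_kernel \<alpha> z * diff2 ?\<rho> x1 z\<bar>)"
      unfolding diff2_integral_def real_scaleR_def
    proof (intro integral_mono integrable_diff2_Cb2[OF \<alpha> Cb2[OF t1']] integrable_mult_right
        integrable_abs int R(1))
      fix z :: 'a
      \<comment> \<open>At a spatial maximum of v its second differences are nonpositive, and those
        of v equal those of w plus N times those of rho.\<close>
      have "diff2 (w t1) x1 z \<le> N * (- diff2 ?\<rho> x1 z)"
        using max[OF t1, of "x1 + z"] max[OF t1, of "x1 - z"] by (simp add: diff2_def v_def algebra_simps)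
      then have "jump_kernel \<alpha> z * diff2 (w t1) x1 z \<le> jump_kernel \<alpha> z * (N * (- diff2 ?\<rho> x1 z))"
        by (rule mult_left_mono) simp
      also have "\<dots> = N * - (jump_kernel \<alpha> z * diff2 ?\<rho> x1 z)" by simp
      also have "\<dots> \<le> N * \<bar>jump_kernel \<alpha> z * diff2 ?\<rho> x1 z\<bar>"
        using N by (intro mult_left_mono abs_ge_minus_self) simp
      finally show "jump_kernel \<alpha> z * diff2 (w t1) x1 z \<le> N * \<bar>jump_kernel \<alpha> z * diff2 ?\<rho> x1 z\<bar>" .
    qed simp
    also have "\<dots> \<le> N * (C * R powr - \<alpha> * tail_weight \<alpha> (x1 /\<^sub>R R))"
      using N bound[of 0 R x1] R by (simp add: mult_left_mono)
    also have "\<dots> \<le> N * (C * R powr - \<alpha> * 1)"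
      using N C \<alpha> by (intro mult_left_mono tail_weight_le_1) auto
    finally show "diff2_integral \<alpha> (w t1) x1 \<le> N * (C * R powr - \<alpha>)" by simp
  qed
  also have "\<dots> \<le> \<kappa>max * (N * (C * R powr - \<alpha>))"
    using N C by (intro mult_right_mono \<kappa>(2)[OF t1']) auto
  finally show False using R(3) by simp
qed

section \<open>Linear bounds for the absorption and multiples of solutions\<close>

text \<open>On [-K, K] a convex function vanishing at 0 lies below its chords from 0 to the two
  endpoints. Both endpoints are needed because this is applied before the sign of the solution is
  known.\<close>

lemma convex_le_abs_multiple:
  fixes \<phi> :: "real \<Rightarrow> real"
  assumes "convex_on UNIV \<phi>" "\<phi> 0 = 0" "K > 0" "\<bar>v\<bar> \<le> K"
  shows "\<phi> v \<le> (max (\<phi> K) (\<phi> (- K)) / K) * \<bar>v\<bar>"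
proof -
  have ineq: "\<phi> (s * c) \<le> s * \<phi> c" if "0 \<le> s" "s \<le> 1" for s c
    using convex_onD[OF assms(1), of s 0 c] that assms(2) by simp
  have s: "0 \<le> \<bar>v\<bar> / K" "\<bar>v\<bar> / K \<le> 1" using assms by auto
  have "\<phi> v = \<phi> (\<bar>v\<bar> / K * (if v \<ge> 0 then K else - K))" using assms by simp
  also have "\<dots> \<le> \<bar>v\<bar> / K * \<phi> (if v \<ge> 0 then K else - K)" by (rule ineq[OF s])
  also have "\<dots> \<le> \<bar>v\<bar> / K * max (\<phi> K) (\<phi> (- K))" using s by (intro mult_left_mono) auto
  finally show ?thesis by (simp add: mult_ac)
qed

lemma convex_le_chord_from_0:
  fixes \<phi> :: "real \<Rightarrow> real"
  assumes "convex_on UNIV \<phi>" "\<phi> 0 = 0" "0 \<le> v" "v \<le> U" "U > 0"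
  shows "\<phi> v \<le> \<phi> U / U * v"
  using convex_onD[OF assms(1), of "v / U" 0 U] assms by (simp add: mult_ac)

lemma diff2_integral_cmult: "diff2_integral \<alpha> (\<lambda>x. c * f x) x = c * diff2_integral \<alpha> f x" for f :: "'a::euclidean_space \<Rightarrow> real"
proof -
  have "diff2 (\<lambda>x. c * f x) x z = c * diff2 f x z" for z by (simp add: diff2_def algebra_simps)
  then show ?thesis by (simp add: diff2_integral_def mult.left_commute[of _ c])
qed

lemma Cb2_cmult:
  assumes "f \<in> Cb2"
  shows "(\<lambda>x. c * f x) \<in> Cb2"
proof -
  from assms obtain g H where bf: "bounded (range f)"
    and g: "\<And>x. (f has_derivative (\<lambda>z. g x \<bullet> z)) (at x)"
    and H: "\<And>x. (g has_derivative blinfun_apply (H x)) (at x)"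
    and cH: "continuous_on UNIV H" and bg: "bounded (range g)" and bH: "bounded (range H)"
    unfolding Cb2_def by blast
  have b: "bounded (range (\<lambda>x. c *\<^sub>R F x))" if "bounded (range F)" for F :: "'a \<Rightarrow> 'b::real_normed_vector"
    using bounded_scaling[OF that, of c] by (simp add: image_image)
  show ?thesis unfolding Cb2_def
  proof (intro CollectI conjI exI[of _ "\<lambda>x. c *\<^sub>R g x"] exI[of _ "\<lambda>x. c *\<^sub>R H x"] allI)
    show "((\<lambda>x. c * f x) has_derivative (\<lambda>z. (c *\<^sub>R g x) \<bullet> z)) (at x)" for x
      by (auto intro!: derivative_eq_intros g)
    show "((\<lambda>x. c *\<^sub>R g x) has_derivative blinfun_apply (c *\<^sub>R H x)) (at x)" for x
      by (auto intro!: derivative_eq_intros H simp: scaleR_blinfun.rep_eq)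
  qed (use b[OF bf] b[OF bg] b[OF bH] cH in \<open>auto intro!: continuous_intros\<close>)
qed

section \<open>Primitives of continuous functions on the half-line\<close>

lemma integral_primitive_derivative:
  fixes f :: "real \<Rightarrow> real"
  assumes "continuous_on {0..} f" "t > 0"
  shows "((\<lambda>t. integral {0..t} f) has_real_derivative f t) (at t)"
proof -
  have "((\<lambda>t. integral {0..t} f) has_real_derivative f t) (at t within {0..t + 1})"
    by (rule integral_has_real_derivative) (use assms in \<open>auto intro: continuous_on_subset\<close>)
  moreover have "at t within {0..t + 1} = at t"
    using assms by (intro at_within_interior) auto
  ultimately show ?thesis by simp
qed

lemma integral_primitive_continuous:
  fixes f :: "real \<Rightarrow> real"
  assumes "continuous_on {0..} f"
  shows "continuous_on {0..} (\<lambda>t. integral {0..t} f)"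
proof (rule continuous_on_eq_continuous_within[THEN iffD2, rule_format])
  fix t :: real assume t: "t \<in> {0..}"
  have "((\<lambda>t. integral {0..t} f) has_real_derivative f t) (at t within {0..t + 1})"
    by (rule integral_has_real_derivative) (use assms t in \<open>auto intro: continuous_on_subset\<close>)
  then have "continuous (at t within {0..t + 1}) (\<lambda>t. integral {0..t} f)"
    by (rule DERIV_continuous)
  moreover have "at t within {0..t + 1} = at t within {0..}"
    by (rule at_within_nhd[of _ "{t - 1<..<t + 1}"]) auto
  ultimately show "continuous (at t within {0..}) (\<lambda>t. integral {0..t} f)" by simp
qed

lemma integral_primitive_nonneg_mono:
  fixes f :: "real \<Rightarrow> real"
  assumes "continuous_on {0..} f" "\<And>t. t \<ge> 0 \<Longrightarrow> f t \<ge> 0" "0 \<le> s" "s \<le> t"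
  shows "0 \<le> integral {0..s} f" "integral {0..s} f \<le> integral {0..t} f"
proof -
  have i: "f integrable_on {0..r}" for r
    by (intro integrable_continuous_real continuous_on_subset[OF assms(1)]) auto
  show "0 \<le> integral {0..s} f" by (intro integral_nonneg i) (use assms in auto)
  show "integral {0..s} f \<le> integral {0..t} f"
    by (rule integral_subset_le[OF _ i i]) (use assms in auto)
qed

section \<open>The mass of a solution\<close>

text \<open>The hypothesis is the integrated form of A' \<le> b A, the form that survives the
  removal of the truncation. Instead of A, the proof differentiates its majorant A s - ?Y s + ?Y r,
  which agrees with A at r = s.\<close>

lemma gronwall_upper:
  fixes A b :: "real \<Rightarrow> real"
  assumes A: "continuous_on {0..} A" and b: "continuous_on {0..} b" and b_nonneg: "\<And>t. t \<ge> 0 \<Longrightarrow> b t \<ge> 0"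
    and le: "\<And>s t. 0 \<le> s \<Longrightarrow> s \<le> t \<Longrightarrow>
      A t - integral {0..t} (\<lambda>r. b r * A r) \<le> A s - integral {0..s} (\<lambda>r. b r * A r)"
    and st: "0 \<le> s" "s \<le> t"
  shows "A t * exp (- integral {0..t} b) \<le> A s * exp (- integral {0..s} b)"
proof -
  let ?Y = "\<lambda>t. integral {0..t} (\<lambda>r. b r * A r)" and ?B = "\<lambda>t. integral {0..t} b"
  define V where "V r = (A s - ?Y s + ?Y r) * exp (- ?B r)" for r
  have bA: "continuous_on {0..} (\<lambda>r. b r * A r)" by (intro continuous_intros A b)
  have "V t \<le> V s"
  proof (rule DERIV_nonpos_imp_decreasing_open[OF st(2)])
    fix r assume r: "s < r" "r < t"
    then have "r > 0" using st by simp
    have "(V has_real_derivative (b r * A r * exp (- ?B r) + (A s - ?Y s + ?Y r) * (- b r * exp (- ?B r)))) (at r)"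
      unfolding V_def[abs_def]
      by (rule derivative_eq_intros integral_primitive_derivative[OF b \<open>r > 0\<close>]
          integral_primitive_derivative[OF bA \<open>r > 0\<close>] refl | simp)+
    moreover have "b r * A r * exp (- ?B r) + (A s - ?Y s + ?Y r) * (- b r * exp (- ?B r))
        = (b r * exp (- ?B r)) * (A r - (A s - ?Y s + ?Y r))" by (simp add: algebra_simps)
    moreover have "A r - (A s - ?Y s + ?Y r) \<le> 0" using le[of s r] st r by simp
    then have "(b r * exp (- ?B r)) * (A r - (A s - ?Y s + ?Y r)) \<le> 0"
      using b_nonneg[of r] \<open>r > 0\<close> by (intro mult_nonneg_nonpos) auto
    ultimately show "\<exists>y. (V has_real_derivative y) (at r) \<and> y \<le> 0" by auto
  next
    show "continuous_on {s..t} V"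
      unfolding V_def
      by (intro continuous_intros continuous_on_subset[OF integral_primitive_continuous[OF bA]]
          continuous_on_subset[OF integral_primitive_continuous[OF b]]) (use st in auto)
  qed
  moreover have "A t * exp (- ?B t) \<le> V t"
    unfolding V_def using le[OF st] by (intro mult_right_mono) auto
  moreover have "V s = A s * exp (- ?B s)" by (simp add: V_def)
  ultimately show ?thesis by linarith
qed

(* Gronwall's argument run backwards in time. *)
lemma gronwall_lower:
  fixes A p :: "real \<Rightarrow> real"
  assumes A: "continuous_on {0..} A" and p: "continuous_on {0..} p" and p_nonneg: "\<And>t. t \<ge> 0 \<Longrightarrow> p t \<ge> 0"
    and le: "\<And>s t. 0 \<le> s \<Longrightarrow> s \<le> t \<Longrightarrow>
      A s + integral {0..s} (\<lambda>r. p r * A r) \<le> A t + integral {0..t} (\<lambda>r. p r * A r)"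
    and st: "0 \<le> s" "s \<le> t"
  shows "A s * exp (integral {0..s} p) \<le> A t * exp (integral {0..t} p)"
proof -
  let ?Z = "\<lambda>t. integral {0..t} (\<lambda>r. p r * A r)" and ?P = "\<lambda>t. integral {0..t} p"
  \<comment> \<open>The hypothesis bounds A r from above by A t + ?Z t - ?Z r, with the final time t
    as base point; this majorant is differentiable in r and agrees with A at r = t.\<close>
  define V where "V r = (A t + ?Z t - ?Z r) * exp (?P r)" for r
  have pA: "continuous_on {0..} (\<lambda>r. p r * A r)" by (intro continuous_intros A p)
  have "V s \<le> V t"
  proof (rule DERIV_nonneg_imp_increasing_open[OF st(2)])
    fix r assume r: "s < r" "r < t"
    then have "r > 0" using st by simp
    have "(V has_real_derivative (- (p r * A r) * exp (?P r) + (A t + ?Z t - ?Z r) * (p r * exp (?P r)))) (at r)"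
      unfolding V_def[abs_def]
      by (rule derivative_eq_intros integral_primitive_derivative[OF p \<open>r > 0\<close>]
          integral_primitive_derivative[OF pA \<open>r > 0\<close>] refl | simp)+
    moreover have "- (p r * A r) * exp (?P r) + (A t + ?Z t - ?Z r) * (p r * exp (?P r))
        = (p r * exp (?P r)) * ((A t + ?Z t - ?Z r) - A r)" by (simp add: algebra_simps)
    moreover have "(A t + ?Z t - ?Z r) - A r \<ge> 0" using le[of r t] st r by simp
    then have "(p r * exp (?P r)) * ((A t + ?Z t - ?Z r) - A r) \<ge> 0"
      using p_nonneg[of r] \<open>r > 0\<close> by (intro mult_nonneg_nonneg) auto
    ultimately show "\<exists>y. (V has_real_derivative y) (at r) \<and> y \<ge> 0" by auto
  next
    show "continuous_on {s..t} V"
      unfolding V_def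
      by (intro continuous_intros continuous_on_subset[OF integral_primitive_continuous[OF pA]]
          continuous_on_subset[OF integral_primitive_continuous[OF p]]) (use st in auto)
  qed
  moreover have "A s * exp (?P s) \<le> V s"
    unfolding V_def using le[OF st] by (intro mult_right_mono) auto
  moreover have "V t = A t * exp (?P t)" by (simp add: V_def)
  ultimately show ?thesis by linarith
qed

lemma continuous_on_section:
  assumes "continuous_on (S \<times> X) (\<lambda>(t, x). f t x)" "t \<in> S"
  shows "continuous_on X (f t)"
proof -
  have "continuous_on X (\<lambda>x. (t, x))" by (intro continuous_intros)
  then have "continuous_on X (\<lambda>x. (\<lambda>(t, x). f t x) (t, x))"
    by (rule continuous_on_compose2[OF assms(1)]) (use assms(2) in auto)
  then show ?thesis by simp
qed

lemma continuous_interval_bound: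
  fixes f :: "real \<Rightarrow> real"
  assumes "continuous_on {0..} f"
  obtains M where "\<And>t. t \<in> {0<..T} \<Longrightarrow> f t \<le> M"
proof -
  have "compact (f ` {0..T})"
    by (intro compact_continuous_image continuous_on_subset[OF assms]) auto
  then obtain M where "\<forall>y\<in>f ` {0..T}. norm y \<le> M"
    using compact_imp_bounded bounded_iff by blast
  then have "f t \<le> M" if "t \<in> {0<..T}" for t
  proof -
    have "norm (f t) \<le> M" using that \<open>\<forall>y\<in>f ` {0..T}. norm y \<le> M\<close> by auto
    then show ?thesis by simp
  qed
  then show ?thesis by (rule that)
qed

section \<open>The equation and the bounds of its solution by 0 and U\<close>

locale fractional_absorption =
  fixes \<alpha> :: real
    and \<phi> h k :: "real \<Rightarrow> real"
    and u0 :: "'a::euclidean_space \<Rightarrow> real"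
    and u :: "real \<Rightarrow> 'a \<Rightarrow> real"
  assumes \<alpha>: "0 < \<alpha>" "\<alpha> < 2"
    and convex: "convex_on UNIV \<phi>" and \<phi>_diff: "\<phi> differentiable_on UNIV"
    and \<phi>_nonneg: "\<And>x. \<phi> x \<ge> 0" and \<phi>_0: "\<phi> 0 = 0"
    and h_cont: "continuous_on {0..} h" and h_nonneg: "\<And>t. t \<ge> 0 \<Longrightarrow> h t \<ge> 0"
    and k_cont: "continuous_on {0..} k" and k_nonneg: "\<And>t. t \<ge> 0 \<Longrightarrow> k t \<ge> 0"
    and u0_Cb: "u0 \<in> Cb" and u0_int: "integrable lborel u0"
    and u0_nonneg: "\<And>x. u0 x \<ge> 0" and u0_pos: "L1_norm u0 > 0"
    and solution: "classical_solution \<alpha> k h \<phi> u0 u"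
begin

definition \<kappa> :: "real \<Rightarrow> real" where
  "\<kappa> t = k t * (frac_laplacian_const TYPE('a) \<alpha> / 2)"

definition rhs :: "real \<Rightarrow> 'a \<Rightarrow> real" where
  "rhs t x = \<kappa> t * diff2_integral \<alpha> (u t) x - h t * \<phi> (u t x)"

abbreviation "U \<equiv> unif_norm u0"

lemma \<kappa>_nonneg: "t \<ge> 0 \<Longrightarrow> \<kappa> t \<ge> 0"
  using frac_laplacian_const_pos[OF \<alpha>, where 'a='a] k_nonneg by (simp add: \<kappa>_def)

lemma \<kappa>_cont: "continuous_on {0..} \<kappa>"
  unfolding \<kappa>_def[abs_def] by (intro continuous_intros k_cont)

lemma u_cont: "continuous_on ({0..} \<times> UNIV) (\<lambda>(t, x). u t x)"
  and u_init: "u 0 x = u0 x"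
  and u_Cb2: "t > 0 \<Longrightarrow> u t \<in> Cb2"
  using solution unfolding classical_solution_def by auto

lemma u_bounded: obtains K where "K > 0" "\<And>t x. t \<ge> 0 \<Longrightarrow> \<bar>u t x\<bar> \<le> K"
proof -
  have "bounded ((\<lambda>(t, x). u t x) ` ({0..} \<times> UNIV))"
    using solution unfolding classical_solution_def by blast
  then obtain K where "K > 0" "\<forall>y\<in>(\<lambda>(t, x). u t x) ` ({0..} \<times> UNIV). norm y \<le> K"
    unfolding bounded_pos by blast
  then show ?thesis by (intro that[of K]) auto
qed

text \<open>Joint continuity of \<open>rhs\<close> is not visible from its formula, because nothing
  is known about how \<open>diff2_integral\<close> varies with t. It is inherited from the time
  derivative provided by \<open>classical_solution\<close>, with which \<open>rhs\<close> agrees for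
  t > 0.\<close>

lemma rhs_props:
  shows rhs_cont: "continuous_on ({0<..} \<times> UNIV) (\<lambda>(t, x). rhs t x)"
    and u_deriv: "t > 0 \<Longrightarrow> ((\<lambda>s. u s x) has_real_derivative rhs t x) (at t)"
proof -
  obtain ut where ut: "continuous_on ({0<..} \<times> UNIV) (\<lambda>(t, x). ut t x)"
    "\<And>t x. t > 0 \<Longrightarrow> ((\<lambda>s. u s x) has_real_derivative ut t x) (at t)"
    "\<And>t x. t > 0 \<Longrightarrow> ut t x = k t * frac_laplacian \<alpha> (u t) x - h t * \<phi> (u t x)"
    using solution unfolding classical_solution_def by blast
  have eq: "ut t x = rhs t x" if "t > 0" for t x
    using ut(3)[OF that] frac_laplacian_Cb2[OF \<alpha> u_Cb2[OF that]] by (simp add: rhs_def \<kappa>_def)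
  show "continuous_on ({0<..} \<times> UNIV) (\<lambda>(t, x). rhs t x)"
    using ut(1) by (rule continuous_on_cong[THEN iffD1, rotated -1]) (auto simp: eq)
  show "t > 0 \<Longrightarrow> ((\<lambda>s. u s x) has_real_derivative rhs t x) (at t)"
    using ut(2) eq by metis
qed

text \<open>The absorption term is nonpositive whatever the sign of u, so u is a subsolution of the
  pure diffusion equation.\<close>

lemma u_le_U: assumes "t \<ge> 0" shows "u t x \<le> U"
proof -
  obtain K where K: "\<And>t x. t \<ge> 0 \<Longrightarrow> \<bar>u t x\<bar> \<le> K" by (rule u_bounded) (rule that)
  obtain \<kappa>max where \<kappa>max: "\<And>r. r \<in> {0<..t} \<Longrightarrow> \<kappa> r \<le> \<kappa>max"
    by (rule continuous_interval_bound[OF \<kappa>_cont]) (rule that)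
  show ?thesis
  proof (rule nonlocal_maximum_principle[where T=t and w=u and wt=rhs and \<kappa>=\<kappa> and \<kappa>max=\<kappa>max and K=K, OF \<alpha>])
    show "continuous_on ({0..t} \<times> UNIV) (\<lambda>(t, x). u t x)"
      by (rule continuous_on_subset[OF u_cont]) auto
    show "u 0 x \<le> U" for x
    proof -
      have "bdd_above (range (\<lambda>x. \<bar>u0 x\<bar>))"
        using u0_Cb by (auto simp: Cb_def bounded_iff bdd_above_def)
      then have "\<bar>u0 x\<bar> \<le> U" unfolding unif_norm_def by (intro cSUP_upper) auto
      then show ?thesis by (simp add: u_init)
    qed
    show "rhs r x \<le> \<kappa> r * diff2_integral \<alpha> (u r) x" if "r \<in> {0<..t}" for r x
      using that h_nonneg[of r] \<phi>_nonneg[of "u r x"] by (simp add: rhs_def)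
  qed (use K \<kappa>max assms in \<open>auto intro: u_Cb2 u_deriv \<kappa>_nonneg\<close>)
qed

text \<open>Where u is negative, absorption still pushes it down, but only at a rate at most L h
  |u|, since \<phi>(u) \<le> L |u| there. The decaying factor e = exp (- L times the integral of h)
  absorbs this rate, so w = - e u satisfies the diffusion inequality wherever w > 0, which is all
  the maximum principle asks.\<close>

lemma u_nonneg: assumes "t \<ge> 0" shows "u t x \<ge> 0"
proof -
  obtain K where K: "K > 0" "\<And>t x. t \<ge> 0 \<Longrightarrow> \<bar>u t x\<bar> \<le> K" by (rule u_bounded) (rule that)
  obtain \<kappa>max where \<kappa>max: "\<And>r. r \<in> {0<..t} \<Longrightarrow> \<kappa> r \<le> \<kappa>max"
    by (rule continuous_interval_bound[OF \<kappa>_cont]) (rule that)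
  define L where "L = max (\<phi> K) (\<phi> (- K)) / K"
  have L: "L \<ge> 0" using K \<phi>_nonneg[of K] by (simp add: L_def max_def)
  define e where "e r = exp (- L * integral {0..r} h)" for r
  define w where "w r x = - e r * u r x" for r x
  define wt where "wt r x = L * h r * e r * u r x - e r * rhs r x" for r x
  have e: "0 < e r" "r \<ge> 0 \<Longrightarrow> e r \<le> 1" for r
    using L integral_primitive_nonneg_mono(1)[OF h_cont h_nonneg, of r r] by (auto simp: e_def)
  have e_cont: "continuous_on {0..} e"
    unfolding e_def[abs_def] by (intro continuous_intros integral_primitive_continuous h_cont)
  have "w t x \<le> 0"
  proof (rule nonlocal_maximum_principle[where T=t and w=w and wt=wt and \<kappa>=\<kappa> and \<kappa>max=\<kappa>max and K=K, OF \<alpha>])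
    have "continuous_on ({0..t} \<times> UNIV) (\<lambda>p::real \<times> 'a. e (fst p))"
      by (rule continuous_on_compose2[OF e_cont]) (auto intro!: continuous_intros)
    moreover have "continuous_on ({0..t} \<times> UNIV) (\<lambda>(t, x). u t x)"
      by (rule continuous_on_subset[OF u_cont]) auto
    ultimately show "continuous_on ({0..t} \<times> UNIV) (\<lambda>(t, x). w t x)"
      unfolding w_def case_prod_beta by (intro continuous_intros)
    show "\<bar>w r x\<bar> \<le> K" if "r \<in> {0..t}" for r x
    proof -
      have "\<bar>w r x\<bar> \<le> 1 * K"
        unfolding w_def abs_mult using that e[of r] K by (intro mult_mono) auto
      then show ?thesis by simp
    qed
    show "w r \<in> Cb2" if "r \<in> {0<..t}" for r
      unfolding w_def using that by (intro Cb2_cmult u_Cb2) auto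
    show "((\<lambda>s. w s x) has_real_derivative wt r x) (at r)" if "r \<in> {0<..t}" for r x
    proof -
      have "(e has_real_derivative exp (- L * integral {0..r} h) * (- L * h r)) (at r)"
        unfolding e_def[abs_def]
        by (intro DERIV_chain2[OF DERIV_exp] DERIV_cmult integral_primitive_derivative h_cont) (use that in auto)
      then have "((\<lambda>s. e s * u s x) has_real_derivative
          exp (- L * integral {0..r} h) * (- L * h r) * u r x + rhs r x * e r) (at r)"
        using that by (intro DERIV_mult u_deriv) auto
      from DERIV_minus[OF this] show ?thesis
        unfolding w_def mult_minus_left by (rule DERIV_cong) (simp add: wt_def e_def algebra_simps)
    qed
    show "wt r x \<le> \<kappa> r * diff2_integral \<alpha> (w r) x" if r: "r \<in> {0<..t}" and w: "w r x > 0" for r x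
    proof -
      have neg: "u r x < 0" using w e(1)[of r] by (simp add: w_def mult_less_0_iff)
      have "\<phi> (u r x) \<le> L * \<bar>u r x\<bar>"
        unfolding L_def using r by (intro convex_le_abs_multiple convex \<phi>_0 K) auto
      then have "\<phi> (u r x) + L * u r x \<le> 0" using neg by simp
      then have "e r * h r * (\<phi> (u r x) + L * u r x) \<le> 0"
        using e(1)[of r] h_nonneg[of r] r by (intro mult_nonneg_nonpos) auto
      moreover have "diff2_integral \<alpha> (w r) x = - e r * diff2_integral \<alpha> (u r) x"
        unfolding w_def by (rule diff2_integral_cmult)
      ultimately show ?thesis by (simp add: wt_def rhs_def algebra_simps)
    qed
    show "w 0 x \<le> 0" for x
      using u0_nonneg[of x] e(1)[of 0] by (simp add: w_def u_init)
  qed (use \<kappa>max assms in \<open>auto intro: \<kappa>_nonneg\<close>)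
  then show ?thesis using e(1)[of t] by (simp add: w_def zero_le_mult_iff)
qed

lemma u0_integral: "L1_norm u0 = (LINT x|lborel. u 0 x)"
  unfolding L1_norm_def u_init using u0_nonneg by simp

lemma U_pos: "U > 0"
proof (rule ccontr)
  assume "\<not> U > 0"
  then have "u0 x = 0" for x using u_le_U[of 0 x] u0_nonneg[of x] by (simp add: u_init)
  then show False using u0_pos by (simp add: L1_norm_def)
qed

lemma \<phi>_le: "t \<ge> 0 \<Longrightarrow> \<phi> (u t x) \<le> \<phi> U / U * u t x"
  by (intro convex_le_chord_from_0 convex \<phi>_0 u_nonneg u_le_U U_pos)

lemma u_cont_x: "t \<ge> 0 \<Longrightarrow> continuous_on UNIV (u t)"
  by (rule continuous_on_section[OF u_cont]) simp

lemma u_measurable: "t \<ge> 0 \<Longrightarrow> u t \<in> borel_measurable borel"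
  by (intro borel_measurable_continuous_onI u_cont_x)

section \<open>The weighted mass and its evolution\<close>

definition F :: "real \<Rightarrow> real \<Rightarrow> real \<Rightarrow> real" where
  "F \<epsilon> R t = (LINT x|lborel. u t x * scaled_weight \<alpha> \<epsilon> R x)"

lemma u_weight_integrable:
  assumes "t \<ge> 0" "\<epsilon> \<ge> 0" "R > 0"
  shows "integrable lborel (\<lambda>x. u t x * scaled_weight \<alpha> \<epsilon> R x)"
proof (rule Bochner_Integration.integrable_bound)
  show "integrable lborel (\<lambda>x::'a. U * scaled_weight \<alpha> \<epsilon> R x)"
    by (intro integrable_mult_right integrable_scaled_weight \<alpha> assms)
  show "AE x in lborel. norm (u t x * scaled_weight \<alpha> \<epsilon> R x) \<le> norm (U * scaled_weight \<alpha> \<epsilon> R x)"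
    using u_nonneg[OF assms(1)] u_le_U[OF assms(1)] U_pos
    by (intro AE_I2) (auto simp: abs_mult intro!: mult_right_mono)
  show "(\<lambda>x. u t x * scaled_weight \<alpha> \<epsilon> R x) \<in> borel_measurable lborel"
    using u_measurable[OF assms(1)] by simp
qed

lemma F_nonneg: "t \<ge> 0 \<Longrightarrow> F \<epsilon> R t \<ge> 0"
  unfolding F_def by (intro Bochner_Integration.integral_nonneg mult_nonneg_nonneg u_nonneg) auto

lemma F_cont:
  assumes "\<epsilon> \<ge> 0" "R > 0"
  shows "continuous_on {0..} (F \<epsilon> R)"
  unfolding continuous_on_sequentially
proof (intro allI ballI impI, elim conjE)
  fix \<tau> :: "nat \<Rightarrow> real" and t assume t: "t \<in> {0..}" and \<tau>: "\<forall>n. \<tau> n \<in> {0..}" "\<tau> \<longlonglongrightarrow> t"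
  have meas: "(\<lambda>x. u s x * scaled_weight \<alpha> \<epsilon> R x) \<in> borel_measurable lborel" if "s \<ge> 0" for s
    using u_measurable[OF that] by simp
  have "(\<lambda>n. LINT x|lborel. u (\<tau> n) x * scaled_weight \<alpha> \<epsilon> R x)
      \<longlonglongrightarrow> (LINT x|lborel. u t x * scaled_weight \<alpha> \<epsilon> R x)"
  proof (rule integral_dominated_convergence[where w="\<lambda>x. U * scaled_weight \<alpha> \<epsilon> R x"])
    show "integrable lborel (\<lambda>x::'a. U * scaled_weight \<alpha> \<epsilon> R x)"
      by (intro integrable_mult_right integrable_scaled_weight \<alpha> assms)
    show "AE x in lborel. (\<lambda>n. u (\<tau> n) x * scaled_weight \<alpha> \<epsilon> R x) \<longlonglongrightarrow> u t x * scaled_weight \<alpha> \<epsilon> R x"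
    proof (rule AE_I2)
      fix x
      have "(\<lambda>n. (\<lambda>(t, x). u t x) (\<tau> n, x)) \<longlonglongrightarrow> (\<lambda>(t, x). u t x) (t, x)"
        by (rule continuous_on_tendsto_compose[OF u_cont]) (use t \<tau> in \<open>auto intro!: tendsto_intros\<close>)
      then show "(\<lambda>n. u (\<tau> n) x * scaled_weight \<alpha> \<epsilon> R x) \<longlonglongrightarrow> u t x * scaled_weight \<alpha> \<epsilon> R x"
        by (intro tendsto_intros) simp
    qed
    show "AE x in lborel. norm (u (\<tau> n) x * scaled_weight \<alpha> \<epsilon> R x) \<le> U * scaled_weight \<alpha> \<epsilon> R x" for n
      using u_nonneg u_le_U \<tau>(1) by (intro AE_I2) (auto simp: abs_mult intro!: mult_right_mono)
  qed (use meas t \<tau> in auto)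
  then show "(F \<epsilon> R \<circ> \<tau>) \<longlonglongrightarrow> F \<epsilon> R t" by (simp add: F_def o_def)
qed

lemma F_tendsto:
  assumes "t \<ge> 0" "R > 0"
  shows "(\<lambda>n. F (inverse (real (Suc n))) R t) \<longlonglongrightarrow> F 0 R t"
  unfolding F_def
proof (rule integral_dominated_convergence[where w="\<lambda>x. U * scaled_weight \<alpha> 0 R x"])
  show "integrable lborel (\<lambda>x::'a. U * scaled_weight \<alpha> 0 R x)"
    by (intro integrable_mult_right integrable_scaled_weight \<alpha> assms) simp
  show "AE x in lborel. (\<lambda>n. u t x * scaled_weight \<alpha> (inverse (real (Suc n))) R x) \<longlonglongrightarrow> u t x * scaled_weight \<alpha> 0 R x"
  proof (rule AE_I2)
    fix x
    show "(\<lambda>n. u t x * scaled_weight \<alpha> (inverse (real (Suc n))) R x) \<longlonglongrightarrow> u t x * scaled_weight \<alpha> 0 R x"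
      unfolding scaled_weight_def truncated_weight_def by (intro tendsto_intros LIMSEQ_inverse_real_of_nat)
  qed
  show "AE x in lborel. norm (u t x * scaled_weight \<alpha> (inverse (real (Suc n))) R x) \<le> U * scaled_weight \<alpha> 0 R x" for n
  proof (rule AE_I2)
    fix x
    have "u t x * scaled_weight \<alpha> (inverse (real (Suc n))) R x \<le> U * scaled_weight \<alpha> 0 R x"
      unfolding scaled_weight_def
      using u_nonneg u_le_U assms U_pos by (intro mult_mono truncated_weight_antimono) auto
    then show "norm (u t x * scaled_weight \<alpha> (inverse (real (Suc n))) R x) \<le> U * scaled_weight \<alpha> 0 R x"
      using u_nonneg[OF assms(1), of x] by (simp add: abs_mult)
  qed
qed (use u_measurable[OF assms(1)] in auto)

text \<open>For \<epsilon> > 0 the weight has compact support, so the Leibniz rule on a box needs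
  only joint continuity of \<open>rhs\<close>, without a dominating function on the whole
  space.\<close>

lemma F_deriv:
  assumes "\<epsilon> > 0" "R > 0" "t > 0"
  shows "(F \<epsilon> R has_real_derivative (LINT x|lborel. rhs t x * scaled_weight \<alpha> \<epsilon> R x)) (at t)"
proof -
  let ?g = "scaled_weight \<alpha> \<epsilon> R :: 'a \<Rightarrow> real"
  obtain r where r: "\<And>x::'a. norm x > r \<Longrightarrow> truncated_weight \<alpha> \<epsilon> x = 0"
    by (rule truncated_weight_compact_support[OF \<alpha>(1) assms(1)]) (rule that)
  obtain a b :: 'a where ab: "cball 0 (r * R) \<subseteq> cbox a b"
    using bounded_subset_cbox_symmetric[OF bounded_cball] by blast
  have g0: "?g x = 0" if "x \<notin> cbox a b" for x
  proof -
    have "x \<notin> cball 0 (r * R)" using that ab by blast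
    then have "norm x > r * R" by simp
    then show ?thesis using assms(2) unfolding scaled_weight_def by (intro r) (simp add: field_simps)
  qed
  have LINT_eq: "(LINT x|lborel. f x * ?g x) = integral (cbox a b) (\<lambda>x. f x * ?g x)"
    if "continuous_on UNIV f" for f
  proof -
    have "continuous_on (cbox a b) (\<lambda>x. f x * ?g x)"
      by (intro continuous_intros continuous_on_subset[OF that]) auto
    then have "set_integrable lborel (cbox a b) (\<lambda>x. f x * ?g x)"
      unfolding set_integrable_def by (intro borel_integrable_compact compact_cbox)
    then have "(LINT x:cbox a b|lborel. f x * ?g x) = integral (cbox a b) (\<lambda>x. f x * ?g x)"
      by (rule set_borel_integral_eq_integral)
    moreover have "(LINT x:cbox a b|lborel. f x * ?g x) = (LINT x|lborel. f x * ?g x)"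
      unfolding set_lebesgue_integral_def
      by (intro Bochner_Integration.integral_cong refl) (auto simp: indicator_def g0)
    ultimately show ?thesis by simp
  qed
  have rhs_cont_x: "continuous_on UNIV (rhs s)" if "s > 0" for s
    by (rule continuous_on_section[OF rhs_cont]) (use that in simp)
  \<comment> \<open>The interval stays away from 0, because \<open>rhs\<close> is known to be
    continuous only at positive times.\<close>
  let ?I = "{t / 2..t + 1}"
  have "((\<lambda>s. integral (cbox a b) (\<lambda>x. u s x * ?g x)) has_field_derivative
      integral (cbox a b) (\<lambda>x. rhs t x * ?g x)) (at t within ?I)"
  proof (rule leibniz_rule_field_derivative)
    fix s x assume s: "s \<in> ?I"
    then have "s > 0" using assms(3) by simp
    then show "((\<lambda>s. u s x * ?g x) has_field_derivative rhs s x * ?g x) (at s within ?I)"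
      by (intro DERIV_cmult_right has_field_derivative_at_within[OF u_deriv])
  next
    fix s assume s: "s \<in> ?I"
    then have "s \<ge> 0" using assms(3) by simp
    then show "(\<lambda>x. u s x * ?g x) integrable_on cbox a b"
      by (intro integrable_continuous continuous_intros continuous_on_subset[OF u_cont_x]) auto
  next
    have "continuous_on (?I \<times> cbox a b) (\<lambda>(t, x). rhs t x)"
      by (rule continuous_on_subset[OF rhs_cont]) (use assms(3) in auto)
    then show "continuous_on (?I \<times> cbox a b) (\<lambda>(s, x). rhs s x * ?g x)"
      unfolding case_prod_beta by (intro continuous_intros)
  qed (use assms(3) in auto)
  moreover have "at t within ?I = at t"
    using assms(3) by (intro at_within_interior) auto
  ultimately have "((\<lambda>s. integral (cbox a b) (\<lambda>x. u s x * ?g x)) has_real_derivative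
      (LINT x|lborel. rhs t x * ?g x)) (at t)"
    using LINT_eq[OF rhs_cont_x[OF assms(3)]] by simp
  then show ?thesis
    by (rule has_field_derivative_transform_within_open[where S="{0<..}"])
       (use assms(3) LINT_eq[OF u_cont_x] in \<open>auto simp: F_def\<close>)
qed

text \<open>The derivative belongs to the truncated weight while the bounds contain the full
  weighted mass \<open>F 0 R\<close>: second differences of a truncated weight spread beyond its
  support. The factor \<phi> U / U is the slope of the chord that dominates \<phi> on
  [0, U].\<close>

lemma F_deriv_bounds:
  obtains C where "C \<ge> 0"
    "\<And>\<epsilon> R t. \<epsilon> > 0 \<Longrightarrow> R > 0 \<Longrightarrow> t > 0 \<Longrightarrow>
      (LINT x|lborel. rhs t x * scaled_weight \<alpha> \<epsilon> R x) \<le> \<kappa> t * (C * R powr - \<alpha>) * F 0 R t"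
    "\<And>\<epsilon> R t. \<epsilon> > 0 \<Longrightarrow> R > 0 \<Longrightarrow> t > 0 \<Longrightarrow>
      - ((\<kappa> t * (C * R powr - \<alpha>) + \<phi> U / U * h t) * F 0 R t)
        \<le> (LINT x|lborel. rhs t x * scaled_weight \<alpha> \<epsilon> R x)"
proof -
  obtain C where C: "C \<ge> 0"
    and int: "\<And>\<epsilon> R x. \<epsilon> \<ge> 0 \<Longrightarrow> R > 0 \<Longrightarrow>
      integrable lborel (\<lambda>z. jump_kernel \<alpha> z * diff2 (scaled_weight \<alpha> \<epsilon> R) (x::'a) z)"
    and bound: "\<And>\<epsilon> R x. \<epsilon> \<ge> 0 \<Longrightarrow> R > 0 \<Longrightarrow>
      (LINT z|lborel. \<bar>jump_kernel \<alpha> z * diff2 (scaled_weight \<alpha> \<epsilon> R) (x::'a) z\<bar>)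
        \<le> C * R powr - \<alpha> * tail_weight \<alpha> (x /\<^sub>R R)"
    by (rule integral_diff2_scaled_weight[OF \<alpha>, where 'a='a]) (rule that)
  have *: "(LINT x|lborel. rhs t x * scaled_weight \<alpha> \<epsilon> R x) \<le> \<kappa> t * (C * R powr - \<alpha>) * F 0 R t \<and>
      - ((\<kappa> t * (C * R powr - \<alpha>) + \<phi> U / U * h t) * F 0 R t)
        \<le> (LINT x|lborel. rhs t x * scaled_weight \<alpha> \<epsilon> R x)"
    if \<epsilon>: "\<epsilon> > 0" and R: "R > 0" and t: "t > 0" for \<epsilon> R t
  proof -
    let ?g = "scaled_weight \<alpha> \<epsilon> R :: 'a \<Rightarrow> real" and ?c = "C * R powr - \<alpha>" and ?l = "\<phi> U / U"
    have t0: "t \<ge> 0" using t by simp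
    \<comment> \<open>This constant may vary with t without control. It only justifies Fubini at the
      fixed time t and does not enter the estimates.\<close>
    obtain C' where C': "\<And>x z. \<bar>diff2 (u t) x z\<bar> \<le> C' * min 1 ((norm z)\<^sup>2)"
      by (rule Cb2_diff2_bound[OF u_Cb2[OF t]]) (rule that)
    have sym: "(LINT x|lborel. diff2_integral \<alpha> (u t) x * ?g x) = (LINT x|lborel. u t x * diff2_integral \<alpha> ?g x)"
    proof (rule diff2_integral_symmetric[OF \<alpha> u_measurable[OF t0] _ C',
          where B=U and G="\<lambda>x. ?c * tail_weight \<alpha> (x /\<^sub>R R)"])
      show "\<bar>u t x\<bar> \<le> U" for x using u_nonneg[OF t0, of x] u_le_U[OF t0, of x] by simp
    qed (use \<alpha> \<epsilon> R in \<open>auto intro!: int bound integrable_scaled_weight integrable_mult_right integrable_tail_weight_scaled\<close>)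
    have F0: "integrable lborel (\<lambda>x. u t x * tail_weight \<alpha> (x /\<^sub>R R))"
      "F 0 R t = (LINT x|lborel. u t x * tail_weight \<alpha> (x /\<^sub>R R))"
      using u_weight_integrable[OF t0, of 0 R] R by (simp_all add: F_def scaled_weight_0)
    have diffusion: "\<bar>LINT x|lborel. diff2_integral \<alpha> (u t) x * ?g x\<bar> \<le> ?c * F 0 R t"
    proof -
      have "\<bar>LINT x|lborel. u t x * diff2_integral \<alpha> ?g x\<bar> \<le> (LINT x|lborel. \<bar>u t x * diff2_integral \<alpha> ?g x\<bar>)"
        by (rule integral_abs_bound)
      also have "\<dots> \<le> (LINT x|lborel. ?c * (u t x * tail_weight \<alpha> (x /\<^sub>R R)))"
      proof (rule integral_mono')
        show "integrable lborel (\<lambda>x. ?c * (u t x * tail_weight \<alpha> (x /\<^sub>R R)))"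
          by (intro integrable_mult_right F0)
        fix x
        have "\<bar>diff2_integral \<alpha> ?g x\<bar> \<le> (LINT z|lborel. \<bar>jump_kernel \<alpha> z * diff2 ?g x z\<bar>)"
          unfolding diff2_integral_def real_scaleR_def by (rule integral_abs_bound)
        also have "\<dots> \<le> ?c * tail_weight \<alpha> (x /\<^sub>R R)" using \<epsilon> R by (intro bound) auto
        finally have "u t x * \<bar>diff2_integral \<alpha> ?g x\<bar> \<le> u t x * (?c * tail_weight \<alpha> (x /\<^sub>R R))"
          by (intro mult_left_mono u_nonneg t0)
        then show "\<bar>u t x * diff2_integral \<alpha> ?g x\<bar> \<le> ?c * (u t x * tail_weight \<alpha> (x /\<^sub>R R))"
          using u_nonneg[OF t0, of x] by (simp add: abs_mult mult_ac)
        show "0 \<le> ?c * (u t x * tail_weight \<alpha> (x /\<^sub>R R))"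
          using C u_nonneg[OF t0, of x] by simp
      qed
      finally show ?thesis by (simp add: sym F0)
    qed
    have \<phi>_meas: "\<phi> \<in> borel_measurable borel"
      by (intro borel_measurable_continuous_onI differentiable_imp_continuous_on \<phi>_diff)
    have absorption_int: "integrable lborel (\<lambda>x. \<phi> (u t x) * ?g x)"
    proof (rule Bochner_Integration.integrable_bound)
      show "integrable lborel (\<lambda>x. ?l * (u t x * ?g x))"
        using t0 \<epsilon> R by (intro integrable_mult_right u_weight_integrable) auto
      show "(\<lambda>x. \<phi> (u t x) * ?g x) \<in> borel_measurable lborel"
        using measurable_compose[OF u_measurable[OF t0] \<phi>_meas] by simp
      show "AE x in lborel. norm (\<phi> (u t x) * ?g x) \<le> norm (?l * (u t x * ?g x))"
      proof (rule AE_I2)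
        fix x
        have "\<phi> (u t x) * ?g x \<le> ?l * u t x * ?g x"
          by (intro mult_right_mono \<phi>_le[OF t0]) simp
        then show "norm (\<phi> (u t x) * ?g x) \<le> norm (?l * (u t x * ?g x))"
          using \<phi>_nonneg[of "u t x"] \<phi>_nonneg[of U] u_nonneg[OF t0, of x] U_pos by (simp add: abs_mult)
      qed
    qed
    have absorption_nonneg: "0 \<le> (LINT x|lborel. \<phi> (u t x) * ?g x)"
      by (intro Bochner_Integration.integral_nonneg mult_nonneg_nonneg \<phi>_nonneg) simp
    have "(LINT x|lborel. \<phi> (u t x) * ?g x) \<le> (LINT x|lborel. ?l * (u t x * tail_weight \<alpha> (x /\<^sub>R R)))"
    proof (rule integral_mono')
      show "integrable lborel (\<lambda>x. ?l * (u t x * tail_weight \<alpha> (x /\<^sub>R R)))"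
        by (intro integrable_mult_right F0)
      fix x
      show nonneg: "0 \<le> ?l * (u t x * tail_weight \<alpha> (x /\<^sub>R R))"
        using U_pos \<phi>_nonneg[of U] u_nonneg[OF t0, of x] by simp
      have "\<phi> (u t x) * ?g x \<le> (?l * u t x) * tail_weight \<alpha> (x /\<^sub>R R)"
        using \<epsilon> \<phi>_le[OF t0, of x] \<phi>_nonneg[of "u t x"] U_pos \<phi>_nonneg[of U] u_nonneg[OF t0, of x]
        by (intro mult_mono scaled_weight_le) auto
      then show "\<phi> (u t x) * ?g x \<le> ?l * (u t x * tail_weight \<alpha> (x /\<^sub>R R))" by (simp only: mult.assoc)
    qed
    then have absorption_le: "(LINT x|lborel. \<phi> (u t x) * ?g x) \<le> ?l * F 0 R t" by (simp add: F0)
    have rhs_int: "integrable lborel (\<lambda>x. rhs t x * ?g x) \<Longrightarrow> (LINT x|lborel. rhs t x * ?g x)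
        = \<kappa> t * (LINT x|lborel. diff2_integral \<alpha> (u t) x * ?g x) - h t * (LINT x|lborel. \<phi> (u t x) * ?g x)"
    proof -
      assume i: "integrable lborel (\<lambda>x. rhs t x * ?g x)"
      have "(LINT x|lborel. rhs t x * ?g x) + h t * (LINT x|lborel. \<phi> (u t x) * ?g x)
          = (LINT x|lborel. rhs t x * ?g x + h t * (\<phi> (u t x) * ?g x))"
        using i absorption_int by simp
      also have "\<dots> = (LINT x|lborel. \<kappa> t * (diff2_integral \<alpha> (u t) x * ?g x))"
        by (intro Bochner_Integration.integral_cong refl) (simp add: rhs_def algebra_simps)
      finally show ?thesis by simp
    qed
    have "\<kappa> t * \<bar>LINT x|lborel. diff2_integral \<alpha> (u t) x * ?g x\<bar> \<le> \<kappa> t * (?c * F 0 R t)"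
      by (intro mult_left_mono diffusion \<kappa>_nonneg t0)
    then have 1: "\<bar>\<kappa> t * (LINT x|lborel. diff2_integral \<alpha> (u t) x * ?g x)\<bar> \<le> \<kappa> t * ?c * F 0 R t"
      using \<kappa>_nonneg[OF t0] by (simp add: abs_mult mult.assoc)
    have 2: "0 \<le> h t * (LINT x|lborel. \<phi> (u t x) * ?g x)"
      using absorption_nonneg h_nonneg[OF t0] by simp
    have 3: "h t * (LINT x|lborel. \<phi> (u t x) * ?g x) \<le> h t * (?l * F 0 R t)"
      by (intro mult_left_mono absorption_le h_nonneg t0)
    have F0_nonneg: "F 0 R t \<ge> 0" by (rule F_nonneg[OF t0])
    have 4: "0 \<le> \<kappa> t * ?c * F 0 R t" "0 \<le> ?l * h t * F 0 R t"
      using C \<kappa>_nonneg[OF t0] F0_nonneg U_pos \<phi>_nonneg[of U] h_nonneg[OF t0] by simp_all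
    have 5: "- ((\<kappa> t * ?c + ?l * h t) * F 0 R t) = - (\<kappa> t * ?c * F 0 R t) - h t * (?l * F 0 R t)"
      by (simp add: algebra_simps)
    show ?thesis
    proof (cases "integrable lborel (\<lambda>x. rhs t x * ?g x)")
      case True
      show ?thesis
        unfolding rhs_int[OF True] 5 using 1 2 3 by linarith
    next
      \<comment> \<open>The integral is then 0 by convention, and 0 lies between the two bounds
        because of their signs.\<close>
      case False
      then have "(LINT x|lborel. rhs t x * ?g x) = 0" by (rule not_integrable_integral_eq)
      then show ?thesis
        unfolding distrib_right using 4 by linarith
    qed
  qed
  show ?thesis by (rule that[OF C]) (use * in blast)+
qed

text \<open>Differentiation is available for \<epsilon> > 0 only, while the bounds involve
  \<epsilon> = 0. Adding or subtracting the primitive of the bound makes the truncated mass monotone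
  in time; monotonicity passes to the limit \<epsilon> = 1 / (n + 1) -> 0, and this is exactly the
  input of the Gronwall lemmas.\<close>

lemma F_growth:
  obtains C where "C \<ge> 0"
    "\<And>R s t. R > 0 \<Longrightarrow> 0 \<le> s \<Longrightarrow> s \<le> t \<Longrightarrow>
      F 0 R t * exp (- (C * R powr - \<alpha> * integral {0..t} \<kappa>)) \<le> F 0 R s * exp (- (C * R powr - \<alpha> * integral {0..s} \<kappa>))"
    "\<And>R t. R > 0 \<Longrightarrow> 0 \<le> t \<Longrightarrow>
      F 0 R 0 \<le> F 0 R t * exp (C * R powr - \<alpha> * integral {0..t} \<kappa> + \<phi> U / U * integral {0..t} h)"
proof -
  obtain C where C: "C \<ge> 0"
    and up: "\<And>\<epsilon> R t. \<epsilon> > 0 \<Longrightarrow> R > 0 \<Longrightarrow> t > 0 \<Longrightarrow>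
      (LINT x|lborel. rhs t x * scaled_weight \<alpha> \<epsilon> R x) \<le> \<kappa> t * (C * R powr - \<alpha>) * F 0 R t"
    and lo: "\<And>\<epsilon> R t. \<epsilon> > 0 \<Longrightarrow> R > 0 \<Longrightarrow> t > 0 \<Longrightarrow>
      - ((\<kappa> t * (C * R powr - \<alpha>) + \<phi> U / U * h t) * F 0 R t)
        \<le> (LINT x|lborel. rhs t x * scaled_weight \<alpha> \<epsilon> R x)"
    by (rule F_deriv_bounds) (rule that)
  have integrable_0t: "f integrable_on {0..t}" if "continuous_on {0..} f" for f :: "real \<Rightarrow> real" and t
    by (intro integrable_continuous_real continuous_on_subset[OF that]) auto
  show ?thesis
  proof (rule that[OF C])
    fix R s t :: real assume R: "R > 0" and st: "0 \<le> s" "s \<le> t"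
    define b where "b r = \<kappa> r * (C * R powr - \<alpha>)" for r
    have b_cont: "continuous_on {0..} b" unfolding b_def by (intro continuous_intros \<kappa>_cont)
    have b_nonneg: "b r \<ge> 0" if "r \<ge> 0" for r using \<kappa>_nonneg[OF that] C by (simp add: b_def)
    have F0_cont: "continuous_on {0..} (F 0 R)" by (rule F_cont[OF order_refl R])
    have bF: "continuous_on {0..} (\<lambda>r. b r * F 0 R r)" by (intro continuous_intros b_cont F0_cont)
    let ?Y = "\<lambda>t. integral {0..t} (\<lambda>r. b r * F 0 R r)"
    have le: "F 0 R t - ?Y t \<le> F 0 R s - ?Y s" if "0 \<le> s" "s \<le> t" for s t
    proof (rule LIMSEQ_le)
      have "F (inverse (real (Suc n))) R t - ?Y t \<le> F (inverse (real (Suc n))) R s - ?Y s" for n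
      proof (rule DERIV_nonpos_imp_decreasing_open[OF that(2)])
        fix r assume "s < r" "r < t"
        then have r: "r > 0" using that by simp
        have "((\<lambda>t. F (inverse (real (Suc n))) R t - ?Y t) has_real_derivative
            (LINT x|lborel. rhs r x * scaled_weight \<alpha> (inverse (real (Suc n))) R x) - b r * F 0 R r) (at r)"
          using R r by (intro DERIV_diff F_deriv integral_primitive_derivative[OF bF]) auto
        moreover have "(LINT x|lborel. rhs r x * scaled_weight \<alpha> (inverse (real (Suc n))) R x) - b r * F 0 R r \<le> 0"
          using up[of "inverse (real (Suc n))" R r] R r by (simp add: b_def)
        ultimately show "\<exists>y. ((\<lambda>t. F (inverse (real (Suc n))) R t - ?Y t) has_real_derivative y) (at r) \<and> y \<le> 0" by blast
      next
        show "continuous_on {s..t} (\<lambda>t. F (inverse (real (Suc n))) R t - ?Y t)"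
          by (intro continuous_intros continuous_on_subset[OF integral_primitive_continuous[OF bF]]
              continuous_on_subset[OF F_cont[OF _ R]]) (use that in auto)
      qed
      then show "\<exists>N. \<forall>n\<ge>N. F (inverse (real (Suc n))) R t - ?Y t \<le> F (inverse (real (Suc n))) R s - ?Y s"
        by blast
      show "(\<lambda>n. F (inverse (real (Suc n))) R s - ?Y s) \<longlonglongrightarrow> F 0 R s - ?Y s"
        using that R by (intro tendsto_intros F_tendsto) auto
      show "(\<lambda>n. F (inverse (real (Suc n))) R t - ?Y t) \<longlonglongrightarrow> F 0 R t - ?Y t"
        using that R by (intro tendsto_intros F_tendsto) auto
    qed
    have B: "integral {0..t} b = C * R powr - \<alpha> * integral {0..t} \<kappa>" for t
      unfolding b_def by (simp add: mult.commute)
    show "F 0 R t * exp (- (C * R powr - \<alpha> * integral {0..t} \<kappa>)) \<le> F 0 R s * exp (- (C * R powr - \<alpha> * integral {0..s} \<kappa>))"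
      using gronwall_upper[OF F0_cont b_cont b_nonneg le st] by (simp add: B)
  next
    fix R t :: real assume R: "R > 0" and t: "0 \<le> t"
    define p where "p r = \<kappa> r * (C * R powr - \<alpha>) + \<phi> U / U * h r" for r
    have p_cont: "continuous_on {0..} p" unfolding p_def by (intro continuous_intros \<kappa>_cont h_cont)
    have p_nonneg: "p r \<ge> 0" if "r \<ge> 0" for r
      using \<kappa>_nonneg[OF that] h_nonneg[OF that] C U_pos \<phi>_nonneg[of U] by (simp add: p_def)
    have F0_cont: "continuous_on {0..} (F 0 R)" by (rule F_cont[OF order_refl R])
    have pF: "continuous_on {0..} (\<lambda>r. p r * F 0 R r)" by (intro continuous_intros p_cont F0_cont)
    let ?Z = "\<lambda>t. integral {0..t} (\<lambda>r. p r * F 0 R r)"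
    have le: "F 0 R s + ?Z s \<le> F 0 R t + ?Z t" if "0 \<le> s" "s \<le> t" for s t
    proof (rule LIMSEQ_le)
      have "F (inverse (real (Suc n))) R s + ?Z s \<le> F (inverse (real (Suc n))) R t + ?Z t" for n
      proof (rule DERIV_nonneg_imp_increasing_open[OF that(2)])
        fix r assume "s < r" "r < t"
        then have r: "r > 0" using that by simp
        have "((\<lambda>t. F (inverse (real (Suc n))) R t + ?Z t) has_real_derivative
            (LINT x|lborel. rhs r x * scaled_weight \<alpha> (inverse (real (Suc n))) R x) + p r * F 0 R r) (at r)"
          using R r by (intro DERIV_add F_deriv integral_primitive_derivative[OF pF]) auto
        moreover have "(LINT x|lborel. rhs r x * scaled_weight \<alpha> (inverse (real (Suc n))) R x) + p r * F 0 R r \<ge> 0"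
          using lo[of "inverse (real (Suc n))" R r] R r by (simp add: p_def)
        ultimately show "\<exists>y. ((\<lambda>t. F (inverse (real (Suc n))) R t + ?Z t) has_real_derivative y) (at r) \<and> y \<ge> 0" by blast
      next
        show "continuous_on {s..t} (\<lambda>t. F (inverse (real (Suc n))) R t + ?Z t)"
          by (intro continuous_intros continuous_on_subset[OF integral_primitive_continuous[OF pF]]
              continuous_on_subset[OF F_cont[OF _ R]]) (use that in auto)
      qed
      then show "\<exists>N. \<forall>n\<ge>N. F (inverse (real (Suc n))) R s + ?Z s \<le> F (inverse (real (Suc n))) R t + ?Z t"
        by blast
      show "(\<lambda>n. F (inverse (real (Suc n))) R s + ?Z s) \<longlonglongrightarrow> F 0 R s + ?Z s"
        using that R by (intro tendsto_intros F_tendsto) auto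
      show "(\<lambda>n. F (inverse (real (Suc n))) R t + ?Z t) \<longlonglongrightarrow> F 0 R t + ?Z t"
        using that R by (intro tendsto_intros F_tendsto) auto
    qed
    have P: "integral {0..t} p = C * R powr - \<alpha> * integral {0..t} \<kappa> + \<phi> U / U * integral {0..t} h"
      unfolding p_def
      using U_pos
      by (subst integral_add) (auto intro!: integrable_0t continuous_intros \<kappa>_cont h_cont simp: mult.commute)
    show "F 0 R 0 \<le> F 0 R t * exp (C * R powr - \<alpha> * integral {0..t} \<kappa> + \<phi> U / U * integral {0..t} h)"
      using gronwall_lower[OF F0_cont p_cont p_nonneg le order_refl t] by (simp add: P)
  qed
qed

section \<open>From the weighted mass to the total mass\<close>

definition M :: "real \<Rightarrow> real" where "M t = (LINT x|lborel. u t x)"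

lemma M_nonneg: "t \<ge> 0 \<Longrightarrow> M t \<ge> 0"
  unfolding M_def by (intro Bochner_Integration.integral_nonneg u_nonneg)

lemma scaled_weight_le_1: "scaled_weight \<alpha> 0 R x \<le> 1"
  using tail_weight_le_1[OF \<alpha>(1)] by (simp add: scaled_weight_0)

text \<open>Integrability matters: otherwise the total mass is 0 by convention and could lie below
  the weighted mass.\<close>

lemma F_le_M:
  assumes "t \<ge> 0" "integrable lborel (u t)" shows "F 0 R t \<le> M t"
  unfolding F_def M_def
proof (rule integral_mono'[OF assms(2)])
  fix x
  show "u t x * scaled_weight \<alpha> 0 R x \<le> u t x"
    using mult_left_mono[OF scaled_weight_le_1 u_nonneg[OF assms(1)]] by simp
qed (rule u_nonneg[OF assms(1)])

lemma weight_at_infinity: "(\<lambda>n. scaled_weight \<alpha> 0 (real (Suc n)) x) \<longlonglongrightarrow> 1"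
  unfolding scaled_weight_0
  by (intro tail_weight_tendsto_1 filterlim_compose[OF filterlim_real_sequentially filterlim_Suc])

lemma powr_at_infinity: "(\<lambda>n. C * real (Suc n) powr - \<alpha> * c) \<longlonglongrightarrow> 0"
proof -
  have "(\<lambda>n. real (Suc n) powr - \<alpha>) \<longlonglongrightarrow> 0"
    using \<alpha> by (intro tendsto_neg_powr filterlim_compose[OF filterlim_real_sequentially filterlim_Suc]) auto
  then have "(\<lambda>n. C * real (Suc n) powr - \<alpha> * c) \<longlonglongrightarrow> C * 0 * c" by (intro tendsto_intros)
  then show ?thesis by simp
qed

text \<open>Fatou's lemma along R = n + 1: the weights increase the weighted mass at most by a
  factor tending to 1, so the extended integral of u t is at most M s. Working with values in
  \<open>ennreal\<close> yields integrability at time t and the inequality at once.\<close>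

lemma mass_decreasing:
  assumes st: "0 \<le> s" "s \<le> t" and int: "integrable lborel (u s)"
  shows "integrable lborel (u t)" "M t \<le> M s"
proof -
  have t: "t \<ge> 0" using st by simp
  obtain C where C: "C \<ge> 0" and up: "\<And>R s t. R > 0 \<Longrightarrow> 0 \<le> s \<Longrightarrow> s \<le> t \<Longrightarrow>
      F 0 R t * exp (- (C * R powr - \<alpha> * integral {0..t} \<kappa>)) \<le> F 0 R s * exp (- (C * R powr - \<alpha> * integral {0..s} \<kappa>))"
    by (rule F_growth) (rule that)
  define e where "e n = C * real (Suc n) powr - \<alpha> * integral {0..t} \<kappa>" for n
  have F_le: "F 0 (real (Suc n)) t \<le> M s * exp (e n)" for n
  proof -
    have "0 \<le> C * real (Suc n) powr - \<alpha> * integral {0..s} \<kappa>"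
      using C integral_primitive_nonneg_mono(1)[OF \<kappa>_cont \<kappa>_nonneg st] by simp
    then have "F 0 (real (Suc n)) s * exp (- (C * real (Suc n) powr - \<alpha> * integral {0..s} \<kappa>)) \<le> M s * 1"
      by (intro mult_mono F_le_M int st M_nonneg) auto
    then have "F 0 (real (Suc n)) t * exp (- e n) \<le> M s"
      using up[of "real (Suc n)" s t] st by (simp add: e_def)
    then show ?thesis by (simp add: exp_minus field_simps)
  qed
  have meas: "(\<lambda>x. ennreal (u t x * scaled_weight \<alpha> 0 (real (Suc n)) x)) \<in> borel_measurable lborel" for n
    using u_measurable[OF t] by simp
  have "(\<integral>\<^sup>+x. ennreal (u t x) \<partial>lborel)
      = (\<integral>\<^sup>+x. liminf (\<lambda>n. ennreal (u t x * scaled_weight \<alpha> 0 (real (Suc n)) x)) \<partial>lborel)"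
  proof (intro nn_integral_cong)
    fix x
    have "(\<lambda>n. ennreal (u t x * scaled_weight \<alpha> 0 (real (Suc n)) x)) \<longlonglongrightarrow> ennreal (u t x * 1)"
      by (intro tendsto_ennrealI tendsto_intros weight_at_infinity)
    then show "ennreal (u t x) = liminf (\<lambda>n. ennreal (u t x * scaled_weight \<alpha> 0 (real (Suc n)) x))"
      by (simp add: lim_imp_Liminf)
  qed
  also have "\<dots> \<le> liminf (\<lambda>n. \<integral>\<^sup>+x. ennreal (u t x * scaled_weight \<alpha> 0 (real (Suc n)) x) \<partial>lborel)"
    by (rule nn_integral_liminf[OF meas])
  also have "\<dots> \<le> liminf (\<lambda>n. ennreal (M s * exp (e n)))"
  proof (rule Liminf_mono, rule always_eventually, rule allI)
    fix n
    have "(\<integral>\<^sup>+x. ennreal (u t x * scaled_weight \<alpha> 0 (real (Suc n)) x) \<partial>lborel) = ennreal (F 0 (real (Suc n)) t)"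
      unfolding F_def
      by (rule nn_integral_eq_integral[OF u_weight_integrable]) (use t u_nonneg in auto)
    then show "(\<integral>\<^sup>+x. ennreal (u t x * scaled_weight \<alpha> 0 (real (Suc n)) x) \<partial>lborel) \<le> ennreal (M s * exp (e n))"
      using F_le[of n] by (simp add: ennreal_leI)
  qed
  also have "\<dots> = ennreal (M s)"
  proof -
    have "(\<lambda>n. ennreal (M s * exp (e n))) \<longlonglongrightarrow> ennreal (M s * exp 0)"
      unfolding e_def by (intro tendsto_ennrealI tendsto_intros powr_at_infinity)
    then show ?thesis by (simp add: lim_imp_Liminf)
  qed
  finally have le: "(\<integral>\<^sup>+x. ennreal (u t x) \<partial>lborel) \<le> ennreal (M s)" .
  show int_t: "integrable lborel (u t)"
    using le u_measurable[OF t] u_nonneg[OF t]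
    by (intro integrableI_nonneg) (auto simp: order.strict_trans1[OF le])
  show "M t \<le> M s"
    using le nn_integral_eq_integral[OF int_t] u_nonneg[OF t] M_nonneg[OF st(1)]
    by (simp add: M_def)
qed

lemma u_integrable: "t \<ge> 0 \<Longrightarrow> integrable lborel (u t)"
proof -
  have "u 0 = u0" by (simp add: fun_eq_iff u_init)
  then show "t \<ge> 0 \<Longrightarrow> integrable lborel (u t)" using mass_decreasing(1)[of 0 t] u0_int by simp
qed

text \<open>Only the weighted mass at time 0 is sent to its limit, by dominated convergence with
  \<open>u 0\<close>; at time t it is simply replaced by the larger M t.\<close>

lemma mass_lower_bound:
  assumes t: "t \<ge> 0"
  shows "M 0 * exp (- (\<phi> U / U) * integral {0..t} h) \<le> M t"
proof -
  obtain C where C: "C \<ge> 0" and lo: "\<And>R t. R > 0 \<Longrightarrow> 0 \<le> t \<Longrightarrow>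
      F 0 R 0 \<le> F 0 R t * exp (C * R powr - \<alpha> * integral {0..t} \<kappa> + \<phi> U / U * integral {0..t} h)"
    by (rule F_growth) (rule that)
  let ?H = "\<phi> U / U * integral {0..t} h"
  have "M 0 \<le> M t * exp (0 + ?H)"
  proof (rule LIMSEQ_le)
    show "(\<lambda>n. F 0 (real (Suc n)) 0) \<longlonglongrightarrow> M 0"
      unfolding F_def M_def
    proof (rule integral_dominated_convergence[where w="u 0"])
      show "AE x in lborel. (\<lambda>n. u 0 x * scaled_weight \<alpha> 0 (real (Suc n)) x) \<longlonglongrightarrow> u 0 x"
        using tendsto_mult_left[OF weight_at_infinity, of "u 0 _"] by (intro AE_I2) force
      show "AE x in lborel. norm (u 0 x * scaled_weight \<alpha> 0 (real (Suc n)) x) \<le> u 0 x" for n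
        using mult_left_mono[OF scaled_weight_le_1 u_nonneg[of 0]] u_nonneg[of 0]
        by (intro AE_I2) (simp add: abs_mult)
    qed (use u_measurable[of 0] u_integrable[of 0] in auto)
    show "(\<lambda>n. M t * exp (C * real (Suc n) powr - \<alpha> * integral {0..t} \<kappa> + ?H)) \<longlonglongrightarrow> M t * exp (0 + ?H)"
      by (intro tendsto_intros powr_at_infinity)
    have "F 0 (real (Suc n)) 0 \<le> M t * exp (C * real (Suc n) powr - \<alpha> * integral {0..t} \<kappa> + ?H)" for n
      using lo[of "real (Suc n)" t] t
        mult_right_mono[OF F_le_M[OF t u_integrable[OF t]], of "exp (C * real (Suc n) powr - \<alpha> * integral {0..t} \<kappa> + ?H)"]
      by (intro order_trans[OF lo]) auto
    then show "\<exists>N. \<forall>n\<ge>N. F 0 (real (Suc n)) 0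
        \<le> M t * exp (C * real (Suc n) powr - \<alpha> * integral {0..t} \<kappa> + ?H)" by blast
  qed
  then show ?thesis by (simp add: exp_minus field_simps)
qed

lemma mass_limit: "\<exists>Minf. (M \<longlongrightarrow> Minf) at_top"
proof
  have bdd: "bdd_below (M ` {0..})" using M_nonneg by (auto intro!: bdd_belowI)
  show "(M \<longlongrightarrow> Inf (M ` {0..})) at_top"
  proof (rule decreasing_tendsto)
    show "\<forall>\<^sub>F t in at_top. Inf (M ` {0..}) \<le> M t"
      using eventually_ge_at_top[of 0] by eventually_elim (auto intro!: cInf_lower bdd)
    fix y assume "Inf (M ` {0..}) < y"
    then obtain s where s: "s \<ge> 0" "M s < y" by (subst (asm) cInf_less_iff) (auto intro: bdd)
    show "\<forall>\<^sub>F t in at_top. M t < y"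
      using eventually_ge_at_top[of s]
    proof eventually_elim
      case (elim t)
      then show ?case using mass_decreasing(2)[OF s(1) elim u_integrable[OF s(1)]] s(2) by simp
    qed
  qed
qed

lemma h_set_integral: "(LINT s:{0..t}|lborel. h s) = integral {0..t} h"
proof (rule set_borel_integral_eq_integral)
  show "set_integrable lborel {0..t} h"
    unfolding set_integrable_def
    by (intro borel_integrable_compact continuous_on_subset[OF h_cont]) auto
qed

lemma h_integral_le:
  assumes fin: "(\<integral>\<^sup>+s\<in>{0..}. ennreal (h s) \<partial>lborel) < \<infinity>" and t: "t \<ge> 0"
  shows "integral {0..t} h \<le> enn2real (\<integral>\<^sup>+s\<in>{0..}. ennreal (h s) \<partial>lborel)"
proof -
  have i: "(h has_integral integral {0..t} h) {0..t}"
    by (intro integrable_integral integrable_continuous_real continuous_on_subset[OF h_cont]) auto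
  have "ennreal (integral {0..t} h) = (\<integral>\<^sup>+s. ennreal (indicator {0..t} s * h s) \<partial>lborel)"
    using nn_integral_has_integral_lebesgue[OF _ i] h_nonneg by simp
  also have "\<dots> \<le> (\<integral>\<^sup>+s\<in>{0..}. ennreal (h s) \<partial>lborel)"
    by (intro nn_integral_mono) (auto simp: indicator_def)
  finally have "enn2real (ennreal (integral {0..t} h)) \<le> enn2real (\<integral>\<^sup>+s\<in>{0..}. ennreal (h s) \<partial>lborel)"
    using fin by (intro enn2real_mono) auto
  moreover have "integral {0..t} h \<ge> 0"
    by (rule integral_primitive_nonneg_mono(1)[OF h_cont h_nonneg t order_refl])
  ultimately show ?thesis by simp
qed

end

theorem theorem2:
  fixes \<alpha> :: real
    and \<phi> h k :: "real \<Rightarrow> real"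
    and u0 :: "'a::euclidean_space \<Rightarrow> real"
    and u :: "real \<Rightarrow> 'a \<Rightarrow> real"
  assumes "0 < \<alpha>" and "\<alpha> < 2"
    and "convex_on UNIV \<phi>" and "\<phi> differentiable_on UNIV" and "\<And>x. \<phi> x \<ge> 0"
    and "\<phi> 0 = 0" and "\<And>x. x \<noteq> 0 \<Longrightarrow> \<phi> x > 0"
    and "continuous_on {0..} h" and "\<And>t. t \<ge> 0 \<Longrightarrow> h t \<ge> 0" and "\<And>t. t > 0 \<Longrightarrow> h t > 0"
    and "continuous_on {0..} k" and "\<And>t. t \<ge> 0 \<Longrightarrow> k t \<ge> 0"
    and "\<And>T. T > 0 \<Longrightarrow> (SUP t\<in>{0..T}. neg_power_integral \<alpha> k t) < \<infinity>"
    and "u0 \<in> Cb" and "integrable lborel u0"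
    and "\<And>x. u0 x \<ge> 0" and "L1_norm u0 > 0"
    and "classical_solution \<alpha> k h \<phi> u0 u"
  shows "(\<forall>t\<ge>0. (LINT x|lborel. u t x)
            \<ge> L1_norm u0 * exp (- (\<phi> (unif_norm u0) / unif_norm u0) * (LINT s:{0..t}|lborel. h s)))
       \<and> (\<exists>Minf :: real. ((\<lambda>t. LINT x|lborel. u t x) \<longlongrightarrow> Minf) at_top
            \<and> ((\<integral>\<^sup>+s\<in>{0..}. ennreal (h s) \<partial>lborel) < \<infinity> \<longrightarrow> Minf > 0))"
proof -
  interpret fractional_absorption \<alpha> \<phi> h k u0 u
    by unfold_locales (use assms in auto)
  have lower: "L1_norm u0 * exp (- (\<phi> U / U) * (LINT s:{0..t}|lborel. h s)) \<le> M t" if "t \<ge> 0" for t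
    using mass_lower_bound[OF that] by (simp add: h_set_integral u0_integral M_def)
  obtain Minf where Minf: "(M \<longlongrightarrow> Minf) at_top" using mass_limit by blast
  have "Minf > 0" if fin: "(\<integral>\<^sup>+s\<in>{0..}. ennreal (h s) \<partial>lborel) < \<infinity>"
  proof -
    \<comment> \<open>Nonnegativity of h bounds the exponent uniformly in t, so the limit inherits
      this positive lower bound.\<close>
    let ?m = "L1_norm u0 * exp (- (\<phi> U / U) * enn2real (\<integral>\<^sup>+s\<in>{0..}. ennreal (h s) \<partial>lborel))"
    have "?m \<le> M t" if "t \<ge> 0" for t
    proof -
      have "\<phi> U / U * integral {0..t} h \<le> \<phi> U / U * enn2real (\<integral>\<^sup>+s\<in>{0..}. ennreal (h s) \<partial>lborel)"
        using U_pos \<phi>_nonneg[of U] by (intro mult_left_mono h_integral_le fin that) auto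
      then have "?m \<le> L1_norm u0 * exp (- (\<phi> U / U) * (LINT s:{0..t}|lborel. h s))"
        using u0_pos by (simp add: h_set_integral)
      then show ?thesis using lower[OF that] by linarith
    qed
    then have "?m \<le> Minf"
      by (intro tendsto_lowerbound[OF Minf]) (auto intro: eventually_mono[OF eventually_ge_at_top[of 0]])
    moreover have "?m > 0" using u0_pos by simp
    ultimately show ?thesis by linarith
  qed
  then show ?thesis using lower Minf unfolding M_def by blast
qed

end
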